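(* Let $X^N=(X^N_0,\dots,X^N_d)$ be the Markov process described in the context, with initial state $X^N(0)=(0,\dots,0,F_N)$. Let $P=(P_{ij},1\le i,j\le d-1)$ be the matrix with $P_{i,i-1}=1$ for $2\le i\le d-1$ and all other entries equal to $0$. Let $S(t)=(s_k(t),1\le k\le d-1)$ be (the first component of) the unique solution of the generalized Skorohod problem associated to the matrix $P$ and the functional $h\mapsto G(h,\beta,\lambda)$ defined in the context. Then, as $N\to\infty$, the sequence of processes $$\left(\frac{X_k^{N}(t)}{N},\,0\leq k\leq d\right)$$ converges in distribution, uniformly on compact sets, to $(x_k(t),0\le k\le d)$ defined by $$x_0(t)=\mu\int_0^t s_1(u)\,du,\qquad x_1(t)=s_1(t),$$ $$x_k(t)=s_k(t)-s_{k-1}(t),\quad 2\leq k\leq d-1,\qquad x_d(t)=\beta-s_{d-1}(t)-x_0(t).$$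
   Context: Model. Fix real numbers $\lambda,\mu>0$ and an integer $d\ge 2$. For each integer $N\ge1$ let $F_N\in\mathbb{N}$, and assume there are $\beta>0$ and $\gamma\ge 0$ with $\lim_{N\to\infty}(F_N-N\beta)/\sqrt N=\gamma$. The process $X^N(t)=(X^N_0(t),\dots,X^N_d(t))$ is the continuous-time Markov jump process on $\{x=(x_0,\dots,x_d)\in\mathbb{N}^{d+1}:\sum_i x_i=F_N\}$ with the following transitions ($e_0,\dots,e_d$ are the unit vectors): (loss) for $1\le k\le d$, $x\to x-e_k+e_{k-1}$ at rate $\mu k x_k$; (duplication) for $1\le k\le d-1$, $x\to x-e_k+e_{k+1}$ at rate $\lambda N$ if $x_k>0$ and $x_i=0$ for all $1\le i<k$, and at rate $0$ otherwise. Functional $G$. For $h=(h_1,\dots,h_{d-1})\in\mathcal D(\mathbb{R}_+,\mathbb{R}^{d-1})$ (càdlàg functions), $\eta>0$ and $F\ge 0$, set $G(h,F,\eta)=(G_k(h,F,\eta),1\le k\le d-1)$, where for $1\le k\le d-2$ $$G_k(h,F,\eta)(t)=\mu\int_0^t\big((k+1)h_{k+1}(u)-(k+1)h_k(u)-h_1(u)\big)\,du-\eta t\,\mathbf 1_{\{k=1\}},$$ $$G_{d-1}(h,F,\eta)(t)=d\mu\int_0^t\Big[F-h_{d-1}(u)-\mu\int_0^u h_1(v)\,dv\Big]du-\mu\int_0^t h_1(u)\,du-\eta t\,\mathbf 1_{\{d=2\}}.$$ Generalized Skorohod problem. For $K\ge1$, a functional $G:\mathcal D(\mathbb{R}_+,\mathbb{R}^K)\to\mathcal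 D(\mathbb{R}_+,\mathbb{R}^K)$ and a non-negative $K\times K$ matrix $P$, a couple of functions $((X(t)),(R(t)))$ with values in $\mathbb{R}^K$ is a solution of the generalized Skorohod problem associated to $G$ and $P$ if: (1) $X(t)=G(X)(t)+(I-P)R(t)$ for all $t\ge0$; (2) $X_k(t)\ge0$ for all $t\ge0$ and $1\le k\le K$; (3) for $1\le k\le K$, $t\mapsto R_k(t)$ is non-decreasing, $R_k(0)=0$ and $\int_{\mathbb{R}_+}X_k(t)\,dR_k(t)=0$. Convergence in distribution of processes is understood on the space of càdlàg functions with the topology of uniform convergence on compact sets. *)

theory Defs
  imports "HOL-Probability.Probability"
begin

definition natural_filtration ::
    "'w measure \<Rightarrow> (real \<Rightarrow> 'w \<Rightarrow> 's) \<Rightarrow> real \<Rightarrow> 'w measure" where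
  "natural_filtration M X s =
     sigma (space M) (\<Union>u\<in>{0..s}. {X u -` A \<inter> space M |A. True})"

text \<open>
  \<open>q x y\<close> is the jump rate from \<open>x\<close> to \<open>y \<noteq> x\<close>; the diagonal of \<open>q\<close> is irrelevant. As \<open>E\<close> is
  finite, the four conditions determine \<open>p t\<close> on \<open>E\<close>: it is the exponential of \<open>t\<close> times the
  generator of \<open>q\<close>.
\<close>

definition transition_function ::
    "'s set \<Rightarrow> ('s \<Rightarrow> 's \<Rightarrow> real) \<Rightarrow> (real \<Rightarrow> 's \<Rightarrow> 's \<Rightarrow> real) \<Rightarrow> bool" where
  "transition_function E q p \<longleftrightarrow>
     (\<forall>t\<ge>0. \<forall>x\<in>E. (\<forall>y\<in>E. 0 \<le> p t x y) \<and> (\<Sum>y\<in>E. p t x y) = 1) \<and>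
     (\<forall>x\<in>E. \<forall>y\<in>E. p 0 x y = of_bool (x = y)) \<and>
     (\<forall>s\<ge>0. \<forall>t\<ge>0. \<forall>x\<in>E. \<forall>y\<in>E. p (s + t) x y = (\<Sum>z\<in>E. p s x z * p t z y)) \<and>
     (\<forall>x\<in>E. \<forall>y\<in>E. x \<noteq> y \<longrightarrow>
        ((\<lambda>t. p t x y) has_real_derivative q x y) (at 0 within {0..}))"

text \<open>
  The third and fourth conjuncts say that the paths are cadlag for the discrete topology on
  \<open>E\<close>; the last one is the Markov property.
\<close>

definition markov_jump_process ::
    "'w measure \<Rightarrow> 's set \<Rightarrow> ('s \<Rightarrow> 's \<Rightarrow> real) \<Rightarrow> (real \<Rightarrow> 'w \<Rightarrow> 's) \<Rightarrow> bool" where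
  "markov_jump_process M E q X \<longleftrightarrow>
     prob_space M \<and> finite E \<and>
     (\<forall>t\<ge>0. X t \<in> measurable M (count_space E)) \<and>
     (\<forall>\<omega>\<in>space M. \<forall>t\<ge>0. \<forall>\<^sub>F u in at_right t. X u \<omega> = X t \<omega>) \<and>
     (\<forall>\<omega>\<in>space M. \<forall>t>0. \<exists>y. \<forall>\<^sub>F u in at_left t. X u \<omega> = y) \<and>
     (\<exists>p. transition_function E q p \<and>
       (\<forall>s\<ge>0. \<forall>t\<ge>s. \<forall>y\<in>E. AE \<omega> in M.
          real_cond_exp M (natural_filtration M X s)
            (indicator {\<omega> \<in> space M. X t \<omega> = y}) \<omega> = p (t - s) (X s \<omega>) y))"

text \<open>States are functions vanishing outside \<open>{0..d}\<close>.\<close>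

definition states :: "nat \<Rightarrow> nat \<Rightarrow> (nat \<Rightarrow> nat) set" where
  "states d F = {x. (\<forall>i>d. x i = 0) \<and> (\<Sum>i\<le>d. x i) = F}"

definition move :: "nat \<Rightarrow> nat \<Rightarrow> (nat \<Rightarrow> nat) \<Rightarrow> (nat \<Rightarrow> nat)" where
  "move k l x = x(k := x k - 1, l := x l + 1)"

text \<open>
  The truncated subtraction in \<open>move k l x\<close> is harmless: it is used for \<open>l \<noteq> k\<close> and with a positive
  rate only if \<open>x k > 0\<close>.
\<close>

definition jump_rate ::
    "nat \<Rightarrow> real \<Rightarrow> real \<Rightarrow> nat \<Rightarrow> (nat \<Rightarrow> nat) \<Rightarrow> (nat \<Rightarrow> nat) \<Rightarrow> real" where
  "jump_rate d lam mu N x y =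
     (\<Sum>k\<in>{1..d}. mu * real k * real (x k) * of_bool (y = move k (k - 1) x)) +
     (\<Sum>k\<in>{1..d - 1}. lam * real N *
        of_bool (x k > 0 \<and> (\<forall>i\<in>{1..<k}. x i = 0) \<and> y = move k (k + 1) x))"

definition cadlag :: "(real \<Rightarrow> real) \<Rightarrow> bool" where
  "cadlag f \<longleftrightarrow> (\<forall>t\<ge>0. (f \<longlongrightarrow> f t) (at_right t)) \<and> (\<forall>t>0. \<exists>l. (f \<longlongrightarrow> l) (at_left t))"

text \<open>A path maps a time in \<open>{0..}\<close> to a vector with coordinates in \<open>I\<close>.\<close>

definition cadlag_paths :: "nat set \<Rightarrow> (real \<Rightarrow> nat \<Rightarrow> real) set" where
  "cadlag_paths I = {x \<in> {0..} \<rightarrow>\<^sub>E (I \<rightarrow>\<^sub>E UNIV). \<forall>k\<in>I. cadlag (\<lambda>t. x t k)}"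

definition cadlag_space :: "nat set \<Rightarrow> (real \<Rightarrow> nat \<Rightarrow> real) measure" where
  "cadlag_space I =
     restrict_space (\<Pi>\<^sub>M t\<in>{0..}. \<Pi>\<^sub>M k\<in>I. (borel :: real measure)) (cadlag_paths I)"

definition ucc_open :: "nat set \<Rightarrow> (real \<Rightarrow> nat \<Rightarrow> real) set \<Rightarrow> bool" where
  "ucc_open I U \<longleftrightarrow> U \<subseteq> cadlag_paths I \<and>
     (\<forall>x\<in>U. \<exists>T. \<exists>\<epsilon>>0. \<forall>y\<in>cadlag_paths I.
        (\<forall>t\<in>{0..T}. \<forall>k\<in>I. \<bar>y t k - x t k\<bar> < \<epsilon>) \<longrightarrow> y \<in> U)"

definition ucc_topology :: "nat set \<Rightarrow> (real \<Rightarrow> nat \<Rightarrow> real) topology" where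
  "ucc_topology I = topology (ucc_open I)"

lemma istopology_ucc_open: "istopology (ucc_open I)"
  unfolding istopology_def
proof (intro conjI allI impI)
  fix U V assume U: "ucc_open I U" and V: "ucc_open I V"
  show "ucc_open I (U \<inter> V)"
    unfolding ucc_open_def
  proof (intro conjI ballI)
    show "U \<inter> V \<subseteq> cadlag_paths I"
      using U by (auto simp: ucc_open_def)
  next
    fix x assume x: "x \<in> U \<inter> V"
    obtain T e where e: "e > 0" "\<And>y. y \<in> cadlag_paths I \<Longrightarrow>
        (\<forall>t\<in>{0..T}. \<forall>k\<in>I. \<bar>y t k - x t k\<bar> < e) \<Longrightarrow> y \<in> U"
      using U x unfolding ucc_open_def by (metis IntD1)
    obtain T' e' where e': "e' > 0" "\<And>y. y \<in> cadlag_paths I \<Longrightarrow>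
        (\<forall>t\<in>{0..T'}. \<forall>k\<in>I. \<bar>y t k - x t k\<bar> < e') \<Longrightarrow> y \<in> V"
      using V x unfolding ucc_open_def by (metis IntD2)
    have "y \<in> U \<inter> V" if "y \<in> cadlag_paths I"
        "\<forall>t\<in>{0..max T T'}. \<forall>k\<in>I. \<bar>y t k - x t k\<bar> < min e e'" for y
      using that by (auto intro!: e(2) e'(2))
    moreover have "min e e' > 0" using e(1) e'(1) by simp
    ultimately show "\<exists>T. \<exists>\<epsilon>>0. \<forall>y\<in>cadlag_paths I.
        (\<forall>t\<in>{0..T}. \<forall>k\<in>I. \<bar>y t k - x t k\<bar> < \<epsilon>) \<longrightarrow> y \<in> U \<inter> V"
      by blast
  qed
next
  fix \<U> assume *: "\<forall>U\<in>\<U>. ucc_open I U"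
  show "ucc_open I (\<Union>\<U>)"
    unfolding ucc_open_def
  proof (intro conjI ballI)
    show "\<Union>\<U> \<subseteq> cadlag_paths I"
      using * by (auto simp: ucc_open_def)
  next
    fix x assume "x \<in> \<Union>\<U>"
    then obtain U where U: "U \<in> \<U>" "x \<in> U" by blast
    then have "ucc_open I U" using * by blast
    then obtain T e where "e > 0" "\<forall>y\<in>cadlag_paths I.
        (\<forall>t\<in>{0..T}. \<forall>k\<in>I. \<bar>y t k - x t k\<bar> < e) \<longrightarrow> y \<in> U"
      using U(2) unfolding ucc_open_def by metis
    with U(1) show "\<exists>T. \<exists>\<epsilon>>0. \<forall>y\<in>cadlag_paths I.
        (\<forall>t\<in>{0..T}. \<forall>k\<in>I. \<bar>y t k - x t k\<bar> < \<epsilon>) \<longrightarrow> y \<in> \<Union>\<U>"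
      by blast
  qed
qed

lemma openin_ucc_topology: "openin (ucc_topology I) = ucc_open I"
  by (simp add: ucc_topology_def istopology_ucc_open topology_inverse')

lemma topspace_ucc_topology: "topspace (ucc_topology I) = cadlag_paths I"
proof -
  have "ucc_open I (cadlag_paths I)"
    unfolding ucc_open_def using zero_less_one by blast
  moreover have "U \<subseteq> cadlag_paths I" if "ucc_open I U" for U
    using that by (simp add: ucc_open_def)
  ultimately show ?thesis
    unfolding topspace_def openin_ucc_topology by blast
qed

text \<open>
  The topology of uniform convergence on compact sets is not separable, and a jump process need not
  be measurable for its Borel \<open>\<sigma>\<close>-algebra. As usual in this situation (Billingsley, Pollard), laws
  live on the \<open>\<sigma>\<close>-algebra generated by the evaluations, and the test functions are the bounded
  continuous functions that are measurable for it.
\<close>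

definition converge_in_law ::
    "nat set \<Rightarrow> (nat \<Rightarrow> (real \<Rightarrow> nat \<Rightarrow> real) measure) \<Rightarrow> (real \<Rightarrow> nat \<Rightarrow> real) measure \<Rightarrow> bool" where
  "converge_in_law I Q Q' \<longleftrightarrow>
     (\<forall>f :: (real \<Rightarrow> nat \<Rightarrow> real) \<Rightarrow> real.
        f \<in> borel_measurable (cadlag_space I) \<and>
        continuous_map (ucc_topology I) euclidean f \<and>
        bounded (f ` cadlag_paths I) \<longrightarrow>
        (\<lambda>N. \<integral>x. f x \<partial>Q N) \<longlonglongrightarrow> (\<integral>x. f x \<partial>Q'))"

text \<open>
  \<open>R\<close> is required to be cadlag so that its Stieltjes measure is defined; \<open>max 0\<close> extends it by
  \<open>R 0 = 0\<close> to negative times, so the measure has no atom at \<open>0\<close>.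
\<close>

definition skorohod_solution ::
    "nat \<Rightarrow> ((real \<Rightarrow> nat \<Rightarrow> real) \<Rightarrow> real \<Rightarrow> nat \<Rightarrow> real) \<Rightarrow> (nat \<Rightarrow> nat \<Rightarrow> real) \<Rightarrow>
     (real \<Rightarrow> nat \<Rightarrow> real) \<Rightarrow> (real \<Rightarrow> nat \<Rightarrow> real) \<Rightarrow> bool" where
  "skorohod_solution K G P X R \<longleftrightarrow>
     (\<forall>k\<in>{1..K}. cadlag (\<lambda>t. X t k) \<and> cadlag (\<lambda>t. R t k)) \<and>
     (\<forall>t\<ge>0. \<forall>k\<in>{1..K}. X t k = G X t k + (\<Sum>j\<in>{1..K}. (of_bool (k = j) - P k j) * R t j)) \<and>
     (\<forall>t\<ge>0. \<forall>k\<in>{1..K}. 0 \<le> X t k) \<and>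
     (\<forall>k\<in>{1..K}. mono_on {0..} (\<lambda>t. R t k) \<and> R 0 k = 0 \<and>
        (\<integral>\<^sup>+t\<in>{0..}. ennreal (X t k) \<partial>interval_measure (\<lambda>t. R (max 0 t) k)) = 0)"

definition G_functional ::
    "nat \<Rightarrow> real \<Rightarrow> (real \<Rightarrow> nat \<Rightarrow> real) \<Rightarrow> real \<Rightarrow> real \<Rightarrow> real \<Rightarrow> nat \<Rightarrow> real" where
  "G_functional d mu h F \<eta> t k =
     (if k = d - 1 then
        real d * mu *
          integral {0..t} (\<lambda>u. F - h u (d - 1) - mu * integral {0..u} (\<lambda>v. h v 1))
        - mu * integral {0..t} (\<lambda>u. h u 1) - \<eta> * t * of_bool (d = 2)
      else
        mu * integral {0..t} (\<lambda>u. real (k + 1) * h u (k + 1) - real (k + 1) * h u k - h u 1)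
        - \<eta> * t * of_bool (k = 1))"

definition P_matrix :: "nat \<Rightarrow> nat \<Rightarrow> real" where
  "P_matrix i j = of_bool (2 \<le> i \<and> j = i - 1)"

definition fluid_limit ::
    "nat \<Rightarrow> real \<Rightarrow> real \<Rightarrow> (real \<Rightarrow> nat \<Rightarrow> real) \<Rightarrow> real \<Rightarrow> nat \<Rightarrow> real" where
  "fluid_limit d mu \<beta> s t k =
     (if k = 0 then mu * integral {0..t} (\<lambda>u. s u 1)
      else if k = 1 then s t 1
      else if k < d then s t k - s t (k - 1)
      else \<beta> - s t (d - 1) - mu * integral {0..t} (\<lambda>u. s u 1))"

end

theory Submission
  imports Defs
begin

text \<open>
  With \<open>S_k = (x_1 + \<dots> + x_k) / N\<close> the process satisfies the equation of the Skorohod problem with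
  \<open>R_k(t) = \<lambda> \<integral>\<^sub>0\<^sup>t 1{S_k = 0}\<close>, up to \<open>F_N / N - \<beta>\<close> and martingales of quadratic variation \<open>O(1/N)\<close>:
  duplication happens at level \<open>k\<close> exactly when \<open>S_(k-1) = 0 < S_k\<close>, at rate \<open>\<lambda> (1{S_(k-1) = 0} - 1{S_k = 0})\<close>.
  The martingales are controlled on the skeleton of mesh \<open>T/k\<close>, where only the derivative of the
  transition function at \<open>0\<close> matters, and then \<open>k\<close> tends to infinity by right-continuity of the paths.
  As the matrix is bidiagonal, the reflection terms can be compared one after the other, and
  approximate solutions of the Skorohod problem are close to each other. This gives uniqueness,
  convergence of the process to the solution, and also existence: paths of the process outside an
  event of small probability form a Cauchy sequence of approximate solutions.
\<close>

section \<open>Cadlag functions\<close>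

text \<open>The duplication rates involve the indicators of S_(k-1) = 0 and S_k = 0, so the drift is
  a discontinuous function of the state and a direct Lipschitz comparison with a differential
  equation fails. Moving the time spent at 0 into R removes the discontinuity: what remains is the
  Lipschitz functional G, and of R one uses that it is monotone and does not grow while S_k is
  positive. This is why an approximate solution may violate the equation by \<epsilon> but satisfies
  the reflection condition exactly. Level 0 fits the scheme: S_0 is an empty sum, so R_0(t) =
  \<lambda> t, and this is the term - \<eta> t of G for k = 1. The coordinate x_d occurs in the
  drift of S_(d-1) and is eliminated by conservation of mass; this brings in x_0, hence the double
  integral in G, and a further martingale for x_0. Stability alone yields no existence: some
  approximate solutions must be at hand, and the processes supply them. The bound R_k(u) - R_k(t)
  \<le> \<lambda> (u - t), uniform in N, makes the limits continuous, and continuity is what carries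
  the reflection condition to the limit.\<close>

lemma cadlag_bounded:
  assumes f: "cadlag f"
  shows "\<exists>B. \<forall>t\<in>{0..T}. \<bar>f t\<bar> \<le> B"
proof (cases "0 \<le> T")
  case True
  \<comment> \<open>Bisection with local boundedness from the one-sided limits. The guard
    \<open>0 \<le> t\<close> is there because the small intervals around the point 0 reach to
    negative times, where \<open>cadlag\<close> says nothing.\<close>
  have "\<exists>B. \<forall>t\<in>{0..T}. 0 \<le> t \<longrightarrow> \<bar>f t\<bar> \<le> B"
    using True
  proof (rule Bolzano[where P="\<lambda>a b. \<exists>B. \<forall>t\<in>{a..b}. 0 \<le> t \<longrightarrow> \<bar>f t\<bar> \<le> B"])
    fix a b c :: real
    assume "\<exists>B. \<forall>t\<in>{a..b}. 0 \<le> t \<longrightarrow> \<bar>f t\<bar> \<le> B" "\<exists>B. \<forall>t\<in>{b..c}. 0 \<le> t \<longrightarrow> \<bar>f t\<bar> \<le> B"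
    then obtain B C where B: "\<forall>t\<in>{a..b}. 0 \<le> t \<longrightarrow> \<bar>f t\<bar> \<le> B"
      and C: "\<forall>t\<in>{b..c}. 0 \<le> t \<longrightarrow> \<bar>f t\<bar> \<le> C"
      by (elim exE)
    have "\<bar>f t\<bar> \<le> max B C" if "t \<in> {a..c}" "0 \<le> t" for t
      using B[rule_format, of t] C[rule_format, of t] that by (cases "t \<le> b") auto
    then show "\<exists>B. \<forall>t\<in>{a..c}. 0 \<le> t \<longrightarrow> \<bar>f t\<bar> \<le> B" by blast
  next
    fix x :: real assume x: "0 \<le> x" "x \<le> T"
    have "(f \<longlongrightarrow> f x) (at_right x)" using f x by (simp add: cadlag_def)
    then have "\<forall>\<^sub>F t in at_right x. \<bar>f t\<bar> < \<bar>f x\<bar> + 1"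
      by (intro order_tendstoD(2)[OF tendsto_rabs]) auto
    then obtain b where b: "b > x" "\<And>t. x < t \<Longrightarrow> t < b \<Longrightarrow> \<bar>f t\<bar> < \<bar>f x\<bar> + 1"
      unfolding eventually_at_right_field by blast
    have "\<exists>a<x. \<exists>C. \<forall>t. a < t \<longrightarrow> t < x \<longrightarrow> 0 \<le> t \<longrightarrow> \<bar>f t\<bar> < C"
    proof (cases "x = 0")
      case True
      then show ?thesis by (intro exI[of _ "-1"]) auto
    next
      case False
      have "0 < x" using False x by simp
      then obtain l where "(f \<longlongrightarrow> l) (at_left x)" using f unfolding cadlag_def by blast
      then have "\<forall>\<^sub>F t in at_left x. \<bar>f t\<bar> < \<bar>l\<bar> + 1"
        by (intro order_tendstoD(2)[OF tendsto_rabs]) auto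
      then show ?thesis unfolding eventually_at_left_field by blast
    qed
    then obtain a C where a: "a < x" "\<And>t. a < t \<Longrightarrow> t < x \<Longrightarrow> 0 \<le> t \<Longrightarrow> \<bar>f t\<bar> < C" by blast
    define e where "e = min (x - a) (b - x)"
    have "e > 0" using a(1) b(1) by (simp add: e_def)
    moreover have "\<exists>B. \<forall>t\<in>{u..v}. 0 \<le> t \<longrightarrow> \<bar>f t\<bar> \<le> B" if uv: "u \<le> x" "x \<le> v" "v - u < e" for u v
    proof -
      have "\<bar>f t\<bar> \<le> max C (\<bar>f x\<bar> + 1)" if t: "t \<in> {u..v}" "0 \<le> t" for t
      proof -
        consider "t < x" | "t = x" | "x < t" by linarith
        then show ?thesis
        proof cases
          case 1
          then show ?thesis using a(2)[of t] t uv by (auto simp: e_def)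
        next
          case 3
          then show ?thesis using b(2)[of t] t uv by (auto simp: e_def)
        qed auto
      qed
      then show ?thesis by blast
    qed
    ultimately show "\<exists>e>0. \<forall>u v. u \<le> x \<and> x \<le> v \<and> v - u < e \<longrightarrow>
        (\<exists>B. \<forall>t\<in>{u..v}. 0 \<le> t \<longrightarrow> \<bar>f t\<bar> \<le> B)" by blast
  qed
  then show ?thesis by auto
qed auto

lemma cadlag_right_continuous_seq:
  assumes f: "cadlag f" and t: "0 \<le> t" and u: "u \<longlonglongrightarrow> t" "\<And>n. t \<le> u n"
  shows "(\<lambda>n. f (u n)) \<longlonglongrightarrow> f t"
proof (rule tendstoI)
  fix e :: real assume "e > 0"
  have "(f \<longlongrightarrow> f t) (at_right t)" using f t by (simp add: cadlag_def)
  then have "\<forall>\<^sub>F v in at_right t. dist (f v) (f t) < e" using \<open>e > 0\<close> by (rule tendstoD)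
  then obtain b where b: "b > t" "\<And>v. t < v \<Longrightarrow> v < b \<Longrightarrow> dist (f v) (f t) < e"
    unfolding eventually_at_right_field by blast
  have "\<forall>\<^sub>F n in sequentially. u n < b" using u(1) b(1) by (rule order_tendstoD)
  then show "\<forall>\<^sub>F n in sequentially. dist (f (u n)) (f t) < e"
  proof eventually_elim
    case (elim n)
    then show ?case using b(2)[of "u n"] u(2)[of n] \<open>e > 0\<close> by (cases "u n = t") auto
  qed
qed

section \<open>Sampling at the next grid point, and Riemann sums of cadlag functions\<close>

lemma next_grid_point_tendsto:
  fixes h :: "nat \<Rightarrow> real"
  assumes h: "\<And>n. 0 < h n" "h \<longlonglongrightarrow> 0"
  shows "t \<le> real_of_int (\<lfloor>t / h n\<rfloor> + 1) * h n"
    and "real_of_int (\<lfloor>t / h n\<rfloor> + 1) * h n \<le> t + h n"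
    and "(\<lambda>n. real_of_int (\<lfloor>t / h n\<rfloor> + 1) * h n) \<longlonglongrightarrow> t"
proof -
  show 1: "t \<le> real_of_int (\<lfloor>t / h n\<rfloor> + 1) * h n" for n
  proof -
    have "t / h n \<le> real_of_int (\<lfloor>t / h n\<rfloor> + 1)" by linarith
    then show ?thesis using h(1)[of n] pos_divide_le_eq by blast
  qed
  show 2: "real_of_int (\<lfloor>t / h n\<rfloor> + 1) * h n \<le> t + h n" for n
  proof -
    have "real_of_int \<lfloor>t / h n\<rfloor> \<le> t / h n" by linarith
    then have "real_of_int \<lfloor>t / h n\<rfloor> * h n \<le> t" using h(1)[of n] pos_le_divide_eq by blast
    then show ?thesis by (simp add: distrib_right)
  qed
  have "(\<lambda>n. t + h n) \<longlonglongrightarrow> t + 0" by (intro tendsto_intros h)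
  then show "(\<lambda>n. real_of_int (\<lfloor>t / h n\<rfloor> + 1) * h n) \<longlonglongrightarrow> t"
    using tendsto_sandwich[OF eventuallyI eventuallyI, where f="\<lambda>_. t" and h="\<lambda>n. t + h n", OF 1 2] by simp
qed

text \<open>The next grid point approaches \<open>t\<close> from the right, where a cadlag function
  converges to its value. The sampled functions factor through the integer floor and are therefore
  measurable whatever \<open>f\<close> is.\<close>

lemma borel_measurable_cadlag:
  assumes f: "cadlag f"
  shows "(\<lambda>t. f (max 0 t)) \<in> borel_measurable borel"
proof (rule borel_measurable_LIMSEQ_real)
  fix t :: real
  show "(\<lambda>n. f (real_of_int (\<lfloor>max 0 t / inverse (real (Suc n))\<rfloor> + 1) * inverse (real (Suc n))))
      \<longlonglongrightarrow> f (max 0 t)"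
    by (intro cadlag_right_continuous_seq[OF f] next_grid_point_tendsto LIMSEQ_inverse_real_of_nat) auto
next
  fix n
  have "(\<lambda>t::real. \<lfloor>max 0 t / inverse (real (Suc n))\<rfloor>) \<in> measurable borel (count_space UNIV)"
    by measurable
  from measurable_compose[OF this, of "\<lambda>i. f (real_of_int (i + 1) * inverse (real (Suc n)))" borel]
  show "(\<lambda>t. f (real_of_int (\<lfloor>max 0 t / inverse (real (Suc n))\<rfloor> + 1) * inverse (real (Suc n))))
      \<in> borel_measurable borel" by simp
qed

lemma integrable_on_cadlag:
  assumes f: "cadlag f" and a: "0 \<le> a"
  shows "f integrable_on {a..b}"
proof -
  obtain B where B: "\<And>t. t \<in> {0..b} \<Longrightarrow> \<bar>f t\<bar> \<le> B" using cadlag_bounded[OF f, of b] by blast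
  have "(\<lambda>t. f (max 0 t)) \<in> borel_measurable (lebesgue_on {a..b})"
    using borel_measurable_cadlag[OF f] by (simp add: measurable_completion measurable_restrict_space1)
  then have "(\<lambda>t. f (max 0 t)) integrable_on {a..b}"
    by (rule measurable_bounded_by_integrable_imp_integrable[where g="\<lambda>_. B"])
      (use a B in auto)
  then show ?thesis
    by (rule integrable_eq) (use a in auto)
qed

lemma integral_next_grid_point:
  fixes \<phi> :: "real \<Rightarrow> real"
  assumes h: "0 < h"
  shows "((\<lambda>u. \<phi> (real_of_int (\<lfloor>u / h\<rfloor> + 1) * h)) has_integral
            h * (\<Sum>i<n. \<phi> (real (Suc i) * h))) {0..real n * h}"
proof (induction n)
  case (Suc n)
  have "((\<lambda>u. \<phi> (real_of_int (\<lfloor>u / h\<rfloor> + 1) * h)) has_integral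
          (real (Suc n) * h - real n * h) *\<^sub>R \<phi> (real (Suc n) * h)) {real n * h..real (Suc n) * h}"
  proof (rule has_integral_spike_finite[of "{real (Suc n) * h}"])
    \<comment> \<open>At the right end point of the cell the floor has already moved on to the next
      cell; this single point is the spike set.\<close>
    show "\<phi> (real_of_int (\<lfloor>u / h\<rfloor> + 1) * h) = \<phi> (real (Suc n) * h)"
      if "u \<in> {real n * h..real (Suc n) * h} - {real (Suc n) * h}" for u
    proof -
      have "real n \<le> u / h" "u / h < real n + 1"
        using that h by (auto simp: pos_le_divide_eq pos_divide_less_eq field_simps)
      then have "\<lfloor>u / h\<rfloor> = int n" by (intro floor_unique) auto
      then show ?thesis by (simp add: add.commute)
    qed
    show "((\<lambda>_. \<phi> (real (Suc n) * h)) has_integral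
          (real (Suc n) * h - real n * h) *\<^sub>R \<phi> (real (Suc n) * h)) {real n * h..real (Suc n) * h}"
      using has_integral_const_real[of "\<phi> (real (Suc n) * h)" "real n * h" "real (Suc n) * h"] h
      by (simp add: mult_right_mono algebra_simps)
  qed simp
  with Suc.IH have "((\<lambda>u. \<phi> (real_of_int (\<lfloor>u / h\<rfloor> + 1) * h)) has_integral
     (h * (\<Sum>i<n. \<phi> (real (Suc i) * h)) + (real (Suc n) * h - real n * h) *\<^sub>R \<phi> (real (Suc n) * h)))
       {0..real (Suc n) * h}"
    by (rule has_integral_combine[rotated 2]) (use h in \<open>auto intro: mult_right_mono\<close>)
  then show ?case by (simp add: algebra_simps)
qed (simp add: has_integral_refl)

text \<open>Discrete compensators are sums over left end points, whereas right-continuity controls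
  sampling from the right. The sum over right end points is the integral of \<open>\<psi> n\<close>,
  which converges by dominated convergence. Shifting the index by one costs the telescoping term
  \<open>h n * (\<phi> 0 - \<phi> (real (j n) * h n))\<close>, and the overshoot of the grid beyond
  \<open>t\<close> costs at most \<open>B * (real (j n) * h n - t)\<close>; both vanish.\<close>

lemma riemann_sum_tendsto_integral:
  fixes \<phi> :: "real \<Rightarrow> real" and h :: "nat \<Rightarrow> real" and j :: "nat \<Rightarrow> nat"
  assumes \<phi>: "cadlag \<phi>" "\<And>u. 0 \<le> u \<Longrightarrow> \<bar>\<phi> u\<bar> \<le> B" and t: "0 \<le> t"
    and h: "\<And>n. 0 < h n" "h \<longlonglongrightarrow> 0"
    and j: "\<And>n. t \<le> real (j n) * h n" "(\<lambda>n. real (j n) * h n) \<longlonglongrightarrow> t"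
  shows "(\<lambda>n. h n * (\<Sum>i<j n. \<phi> (real i * h n))) \<longlonglongrightarrow> integral {0..t} \<phi>"
proof -
  define \<psi> where "\<psi> n u = \<phi> (real_of_int (\<lfloor>u / h n\<rfloor> + 1) * h n)" for n u
  have I: "(\<psi> n has_integral h n * (\<Sum>i<j n. \<phi> (real (Suc i) * h n))) {0..real (j n) * h n}" for n
    unfolding \<psi>_def by (rule integral_next_grid_point[OF h(1)])
  have int: "\<psi> n integrable_on {0..t}" "\<psi> n integrable_on {t..real (j n) * h n}" for n
    using integrable_on_subinterval[OF has_integral_integrable[OF I[of n]]] j(1)[of n] t
    by simp_all
  have \<psi>_le: "\<bar>\<psi> n u\<bar> \<le> B" if "0 \<le> u" for n u
    unfolding \<psi>_def using next_grid_point_tendsto(1)[of h u n] h that by (intro \<phi>(2)) (meson order_trans)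
  have lim: "(\<lambda>n. integral {0..t} (\<psi> n)) \<longlonglongrightarrow> integral {0..t} \<phi>"
  proof (rule dominated_convergence(2)[where h="\<lambda>_. B"])
    show "\<And>n u. u \<in> {0..t} \<Longrightarrow> norm (\<psi> n u) \<le> B" using \<psi>_le by simp
    show "(\<lambda>n. \<psi> n u) \<longlonglongrightarrow> \<phi> u" if "u \<in> {0..t}" for u
      unfolding \<psi>_def using that
      by (intro cadlag_right_continuous_seq[OF \<phi>(1)] next_grid_point_tendsto h) auto
  qed (use int in auto)
  have "h n * (\<Sum>i<j n. \<phi> (real i * h n)) = integral {0..t} (\<psi> n)
      + integral {t..real (j n) * h n} (\<psi> n) + h n * (\<phi> 0 - \<phi> (real (j n) * h n))" for n
  proof -
    have "(\<Sum>i<j n. \<phi> (real i * h n)) = (\<Sum>i<j n. \<phi> (real (Suc i) * h n)) + (\<phi> 0 - \<phi> (real (j n) * h n))"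
      using sum_lessThan_telescope'[of "\<lambda>i. \<phi> (real i * h n)" "j n"] by (simp add: sum_subtractf)
    moreover have "h n * (\<Sum>i<j n. \<phi> (real (Suc i) * h n)) = integral {0..t} (\<psi> n)
      + integral {t..real (j n) * h n} (\<psi> n)"
      using integral_unique[OF I[of n]] Henstock_Kurzweil_Integration.integral_combine[of 0 t "real (j n) * h n" "\<psi> n"]
        has_integral_integrable[OF I[of n]] t j(1)[of n] by simp
    ultimately show ?thesis by (simp add: distrib_left)
  qed
  moreover have "(\<lambda>n. integral {0..t} (\<psi> n) + integral {t..real (j n) * h n} (\<psi> n)
      + h n * (\<phi> 0 - \<phi> (real (j n) * h n))) \<longlonglongrightarrow> integral {0..t} \<phi> + 0 + 0"
  proof (intro tendsto_add lim)
    have "\<bar>integral {t..real (j n) * h n} (\<psi> n)\<bar> \<le> B * (real (j n) * h n - t)" for n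
      using integral_norm_bound_integral[of "\<psi> n" "{t..real (j n) * h n}" "\<lambda>_. B"] int(2)[of n] \<psi>_le t j(1)[of n]
        integrable_const_ivl[of B t "real (j n) * h n"]
      by (simp add: mult.commute)
    moreover have "(\<lambda>n. B * (real (j n) * h n - t)) \<longlonglongrightarrow> 0"
      using tendsto_mult[OF tendsto_const[of B] tendsto_diff[OF j(2) tendsto_const[of t]]] by simp
    ultimately show "(\<lambda>n. integral {t..real (j n) * h n} (\<psi> n)) \<longlonglongrightarrow> 0"
      by - (rule Lim_null_comparison[OF always_eventually], auto)
    have "\<bar>h n * (\<phi> 0 - \<phi> (real (j n) * h n))\<bar> \<le> h n * (2 * B)" for n
    proof -
      have "\<bar>\<phi> 0 - \<phi> (real (j n) * h n)\<bar> \<le> 2 * B"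
        using \<phi>(2)[of 0] \<phi>(2)[of "real (j n) * h n"] j(1)[of n] t by linarith
      then show ?thesis using h(1)[of n] by (simp add: abs_mult mult_left_mono)
    qed
    moreover have "(\<lambda>n. h n * (2 * B)) \<longlonglongrightarrow> 0"
      using tendsto_mult[OF h(2) tendsto_const[of "2 * B"]] by simp
    ultimately show "(\<lambda>n. h n * (\<phi> 0 - \<phi> (real (j n) * h n))) \<longlonglongrightarrow> 0"
      by - (rule Lim_null_comparison[OF always_eventually], auto)
  qed
  ultimately show ?thesis by simp
qed

section \<open>Finite Markov jump processes\<close>

lemma (in finite_measure) integrable_bounded:
  assumes "f \<in> borel_measurable M" "\<And>\<omega>. \<omega> \<in> space M \<Longrightarrow> \<bar>f \<omega>\<bar> \<le> (B::real)"
  shows "integrable M f"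
  using assms by (intro integrable_const_bound[where B=B] AE_I2) auto

text \<open>
  Kolmogorov's inequality: the increments after the first passage time of \<open>e\<close> are switched off by
  \<open>Z\<close>, which keeps the sum above \<open>e\<close> and leaves the increments orthogonal.
\<close>

lemma (in prob_space) martingale_maximal_inequality:
  fixes \<xi> :: "nat \<Rightarrow> 'a \<Rightarrow> real" and F :: "nat \<Rightarrow> 'a measure"
  assumes subalg: "\<And>i. subalgebra M (F i)"
    and adapted: "\<And>i j. i < j \<Longrightarrow> \<xi> i \<in> borel_measurable (F j)"
    and bdd: "\<And>i \<omega>. \<omega> \<in> space M \<Longrightarrow> \<bar>\<xi> i \<omega>\<bar> \<le> B"
    and orth: "\<And>i W C. W \<in> borel_measurable (F i) \<Longrightarrow> (\<And>\<omega>. \<omega> \<in> space M \<Longrightarrow> \<bar>W \<omega>\<bar> \<le> C) \<Longrightarrow>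
                 (\<integral>\<omega>. W \<omega> * \<xi> i \<omega> \<partial>M) = 0"
    and var: "\<And>i. (\<integral>\<omega>. (\<xi> i \<omega>)\<^sup>2 \<partial>M) \<le> v"
    and e: "e > 0"
  shows "prob {\<omega>\<in>space M. \<exists>j\<le>n. e \<le> \<bar>\<Sum>i<j. \<xi> i \<omega>\<bar>} \<le> real n * v / e\<^sup>2"
proof -
  define Z where "Z i \<omega> = (\<Prod>j\<le>i. indicator {..<e} \<bar>\<Sum>l<j. \<xi> l \<omega>\<bar> :: real)" for i \<omega>
  define S where "S n \<omega> = (\<Sum>i<n. Z i \<omega> * \<xi> i \<omega>)" for n \<omega>
  have mM: "f \<in> borel_measurable M" if "f \<in> borel_measurable (F i)" for f :: "'a \<Rightarrow> real" and i
    using measurable_from_subalg[OF subalg that] .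
  have \<xi>M [measurable]: "\<xi> i \<in> borel_measurable M" for i
    using adapted[of i "Suc i"] mM by blast
  have ZF: "Z i \<in> borel_measurable (F n)" if "i \<le> n" for i n
  proof -
    have [measurable]: "\<xi> l \<in> borel_measurable (F n)" if "l < n" for l using adapted that by simp
    have "(\<lambda>\<omega>. \<Sum>l<j. \<xi> l \<omega>) \<in> borel_measurable (F n)" if "j \<le> i" for j
      using that \<open>i \<le> n\<close> by (intro borel_measurable_sum) auto
    then have "(\<lambda>\<omega>. indicator {..<e} \<bar>\<Sum>l<j. \<xi> l \<omega>\<bar> :: real) \<in> borel_measurable (F n)" if "j \<le> i" for j
      using that by (intro measurable_compose[OF borel_measurable_abs borel_measurable_indicator]) auto
    then show ?thesis unfolding Z_def by (intro borel_measurable_prod) auto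
  qed
  have SF: "S n \<in> borel_measurable (F n)" for n
    unfolding S_def by (intro borel_measurable_sum borel_measurable_times ZF adapted) auto
  have Z01: "0 \<le> Z i \<omega>" "Z i \<omega> \<le> 1" "Z i \<omega> * Z i \<omega> = Z i \<omega>" for i \<omega>
    unfolding Z_def prod.distrib[symmetric]
    by (auto intro!: prod_nonneg prod_le_1 prod.cong simp: indicator_def)
  have Sb: "\<bar>S n \<omega>\<bar> \<le> real n * B" if "\<omega> \<in> space M" for n \<omega>
  proof -
    have "\<bar>Z i \<omega> * \<xi> i \<omega>\<bar> \<le> B" for i
      using mult_mono[OF Z01(2) bdd[OF that], of i i] Z01(1)[of i \<omega>] by (simp add: abs_mult)
    then have "(\<Sum>i<n. \<bar>Z i \<omega> * \<xi> i \<omega>\<bar>) \<le> (\<Sum>i<n. B)" by (intro sum_mono)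
    then show ?thesis unfolding S_def by (intro order_trans[OF sum_abs]) simp
  qed
  have SM [measurable]: "S n \<in> borel_measurable M" for n using SF mM by blast
  have ZM [measurable]: "Z n \<in> borel_measurable M" for n using ZF mM by blast
  have sq: "x\<^sup>2 \<le> C\<^sup>2" if "\<bar>x\<bar> \<le> C" for x C :: real
    using that by (simp add: abs_le_square_iff[symmetric])
  have int\<xi>: "integrable M (\<lambda>\<omega>. (\<xi> i \<omega>)\<^sup>2)" for i
    by (rule integrable_bounded[where B="B\<^sup>2"]) (auto intro!: sq bdd)
  have intS: "integrable M (\<lambda>\<omega>. (S n \<omega>)\<^sup>2)" for n
    by (rule integrable_bounded[where B="(real n * B)\<^sup>2"]) (auto intro!: sq Sb)
  have "(\<integral>\<omega>. (S n \<omega>)\<^sup>2 \<partial>M) \<le> real n * v" for n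
  proof (induction n)
    case (Suc n)
    \<comment> \<open>\<open>Z n\<close> is 0 or 1, so it equals its square. The factor
      \<open>S n * Z n\<close> of the cross term is bounded and measurable for \<open>F n\<close>,
      so \<open>orth\<close> removes the cross term.\<close>
    have eq: "(S (Suc n) \<omega>)\<^sup>2 = (S n \<omega>)\<^sup>2 + 2 * ((S n \<omega> * Z n \<omega>) * \<xi> n \<omega>) + Z n \<omega> * (\<xi> n \<omega>)\<^sup>2" for \<omega>
    proof -
      have "Z n \<omega> = 0 \<or> Z n \<omega> = 1" using Z01(3)[of n \<omega>] by simp
      then show ?thesis by (auto simp: S_def power2_eq_square algebra_simps)
    qed
    have b: "\<bar>S n \<omega> * Z n \<omega>\<bar> \<le> real n * B" if "\<omega> \<in> space M" for \<omega>
      using mult_mono[OF Sb[OF that, of n] Z01(2)[of n \<omega>]] Z01(1)[of n \<omega>] Sb[OF that, of n]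
      by (simp add: abs_mult)
    have i2: "integrable M (\<lambda>\<omega>. (S n \<omega> * Z n \<omega>) * \<xi> n \<omega>)"
    proof (rule integrable_bounded[where B="(real n * B) * B"])
      show "\<bar>(S n \<omega> * Z n \<omega>) * \<xi> n \<omega>\<bar> \<le> (real n * B) * B" if "\<omega> \<in> space M" for \<omega>
        using mult_mono[OF b[OF that] bdd[OF that, of n]] order_trans[OF abs_ge_zero b[OF that]]
        by (simp add: abs_mult)
    qed measurable
    have i3: "integrable M (\<lambda>\<omega>. Z n \<omega> * (\<xi> n \<omega>)\<^sup>2)"
    proof (rule integrable_bounded[where B="B\<^sup>2"])
      show "\<bar>Z n \<omega> * (\<xi> n \<omega>)\<^sup>2\<bar> \<le> B\<^sup>2" if "\<omega> \<in> space M" for \<omega>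
        using mult_mono[OF Z01(2)[of n \<omega>] sq[OF bdd[OF that, of n]]] Z01(1)[of n \<omega>]
        by (simp add: abs_mult)
    qed measurable
    have "(\<integral>\<omega>. (S (Suc n) \<omega>)\<^sup>2 \<partial>M)
        = (\<integral>\<omega>. (S n \<omega>)\<^sup>2 \<partial>M) + 2 * (\<integral>\<omega>. (S n \<omega> * Z n \<omega>) * \<xi> n \<omega> \<partial>M) + (\<integral>\<omega>. Z n \<omega> * (\<xi> n \<omega>)\<^sup>2 \<partial>M)"
      unfolding eq using intS i2 i3 by simp
    also have "(\<integral>\<omega>. (S n \<omega> * Z n \<omega>) * \<xi> n \<omega> \<partial>M) = 0"
      by (rule orth[OF _ b]) (auto intro!: borel_measurable_times SF ZF)
    also have "(\<integral>\<omega>. Z n \<omega> * (\<xi> n \<omega>)\<^sup>2 \<partial>M) \<le> (\<integral>\<omega>. (\<xi> n \<omega>)\<^sup>2 \<partial>M)"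
      using Z01 by (intro integral_mono i3 int\<xi>) (simp add: mult_left_le_one_le)
    finally show ?case using Suc.IH var[of n] by (simp add: algebra_simps)
  qed (simp add: S_def)
  then have "(\<integral>\<omega>. (S n \<omega>)\<^sup>2 \<partial>M) / e\<^sup>2 \<le> real n * v / e\<^sup>2"
    using e by (intro divide_right_mono) auto
  moreover have "{\<omega>\<in>space M. \<exists>j\<le>n. e \<le> \<bar>\<Sum>i<j. \<xi> i \<omega>\<bar>} \<subseteq> {\<omega>\<in>space M. e \<le> \<bar>S n \<omega>\<bar>}"
  proof safe
    fix \<omega> j assume \<omega>: "\<omega> \<in> space M" and j: "j \<le> n" "e \<le> \<bar>\<Sum>i<j. \<xi> i \<omega>\<bar>"
    \<comment> \<open>At the first passage index \<open>k\<close> the switched sum freezes: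
      \<open>Z i\<close> is 1 exactly for \<open>i < k\<close>, so \<open>S n\<close> keeps the
      value of the original sum at \<open>k\<close>, which is at least \<open>e\<close> in
      modulus.\<close>
    define k where "k = (LEAST j. e \<le> \<bar>\<Sum>i<j. \<xi> i \<omega>\<bar>)"
    have k: "e \<le> \<bar>\<Sum>i<k. \<xi> i \<omega>\<bar>" "k \<le> j" "\<And>l. l < k \<Longrightarrow> \<not> e \<le> \<bar>\<Sum>i<l. \<xi> i \<omega>\<bar>"
      unfolding k_def using LeastI[of "\<lambda>j. e \<le> \<bar>\<Sum>i<j. \<xi> i \<omega>\<bar>", OF j(2)] Least_le[of "\<lambda>j. e \<le> \<bar>\<Sum>i<j. \<xi> i \<omega>\<bar>", OF j(2)]
        not_less_Least[of _ "\<lambda>j. e \<le> \<bar>\<Sum>i<j. \<xi> i \<omega>\<bar>"] by blast+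
    have Z1: "Z i \<omega> = of_bool (i < k)" for i
    proof (cases "i < k")
      case True
      then have "indicator {..<e} \<bar>\<Sum>l<j. \<xi> l \<omega>\<bar> = (1::real)" if "j \<le> i" for j
        using k(3)[of j] that by (auto simp: indicator_def)
      then show ?thesis using True by (simp add: Z_def)
    next
      case False
      have "indicator {..<e} \<bar>\<Sum>l<k. \<xi> l \<omega>\<bar> = (0::real)" using k(1) by (simp add: indicator_def)
      then have "\<exists>j\<in>{..i}. indicator {..<e} \<bar>\<Sum>l<j. \<xi> l \<omega>\<bar> = (0::real)"
        using False by (intro bexI[of _ k]) auto
      then have "Z i \<omega> = 0" unfolding Z_def by (subst prod_zero_iff) auto
      then show ?thesis using False by simp
    qed
    have "S n \<omega> = (\<Sum>i\<in>{..<n}. if i \<in> {..<k} then \<xi> i \<omega> else 0)"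
      unfolding S_def Z1 by (intro sum.cong) auto
    also have "\<dots> = (\<Sum>i\<in>{..<n} \<inter> {..<k}. \<xi> i \<omega>)" by (subst sum.inter_restrict) auto
    also have "{..<n} \<inter> {..<k} = {..<k}" using k(2) j(1) by auto
    finally show "e \<le> \<bar>S n \<omega>\<bar>" using k(1) by simp
  qed
  then have "prob {\<omega>\<in>space M. \<exists>j\<le>n. e \<le> \<bar>\<Sum>i<j. \<xi> i \<omega>\<bar>} \<le> prob {\<omega>\<in>space M. e \<le> \<bar>S n \<omega>\<bar>}"
    by (intro finite_measure_mono) measurable
  moreover have "prob {\<omega>\<in>space M. e \<le> \<bar>S n \<omega>\<bar>} \<le> (\<integral>\<omega>. (S n \<omega>)\<^sup>2 \<partial>M) / e\<^sup>2"
    using e by (intro second_moment_method intS) auto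
  ultimately show ?thesis by linarith
qed

text \<open>\<open>markov_jump_process\<close> with the transition function named, since the
  skeleton arguments speak about \<open>p\<close> at small times.\<close>

locale finite_markov_process = prob_space M for M :: "'w measure" +
  fixes E :: "'s set" and q :: "'s \<Rightarrow> 's \<Rightarrow> real" and X :: "real \<Rightarrow> 'w \<Rightarrow> 's"
    and p :: "real \<Rightarrow> 's \<Rightarrow> 's \<Rightarrow> real"
  assumes finite_E: "finite E"
    and measurable_X: "0 \<le> t \<Longrightarrow> X t \<in> measurable M (count_space E)"
    and right_cont: "\<omega> \<in> space M \<Longrightarrow> 0 \<le> t \<Longrightarrow> \<forall>\<^sub>F u in at_right t. X u \<omega> = X t \<omega>"
    and left_lim: "\<omega> \<in> space M \<Longrightarrow> 0 < t \<Longrightarrow> \<exists>y. \<forall>\<^sub>F u in at_left t. X u \<omega> = y"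
    and transition: "transition_function E q p"
    and cond_exp: "0 \<le> s \<Longrightarrow> s \<le> t \<Longrightarrow> y \<in> E \<Longrightarrow> AE \<omega> in M.
          real_cond_exp M (natural_filtration M X s)
            (indicator {\<omega> \<in> space M. X t \<omega> = y}) \<omega> = p (t - s) (X s \<omega>) y"

lemma markov_jump_processE:
  assumes "markov_jump_process M E q X"
  obtains p where "finite_markov_process M E q X p"
  using assms unfolding markov_jump_process_def finite_markov_process_def finite_markov_process_axioms_def
  by (elim conjE exE) blast

context finite_markov_process
begin

lemma X_in_E: "0 \<le> t \<Longrightarrow> \<omega> \<in> space M \<Longrightarrow> X t \<omega> \<in> E"
  using measurable_space[OF measurable_X] by simp

lemma cadlag_path:
  assumes "\<omega> \<in> space M"
  shows "cadlag (\<lambda>t. \<phi> (X t \<omega>))"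
  unfolding cadlag_def
proof (intro conjI allI impI)
  fix t :: real assume "0 \<le> t"
  show "((\<lambda>t. \<phi> (X t \<omega>)) \<longlongrightarrow> \<phi> (X t \<omega>)) (at_right t)"
    by (intro tendsto_eventually eventually_mono[OF right_cont[OF assms \<open>0 \<le> t\<close>]]) simp
next
  fix t :: real assume "0 < t"
  with left_lim[OF assms] obtain y where "\<forall>\<^sub>F u in at_left t. X u \<omega> = y" by blast
  then have "((\<lambda>t. \<phi> (X t \<omega>)) \<longlongrightarrow> \<phi> y) (at_left t)"
    by (intro tendsto_eventually) (simp add: eventually_mono)
  then show "\<exists>l. ((\<lambda>t. \<phi> (X t \<omega>)) \<longlongrightarrow> l) (at_left t)" by blast
qed

lemma subalgebra_natural_filtration: "subalgebra M (natural_filtration M X s)"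
proof -
  have "X u -` A \<inter> space M \<in> sets M" if "u \<in> {0..s}" for u A
  proof -
    \<comment> \<open>The \<sigma>-algebra of \<open>count_space E\<close> consists of subsets of
      \<open>E\<close>; as the path stays in \<open>E\<close>, the trace of \<open>A\<close> on
      \<open>E\<close> has the same preimage.\<close>
    have "X u -` A \<inter> space M = X u -` (A \<inter> E) \<inter> space M" using X_in_E that by auto
    also have "\<dots> \<in> sets M" using measurable_X[of u] that by (intro measurable_sets) auto
    finally show ?thesis .
  qed
  then have "(\<Union>u\<in>{0..s}. {X u -` A \<inter> space M |A. True}) \<subseteq> sets M" by auto
  then show ?thesis
    unfolding natural_filtration_def subalgebra_def
    by (auto simp: sets.sigma_sets_subset space_measure_of_conv sets_measure_of_conv
        intro: sets.sigma_sets_subset[THEN subsetD] split: if_splits)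
qed

lemma adapted:
  assumes "0 \<le> u" "u \<le> s"
  shows "(\<lambda>\<omega>. \<phi> (X u \<omega>) :: real) \<in> borel_measurable (natural_filtration M X s)"
proof (rule measurableI)
  fix A :: "real set"
  have "(\<lambda>\<omega>. \<phi> (X u \<omega>)) -` A \<inter> space M = X u -` (\<phi> -` A) \<inter> space M" by auto
  also have "\<dots> \<in> sets (natural_filtration M X s)"
    unfolding natural_filtration_def using assms
    by (subst sets_measure_of) (auto intro!: sigma_sets.Basic bexI[of _ u] exI[of _ "\<phi> -` A"])
  finally show "(\<lambda>\<omega>. \<phi> (X u \<omega>)) -` A \<inter> space (natural_filtration M X s) \<in> sets (natural_filtration M X s)"
    by (simp add: natural_filtration_def space_measure_of_conv)
qed simp

lemma measurable_function_X: "0 \<le> u \<Longrightarrow> (\<lambda>\<omega>. \<phi> (X u \<omega>) :: real) \<in> borel_measurable M"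
  using measurable_from_subalg[OF subalgebra_natural_filtration adapted[of u u]] by simp

lemma bounded_on_E: obtains B :: real where "0 \<le> B" "\<And>x. x \<in> E \<Longrightarrow> \<bar>\<phi> x\<bar> \<le> B"
proof
  show "0 \<le> (\<Sum>x\<in>E. \<bar>\<phi> x\<bar>)" by (simp add: sum_nonneg)
  show "\<bar>\<phi> x\<bar> \<le> (\<Sum>x\<in>E. \<bar>\<phi> x\<bar>)" if "x \<in> E" for x
    using member_le_sum[OF that, of "\<lambda>x. \<bar>\<phi> x\<bar>"] finite_E by simp
qed

text \<open>The Markov property is given for indicators of single states. Since \<open>E\<close> is
  finite, writing \<open>g\<close> as a combination of such indicators extends it to every
  \<open>g\<close>, and testing against a bounded \<open>W\<close> from the past avoids further
  conditional expectations.\<close>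

lemma markov_property:
  assumes s: "0 \<le> s" "s \<le> t"
    and W: "W \<in> borel_measurable (natural_filtration M X s)" "\<And>\<omega>. \<omega> \<in> space M \<Longrightarrow> \<bar>W \<omega>\<bar> \<le> (C::real)"
  shows "(\<integral>\<omega>. W \<omega> * g (X t \<omega>) \<partial>M) = (\<integral>\<omega>. W \<omega> * (\<Sum>y\<in>E. p (t - s) (X s \<omega>) y * g y) \<partial>M)"
proof -
  interpret S: finite_measure_subalgebra M "natural_filtration M X s"
    by unfold_locales (rule subalgebra_natural_filtration)
  have WM [measurable]: "W \<in> borel_measurable M"
    using measurable_from_subalg[OF subalgebra_natural_filtration W(1)] .
  define I where "I y = (indicator {\<omega>\<in>space M. X t \<omega> = y} :: 'w \<Rightarrow> real)" for y
  have IM [measurable]: "I y \<in> borel_measurable M" if "y \<in> E" for y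
  proof -
    have "{\<omega>\<in>space M. X t \<omega> = y} = X t -` {y} \<inter> space M" by auto
    also have "\<dots> \<in> sets M" using measurable_X[of t] s that by (intro measurable_sets) auto
    finally show ?thesis unfolding I_def by simp
  qed
  have int1: "integrable M (\<lambda>\<omega>. W \<omega> * I y \<omega>)" if "y \<in> E" for y
    using that W(2) by (intro integrable_bounded[where B=C] borel_measurable_times WM IM)
      (auto simp: I_def indicator_def intro: order_trans[OF abs_ge_zero])
  have int2: "integrable M (\<lambda>\<omega>. W \<omega> * p (t - s) (X s \<omega>) y)" for y
  proof -
    obtain B where B: "0 \<le> B" "\<And>x. x \<in> E \<Longrightarrow> \<bar>p (t - s) x y\<bar> \<le> B"
      using bounded_on_E[of "\<lambda>x. p (t - s) x y"] by blast
    show ?thesis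
    proof (rule integrable_bounded[where B="C * B"])
      show "\<bar>W \<omega> * p (t - s) (X s \<omega>) y\<bar> \<le> C * B" if "\<omega> \<in> space M" for \<omega>
        using mult_mono[OF W(2)[OF that] B(2)[OF X_in_E[OF s(1) that]]] W(2)[OF that]
        by (simp add: abs_mult)
    qed (use measurable_function_X[OF s(1), of "\<lambda>x. p (t - s) x y"] in measurable)
  qed
  have *: "(\<integral>\<omega>. W \<omega> * I y \<omega> \<partial>M) = (\<integral>\<omega>. W \<omega> * p (t - s) (X s \<omega>) y \<partial>M)" if y: "y \<in> E" for y
  proof -
    have "(\<integral>\<omega>. W \<omega> * I y \<omega> \<partial>M) = (\<integral>\<omega>. W \<omega> * real_cond_exp M (natural_filtration M X s) (I y) \<omega> \<partial>M)"
      using S.real_cond_exp_intg(2)[OF int1[OF y] W(1) IM[OF y]] by simp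
    also have "\<dots> = (\<integral>\<omega>. W \<omega> * p (t - s) (X s \<omega>) y \<partial>M)"
    proof (rule integral_cong_AE)
      show "AE \<omega> in M. W \<omega> * real_cond_exp M (natural_filtration M X s) (I y) \<omega> = W \<omega> * p (t - s) (X s \<omega>) y"
        using cond_exp[OF s y] unfolding I_def by eventually_elim simp
    qed (use measurable_function_X[OF s(1), of "\<lambda>x. p (t - s) x y"] in measurable)
    finally show ?thesis .
  qed
  have "(\<integral>\<omega>. W \<omega> * g (X t \<omega>) \<partial>M) = (\<integral>\<omega>. (\<Sum>y\<in>E. g y * (W \<omega> * I y \<omega>)) \<partial>M)"
  proof (rule Bochner_Integration.integral_cong)
    fix \<omega> assume "\<omega> \<in> space M"
    then have "(\<Sum>y\<in>E. g y * (W \<omega> * I y \<omega>)) = (\<Sum>y\<in>E. if y = X t \<omega> then g y * W \<omega> else 0)"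
      by (intro sum.cong) (auto simp: I_def indicator_def)
    then show "W \<omega> * g (X t \<omega>) = (\<Sum>y\<in>E. g y * (W \<omega> * I y \<omega>))"
      using X_in_E[of t \<omega>] \<open>\<omega> \<in> space M\<close> s finite_E by (simp add: mult.commute)
  qed simp
  also have "\<dots> = (\<Sum>y\<in>E. g y * (\<integral>\<omega>. W \<omega> * I y \<omega> \<partial>M))"
    using int1 by simp
  also have "\<dots> = (\<Sum>y\<in>E. g y * (\<integral>\<omega>. W \<omega> * p (t - s) (X s \<omega>) y \<partial>M))"
    using * by (intro sum.cong) auto
  also have "\<dots> = (\<integral>\<omega>. (\<Sum>y\<in>E. g y * (W \<omega> * p (t - s) (X s \<omega>) y)) \<partial>M)"
    using int2 by simp
  also have "\<dots> = (\<integral>\<omega>. W \<omega> * (\<Sum>y\<in>E. p (t - s) (X s \<omega>) y * g y) \<partial>M)"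
    by (simp add: sum_distrib_left mult_ac)
  finally show ?thesis .
qed

text \<open>The left side is a mean conditional variance, and the conditional mean minimises the
  mean square deviation; replacing it by \<open>g (X s \<omega>)\<close> adds the square of their
  difference. The new integrand vanishes at \<open>y = X s \<omega>\<close>, so that dividing by the
  mesh and using \<open>generator_limit\<close> yields the carre du champ.\<close>

lemma transition_second_moment:
  assumes s: "0 \<le> s" "s \<le> t"
  shows "(\<integral>\<omega>. (g (X t \<omega>) - (\<Sum>y\<in>E. p (t - s) (X s \<omega>) y * g y))\<^sup>2 \<partial>M)
       \<le> (\<integral>\<omega>. (\<Sum>y\<in>E. p (t - s) (X s \<omega>) y * (g y - g (X s \<omega>))\<^sup>2) \<partial>M)"
proof -
  define P where "P f x = (\<Sum>y\<in>E. p (t - s) x y * f y)" for f x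
  obtain B where B: "0 \<le> B" "\<And>x. x \<in> E \<Longrightarrow> \<bar>P g x\<bar> \<le> B" using bounded_on_E[of "P g"] by blast
  have int: "integrable M (\<lambda>\<omega>. \<phi> (X u \<omega>))" if "0 \<le> u" for \<phi> :: "'s \<Rightarrow> real" and u
  proof -
    obtain B where "0 \<le> B" "\<And>x. x \<in> E \<Longrightarrow> \<bar>\<phi> x\<bar> \<le> B" using bounded_on_E[of \<phi>] by blast
    then show ?thesis using that X_in_E measurable_function_X by (intro integrable_bounded[where B=B]) auto
  qed
  obtain B' where B': "0 \<le> B'" "\<And>x. x \<in> E \<Longrightarrow> \<bar>g x\<bar> \<le> B'" using bounded_on_E[of g] by blast
  have int': "integrable M (\<lambda>\<omega>. P g (X s \<omega>) * g (X t \<omega>))"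
  proof (rule integrable_bounded[where B="B * B'"])
    have "0 \<le> t" using s by simp
    then show "\<bar>P g (X s \<omega>) * g (X t \<omega>)\<bar> \<le> B * B'" if "\<omega> \<in> space M" for \<omega>
      using mult_mono[OF B(2)[OF X_in_E[OF s(1) that]] B'(2)[OF X_in_E[OF _ that, of t]]] B B'
      by (simp add: abs_mult)
    show "(\<lambda>\<omega>. P g (X s \<omega>) * g (X t \<omega>)) \<in> borel_measurable M"
      using s by (intro borel_measurable_times measurable_function_X) auto
  qed
  have 1: "(\<integral>\<omega>. (g (X t \<omega>))\<^sup>2 \<partial>M) = (\<integral>\<omega>. P (\<lambda>y. (g y)\<^sup>2) (X s \<omega>) \<partial>M)"
    using markov_property[OF s, of "\<lambda>_. 1" 1 "\<lambda>y. (g y)\<^sup>2"] by (simp add: P_def)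
  have 2: "(\<integral>\<omega>. P g (X s \<omega>) * g (X t \<omega>) \<partial>M) = (\<integral>\<omega>. (P g (X s \<omega>))\<^sup>2 \<partial>M)"
    using markov_property[OF s, of "\<lambda>\<omega>. P g (X s \<omega>)" B g] adapted[of s s "P g"] B X_in_E s
    by (simp add: P_def[symmetric] power2_eq_square)
  have "(\<integral>\<omega>. (g (X t \<omega>) - P g (X s \<omega>))\<^sup>2 \<partial>M)
      = (\<integral>\<omega>. (g (X t \<omega>))\<^sup>2 - 2 * (P g (X s \<omega>) * g (X t \<omega>)) + (P g (X s \<omega>))\<^sup>2 \<partial>M)"
    by (simp add: power2_eq_square algebra_simps)
  also have "\<dots> = (\<integral>\<omega>. (g (X t \<omega>))\<^sup>2 \<partial>M) - 2 * (\<integral>\<omega>. P g (X s \<omega>) * g (X t \<omega>) \<partial>M) + (\<integral>\<omega>. (P g (X s \<omega>))\<^sup>2 \<partial>M)"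
    using int[of t "\<lambda>x. (g x)\<^sup>2"] int[of s "\<lambda>x. (P g x)\<^sup>2"] int' s by simp
  also have "\<dots> = (\<integral>\<omega>. P (\<lambda>y. (g y)\<^sup>2) (X s \<omega>) - (P g (X s \<omega>))\<^sup>2 \<partial>M)"
    unfolding 1 2 using int[of s "P (\<lambda>y. (g y)\<^sup>2)"] int[of s "\<lambda>x. (P g x)\<^sup>2"] s by simp
  also have "\<dots> \<le> (\<integral>\<omega>. (\<Sum>y\<in>E. p (t - s) (X s \<omega>) y * (g y - g (X s \<omega>))\<^sup>2) \<partial>M)"
  proof (rule integral_mono)
    show "integrable M (\<lambda>\<omega>. P (\<lambda>y. (g y)\<^sup>2) (X s \<omega>) - (P g (X s \<omega>))\<^sup>2)"
      using int[of s "\<lambda>x. P (\<lambda>y. (g y)\<^sup>2) x - (P g x)\<^sup>2"] s by simp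
    show "integrable M (\<lambda>\<omega>. \<Sum>y\<in>E. p (t - s) (X s \<omega>) y * (g y - g (X s \<omega>))\<^sup>2)"
      using int[of s "\<lambda>x. \<Sum>y\<in>E. p (t - s) x y * (g y - g x)\<^sup>2"] s by simp
    fix \<omega> assume "\<omega> \<in> space M"
    define x where "x = X s \<omega>"
    have "(\<Sum>y\<in>E. p (t - s) x y) = 1"
      using transition s X_in_E[OF s(1) \<open>\<omega> \<in> space M\<close>] unfolding transition_function_def x_def by simp
    moreover have "p (t - s) x y * (g y - g x)\<^sup>2
        = p (t - s) x y * (g y)\<^sup>2 - 2 * g x * (p (t - s) x y * g y) + (g x)\<^sup>2 * p (t - s) x y" for y
      by (simp add: power2_eq_square algebra_simps)
    ultimately have "(\<Sum>y\<in>E. p (t - s) x y * (g y - g x)\<^sup>2) = P (\<lambda>y. (g y)\<^sup>2) x - 2 * g x * P g x + (g x)\<^sup>2"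
      by (simp add: P_def sum.distrib sum_subtractf flip: sum_distrib_left)
    moreover have "0 \<le> (P g x - g x)\<^sup>2" by simp
    ultimately show "P (\<lambda>y. (g y)\<^sup>2) (X s \<omega>) - (P g (X s \<omega>))\<^sup>2
        \<le> (\<Sum>y\<in>E. p (t - s) (X s \<omega>) y * (g y - g (X s \<omega>))\<^sup>2)"
      unfolding x_def[symmetric] by (simp add: power2_eq_square algebra_simps)
  qed
  finally show ?thesis by (simp add: P_def)
qed

text \<open>The condition \<open>c x = 0\<close> removes the diagonal term;
  \<open>transition_function\<close> gives derivatives at 0 off the diagonal.\<close>

lemma generator_limit:
  assumes h: "\<And>k. 0 < h k" "h \<longlonglongrightarrow> 0" and x: "x \<in> E" and c: "c x = 0"
  shows "(\<lambda>k. (\<Sum>y\<in>E. p (h k) x y * c y) / h k) \<longlonglongrightarrow> (\<Sum>y\<in>E. q x y * c y)"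
proof -
  have "(\<lambda>k. p (h k) x y * c y / h k) \<longlonglongrightarrow> q x y * c y" if y: "y \<in> E" for y
  proof (cases "x = y")
    case False
    then have "((\<lambda>t. p t x y) has_real_derivative q x y) (at 0 within {0..})" and p0: "p 0 x y = 0"
      using transition x y unfolding transition_function_def by auto
    then have "((\<lambda>t. p t x y / t) \<longlongrightarrow> q x y) (at 0 within {0..})"
      by (simp add: has_field_derivative_iff)
    moreover have "filterlim h (at 0 within {0..}) sequentially"
      using h by (auto simp: filterlim_at less_imp_le less_imp_neq[symmetric])
    ultimately have "(\<lambda>k. p (h k) x y / h k) \<longlonglongrightarrow> q x y"
      by (rule filterlim_compose)
    then have "(\<lambda>k. p (h k) x y / h k * c y) \<longlonglongrightarrow> q x y * c y"
      by (intro tendsto_mult tendsto_const)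
    then show ?thesis by simp
  qed (use c in simp)
  then show ?thesis unfolding sum_divide_distrib by (intro tendsto_sum)
qed

text \<open>A measurable exceptional set \<open>A\<close> replaces the event that the supremum over
  a continuum of times exceeds \<open>e\<close>. The strict inequality in \<open>V\<close> leaves
  room for the discretisation: the one-step second moments divided by the mesh converge to the carre
  du champ and are eventually below \<open>V\<close>.\<close>

lemma dynkin_maximal_inequality:
  fixes f :: "'s \<Rightarrow> real"
  assumes T: "0 < T" and e: "0 < e"
    and V: "\<And>x. x \<in> E \<Longrightarrow> (\<Sum>y\<in>E. q x y * (f y - f x)\<^sup>2) < V"
  shows "\<exists>A\<in>sets M. prob A \<le> T * V / e\<^sup>2 \<and> (\<forall>\<omega>\<in>space M - A. \<forall>t\<in>{0..T}.
     \<bar>f (X t \<omega>) - f (X 0 \<omega>) - integral {0..t} (\<lambda>u. \<Sum>y\<in>E. q (X u \<omega>) y * (f y - f (X u \<omega>)))\<bar> \<le> e)"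
proof -
  \<comment> \<open>With this mesh \<open>Suc k\<close> steps cover \<open>{0..T}\<close>, and the
    bound \<open>real (Suc k) * (V * h k) / e\<^sup>2\<close> of the maximal inequality is
    \<open>T * V / e\<^sup>2\<close> for every \<open>k\<close>.\<close>
  define h where "h k = T / real (Suc k)" for k
  have h: "0 < h k" "h \<longlonglongrightarrow> 0" for k
    using T tendsto_mult[OF tendsto_const[of T] LIMSEQ_inverse_real_of_nat]
    by (simp_all add: h_def[abs_def] divide_inverse)
  define P where "P k x = (\<Sum>y\<in>E. p (h k) x y * f y)" for k x
  define g where "g x = (\<Sum>y\<in>E. q x y * (f y - f x))" for x
  define \<xi> where "\<xi> k i \<omega> = f (X (real (Suc i) * h k) \<omega>) - P k (X (real i * h k) \<omega>)" for k i \<omega>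
  define Bad where "Bad k = {\<omega>\<in>space M. \<exists>j\<le>Suc k. e \<le> \<bar>\<Sum>i<j. \<xi> k i \<omega>\<bar>}" for k
  have t0: "0 \<le> real i * h k" for i k using h(1)[of k] by simp
  have step: "real (Suc i) * h k - real i * h k = h k" "real i * h k \<le> real (Suc i) * h k" for i k
    using h(1)[of k] by (simp_all add: algebra_simps)
  have [measurable]: "\<xi> k i \<in> borel_measurable M" for k i
    unfolding \<xi>_def using t0[of i k] t0[of "Suc i" k]
    by (intro borel_measurable_diff measurable_function_X)
  have Bad_sets: "Bad k \<in> sets M" for k unfolding Bad_def by measurable
  have Bad_bound: "prob (Bad k) \<le> real (Suc k) * (V * h k) / e\<^sup>2"
    if k: "\<And>x. x \<in> E \<Longrightarrow> (\<Sum>y\<in>E. p (h k) x y * (f y - f x)\<^sup>2) \<le> V * h k" for k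
  proof -
    obtain B1 where B1: "0 \<le> B1" "\<And>x. x \<in> E \<Longrightarrow> \<bar>f x\<bar> \<le> B1" using bounded_on_E[of f] by blast
    obtain B2 where B2: "0 \<le> B2" "\<And>x. x \<in> E \<Longrightarrow> \<bar>P k x\<bar> \<le> B2" using bounded_on_E[of "P k"] by blast
    show ?thesis unfolding Bad_def
    proof (rule martingale_maximal_inequality[where F="\<lambda>i. natural_filtration M X (real i * h k)" and B="B1 + B2"])
      show "subalgebra M (natural_filtration M X (real i * h k))" for i
        by (rule subalgebra_natural_filtration)
      show "\<xi> k i \<in> borel_measurable (natural_filtration M X (real j * h k))" if "i < j" for i j
      proof -
        have "real (Suc i) * h k \<le> real j * h k" using that h(1)[of k] by (intro mult_right_mono) auto
        then show ?thesis unfolding \<xi>_def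
          using step(2)[of i k] t0[of i k] t0[of "Suc i" k] by (intro borel_measurable_diff adapted) linarith+
      qed
      show "\<bar>\<xi> k i \<omega>\<bar> \<le> B1 + B2" if "\<omega> \<in> space M" for i \<omega>
        using B1(2)[OF X_in_E[OF t0[of "Suc i" k] that]] B2(2)[OF X_in_E[OF t0[of i k] that]]
        unfolding \<xi>_def by linarith
      show "(\<integral>\<omega>. W \<omega> * \<xi> k i \<omega> \<partial>M) = 0"
        if W: "W \<in> borel_measurable (natural_filtration M X (real i * h k))"
          "\<And>\<omega>. \<omega> \<in> space M \<Longrightarrow> \<bar>W \<omega>\<bar> \<le> C" for i W C
      proof -
        have [measurable]: "W \<in> borel_measurable M"
          using measurable_from_subalg[OF subalgebra_natural_filtration W(1)] .
        have int: "integrable M (\<lambda>\<omega>. W \<omega> * \<phi> (X t \<omega>))" if "0 \<le> t" for \<phi> :: "'s \<Rightarrow> real" and t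
        proof -
          obtain B where B: "0 \<le> B" "\<And>x. x \<in> E \<Longrightarrow> \<bar>\<phi> x\<bar> \<le> B" using bounded_on_E[of \<phi>] by blast
          show ?thesis
          proof (rule integrable_bounded[where B="C * B"])
            show "\<bar>W \<omega> * \<phi> (X t \<omega>)\<bar> \<le> C * B" if "\<omega> \<in> space M" for \<omega>
              using mult_mono[OF W(2)[OF that] B(2)[OF X_in_E[OF \<open>0 \<le> t\<close> that]]] W(2)[OF that]
              by (simp add: abs_mult)
          qed (use measurable_function_X[OF that, of \<phi>] in measurable)
        qed
        have "(\<integral>\<omega>. W \<omega> * \<xi> k i \<omega> \<partial>M) = (\<integral>\<omega>. W \<omega> * f (X (real (Suc i) * h k) \<omega>) \<partial>M)
            - (\<integral>\<omega>. W \<omega> * P k (X (real i * h k) \<omega>) \<partial>M)"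
          unfolding \<xi>_def right_diff_distrib by (intro Bochner_Integration.integral_diff int t0)
        then show ?thesis
          using markov_property[OF t0[of i k] step(2)[of i k] W, of f] by (simp only: step(1) P_def)
      qed
      show "(\<integral>\<omega>. (\<xi> k i \<omega>)\<^sup>2 \<partial>M) \<le> V * h k" for i
      proof -
        have "(\<integral>\<omega>. (\<xi> k i \<omega>)\<^sup>2 \<partial>M) \<le>
          (\<integral>\<omega>. (\<Sum>y\<in>E. p (h k) (X (real i * h k) \<omega>) y * (f y - f (X (real i * h k) \<omega>))\<^sup>2) \<partial>M)"
          using transition_second_moment[OF t0[of i k] step(2)[of i k], of f] by (simp only: step(1) P_def \<xi>_def)
        also have "\<dots> \<le> (\<integral>\<omega>. V * h k \<partial>M)"
        proof (rule integral_mono)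
          obtain B where "0 \<le> B" "\<And>x. x \<in> E \<Longrightarrow> \<bar>\<Sum>y\<in>E. p (h k) x y * (f y - f x)\<^sup>2\<bar> \<le> B"
            using bounded_on_E[of "\<lambda>x. \<Sum>y\<in>E. p (h k) x y * (f y - f x)\<^sup>2"] by blast
          then show "integrable M (\<lambda>\<omega>. \<Sum>y\<in>E. p (h k) (X (real i * h k) \<omega>) y * (f y - f (X (real i * h k) \<omega>))\<^sup>2)"
            by (intro integrable_bounded[where B=B] measurable_function_X[OF t0, of "\<lambda>x. \<Sum>y\<in>E. p (h k) x y * (f y - f x)\<^sup>2"])
              (use X_in_E[OF t0] in auto)
          show "(\<Sum>y\<in>E. p (h k) (X (real i * h k) \<omega>) y * (f y - f (X (real i * h k) \<omega>))\<^sup>2) \<le> V * h k"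
            if "\<omega> \<in> space M" for \<omega> using k[OF X_in_E[OF t0 that]] .
        qed simp
        finally show ?thesis by (simp add: prob_space)
      qed
    qed (rule e)
  qed
  \<comment> \<open>Finiteness of \<open>E\<close> makes the threshold uniform in the state.\<close>
  have "\<forall>\<^sub>F k in sequentially. \<forall>x\<in>E. (\<Sum>y\<in>E. p (h k) x y * (f y - f x)\<^sup>2) / h k < V"
    using V by (intro eventually_ball_finite finite_E ballI order_tendstoD(2)[OF generator_limit[OF h]]) auto
  then obtain k0 where k0: "\<And>k x. k0 \<le> k \<Longrightarrow> x \<in> E \<Longrightarrow> (\<Sum>y\<in>E. p (h k) x y * (f y - f x)\<^sup>2) / h k < V"
    unfolding eventually_sequentially by blast
  have Bad_le: "prob (Bad k) \<le> T * V / e\<^sup>2" if "k0 \<le> k" for k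
  proof -
    have le: "(\<Sum>y\<in>E. p (h k) x y * (f y - f x)\<^sup>2) \<le> V * h k" if "x \<in> E" for x
      using k0[OF \<open>k0 \<le> k\<close> that] h(1)[of k] by (simp add: pos_divide_less_eq less_imp_le)
    have eq: "real (Suc k) * (V * h k) = T * V" by (simp add: h_def)
    show ?thesis using Bad_bound[OF le] unfolding eq .
  qed
  \<comment> \<open>The union of the sets \<open>A m\<close> is the event that all but finitely many
    skeletons are bad. It inherits the bound because each \<open>A m\<close> lies in one
    \<open>Bad\<close> set; the event that infinitely many are bad could be larger. Outside the
    union infinitely many skeletons are good, which suffices because the skeleton martingales
    converge.\<close>
  define A where "A m = (\<Inter>k\<in>{k0 + m..}. Bad k)" for m
  have Am: "A m \<in> sets M" for m
    unfolding A_def using Bad_sets by (intro sets.countable_INT') auto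
  have "incseq A" unfolding A_def by (intro monoI) force
  then have "(\<lambda>m. prob (A m)) \<longlonglongrightarrow> prob (\<Union>m. A m)"
    using Am by (intro finite_Lim_measure_incseq) auto
  moreover have "prob (A m) \<le> T * V / e\<^sup>2" for m
  proof -
    have "prob (A m) \<le> prob (Bad (k0 + m))"
      using Bad_sets by (intro finite_measure_mono) (auto simp: A_def)
    then show ?thesis using Bad_le[of "k0 + m"] by simp
  qed
  ultimately have "prob (\<Union>m. A m) \<le> T * V / e\<^sup>2" by (intro LIMSEQ_le_const2) auto
  moreover have "\<bar>f (X t \<omega>) - f (X 0 \<omega>) - integral {0..t} (\<lambda>u. g (X u \<omega>))\<bar> \<le> e"
    if \<omega>: "\<omega> \<in> space M" "\<omega> \<notin> (\<Union>m. A m)" and t: "t \<in> {0..T}" for \<omega> t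
  proof -
    \<comment> \<open>Ceiling here, and not floor plus one: for \<open>t = T\<close> the latter
      would need one step more than the \<open>Suc k\<close> that \<open>Bad k\<close> looks
      at.\<close>
    define j where "j k = nat \<lceil>t / h k\<rceil>" for k
    define D where "D k = (\<Sum>i<j k. \<xi> k i \<omega>)" for k
    define a where "a k x = (\<Sum>y\<in>E. p (h k) x y * (f y - f x)) / h k" for k x
    define \<delta> where "\<delta> k = (\<Sum>x\<in>E. \<bar>a k x - g x\<bar>)" for k
    have j_real: "real (j k) = real_of_int \<lceil>t / h k\<rceil>" for k
      using t h(1)[of k] by (simp add: j_def)
    have j1: "t \<le> real (j k) * h k" for k
      using le_of_int_ceiling[of "t / h k"] h(1)[of k] pos_divide_le_eq[OF h(1)[of k], of t] j_real by metis
    have j2: "real (j k) * h k \<le> t + h k" for k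
    proof -
      have "real (j k) - 1 \<le> t / h k" unfolding j_real by linarith
      then have "(real (j k) - 1) * h k \<le> t" using h(1)[of k] pos_le_divide_eq by blast
      then show ?thesis by (simp add: algebra_simps)
    qed
    have jlim: "(\<lambda>k. real (j k) * h k) \<longlonglongrightarrow> t"
      using tendsto_sandwich[OF always_eventually always_eventually, of "\<lambda>_. t" "\<lambda>k. real (j k) * h k" "\<lambda>k. t + h k"]
        j1 j2 tendsto_add[OF tendsto_const[of t] h(2)] by simp
    have jk: "j k \<le> Suc k" for k
    proof -
      have "real (Suc k) * h k = T" by (simp add: h_def)
      then have "t / h k \<le> real (Suc k)" using t h(1)[of k] by (metis atLeastAtMost_iff pos_divide_le_eq)
      then have "\<lceil>t / h k\<rceil> \<le> int (Suc k)" by (intro ceiling_le) simp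
      then show ?thesis by (simp only: j_def nat_le_iff)
    qed
    have \<delta>: "\<delta> \<longlonglongrightarrow> 0"
    proof -
      have "(\<lambda>k. \<bar>a k x - g x\<bar>) \<longlonglongrightarrow> 0" if "x \<in> E" for x
        using generator_limit[OF h that, of "\<lambda>y. f y - f x"] unfolding a_def g_def
        by (intro tendsto_rabs_zero) (simp add: LIM_zero)
      then show ?thesis unfolding \<delta>_def by (intro tendsto_null_sum) auto
    qed
    have \<delta>_le: "\<bar>a k x - g x\<bar> \<le> \<delta> k" if "x \<in> E" for k x
      unfolding \<delta>_def using finite_E that by (intro member_le_sum) auto
    have P: "P k x = f x + h k * a k x" if "x \<in> E" for k x
    proof -
      have "(\<Sum>y\<in>E. p (h k) x y) = 1"
        using transition h(1)[of k] that unfolding transition_function_def by (simp add: less_imp_le)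
      then have "(\<Sum>y\<in>E. p (h k) x y * f x) = f x" by (simp add: sum_distrib_right[symmetric])
      then have "(\<Sum>y\<in>E. p (h k) x y * (f y - f x)) = P k x - f x"
        by (simp add: P_def right_diff_distrib sum_subtractf)
      then show ?thesis using h(1)[of k] by (simp add: a_def)
    qed
    \<comment> \<open>The skeleton martingale is the increment of \<open>f\<close>, minus a Riemann
      sum of the generator term \<open>g\<close>, minus the error of replacing the difference
      quotient \<open>a k\<close> by \<open>g\<close>; this error is at most
      \<open>\<delta> k\<close> per unit of time.\<close>
    have D_eq: "D k = f (X (real (j k) * h k) \<omega>) - f (X 0 \<omega>)
        - h k * (\<Sum>i<j k. g (X (real i * h k) \<omega>)) - h k * (\<Sum>i<j k. a k (X (real i * h k) \<omega>) - g (X (real i * h k) \<omega>))" for k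
    proof -
      have "D k = (\<Sum>i<j k. (f (X (real (Suc i) * h k) \<omega>) - f (X (real i * h k) \<omega>)) - h k * a k (X (real i * h k) \<omega>))"
        unfolding D_def \<xi>_def using P[OF X_in_E[OF t0 \<omega>(1)]] by (intro sum.cong) auto
      also have "\<dots> = f (X (real (j k) * h k) \<omega>) - f (X 0 \<omega>) - h k * (\<Sum>i<j k. a k (X (real i * h k) \<omega>))"
        using sum_lessThan_telescope[of "\<lambda>i. f (X (real i * h k) \<omega>)" "j k"]
        by (simp add: sum_subtractf sum_distrib_left)
      finally show ?thesis by (simp add: sum_subtractf algebra_simps)
    qed
    have err: "(\<lambda>k. h k * (\<Sum>i<j k. a k (X (real i * h k) \<omega>) - g (X (real i * h k) \<omega>))) \<longlonglongrightarrow> 0"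
    proof (rule Lim_null_comparison[OF always_eventually])
      show "\<forall>k. norm (h k * (\<Sum>i<j k. a k (X (real i * h k) \<omega>) - g (X (real i * h k) \<omega>))) \<le> (real (j k) * h k) * \<delta> k"
      proof
        fix k
        have "\<bar>\<Sum>i<j k. a k (X (real i * h k) \<omega>) - g (X (real i * h k) \<omega>)\<bar> \<le> (\<Sum>i<j k. \<delta> k)"
          by (intro order_trans[OF sum_abs] sum_mono \<delta>_le X_in_E t0 \<omega>)
        then show "norm (h k * (\<Sum>i<j k. a k (X (real i * h k) \<omega>) - g (X (real i * h k) \<omega>))) \<le> (real (j k) * h k) * \<delta> k"
          using h(1)[of k] by (simp add: abs_mult mult.commute mult.left_commute)
      qed
      show "(\<lambda>k. (real (j k) * h k) * \<delta> k) \<longlonglongrightarrow> 0"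
        using tendsto_mult[OF jlim \<delta>] by simp
    qed
    obtain B where B: "0 \<le> B" "\<And>x. x \<in> E \<Longrightarrow> \<bar>g x\<bar> \<le> B" using bounded_on_E[of g] by blast
    have riemann: "(\<lambda>k. h k * (\<Sum>i<j k. g (X (real i * h k) \<omega>))) \<longlonglongrightarrow> integral {0..t} (\<lambda>u. g (X u \<omega>))"
      using t B X_in_E \<omega>
      by (intro riemann_sum_tendsto_integral[where B=B] cadlag_path h j1 jlim) auto
    have "(\<lambda>k. f (X (real (j k) * h k) \<omega>)) \<longlonglongrightarrow> f (X t \<omega>)"
      using t by (intro cadlag_right_continuous_seq[OF cadlag_path[OF \<omega>(1), of f]] jlim j1) auto
    then have "D \<longlonglongrightarrow> f (X t \<omega>) - f (X 0 \<omega>) - integral {0..t} (\<lambda>u. g (X u \<omega>)) - 0"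
      unfolding D_eq by (intro tendsto_diff tendsto_const riemann err)
    then have lim: "(\<lambda>k. \<bar>D k\<bar>) \<longlonglongrightarrow> \<bar>f (X t \<omega>) - f (X 0 \<omega>) - integral {0..t} (\<lambda>u. g (X u \<omega>))\<bar>"
      by (intro tendsto_rabs) simp
    show ?thesis
    proof (rule ccontr)
      assume "\<not> ?thesis"
      then have "\<forall>\<^sub>F k in sequentially. e < \<bar>D k\<bar>" by (intro order_tendstoD(1)[OF lim]) simp
      then obtain m where "\<And>k. m \<le> k \<Longrightarrow> e < \<bar>D k\<bar>" unfolding eventually_sequentially by blast
      then have "\<omega> \<in> Bad k" if "m \<le> k" for k
        using that jk[of k] \<omega>(1) unfolding Bad_def D_def by (auto intro!: exI[of _ "j k"] less_imp_le)
      then have "\<omega> \<in> A m" unfolding A_def by auto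
      then show False using \<omega>(2) by blast
    qed
  qed
  ultimately show ?thesis
    using Am by (intro bexI[of _ "\<Union>m. A m"]) (auto simp: g_def)
qed

end

section \<open>Stability of the generalized Skorohod problem\<close>

text \<open>
  A reformulation of \<open>\<integral> x dr = 0\<close> that needs no Stieltjes measure and is stable under limits.
\<close>

definition reflection_term :: "(real \<Rightarrow> real) \<Rightarrow> (real \<Rightarrow> real) \<Rightarrow> bool" where
  "reflection_term x r \<longleftrightarrow> mono_on {0..} r \<and> r 0 = 0 \<and>
     (\<forall>a b. 0 \<le> a \<and> a \<le> b \<and> (\<forall>u\<in>{a<..b}. 0 < x u) \<longrightarrow> r b = r a) \<and>
     (\<forall>t>0. 0 < x t \<longrightarrow> (r \<longlongrightarrow> r t) (at_left t))"

lemma reflection_termD: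
  assumes "reflection_term x r"
  shows "\<And>a b. 0 \<le> a \<Longrightarrow> a \<le> b \<Longrightarrow> r a \<le> r b" "r 0 = 0"
    "\<And>a b. 0 \<le> a \<Longrightarrow> a \<le> b \<Longrightarrow> (\<And>u. a < u \<Longrightarrow> u \<le> b \<Longrightarrow> 0 < x u) \<Longrightarrow> r b = r a"
    "\<And>t. 0 < t \<Longrightarrow> 0 < x t \<Longrightarrow> (r \<longlongrightarrow> r t) (at_left t)"
proof -
  show "r a \<le> r b" if "0 \<le> a" "a \<le> b" for a b
    using assms that unfolding reflection_term_def by (intro mono_onD[of "{0..}" r]) auto
  show "r b = r a" if "0 \<le> a" "a \<le> b" "\<And>u. a < u \<Longrightarrow> u \<le> b \<Longrightarrow> 0 < x u" for a b
  proof -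
    have "\<forall>u\<in>{a<..b}. 0 < x u" using that(3) by simp
    then show ?thesis using assms that(1,2) unfolding reflection_term_def by blast
  qed
qed (use assms in \<open>auto simp: reflection_term_def\<close>)

text \<open>
  After the last time \<open>\<tau>\<close> at which \<open>r \<le> r' + e\<close>, the path \<open>x\<close> lies strictly above \<open>x' \<ge> 0\<close>, so that
  \<open>r\<close> does not increase any more.
\<close>

lemma reflection_term_comparison:
  assumes r: "reflection_term x r" and r': "reflection_term x' r'"
    and t: "0 \<le> t" and e: "0 \<le> e"
    and x': "\<And>u. 0 \<le> u \<Longrightarrow> u \<le> t \<Longrightarrow> 0 \<le> x' u"
    and le: "\<And>u. 0 \<le> u \<Longrightarrow> u \<le> t \<Longrightarrow> x' u - r' u - e \<le> x u - r u"
  shows "r t \<le> r' t + e"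
proof (rule ccontr)
  assume not: "\<not> r t \<le> r' t + e"
  define A where "A = {u\<in>{0..t}. r u \<le> r' u + e}"
  define \<tau> where "\<tau> = Sup A"
  have A0: "0 \<in> A" using t e reflection_termD(2)[OF r] reflection_termD(2)[OF r'] by (simp add: A_def)
  have bdd: "bdd_above A" unfolding A_def by (rule bdd_aboveI[of _ t]) simp
  have \<tau>: "0 \<le> \<tau>" "\<tau> \<le> t"
    unfolding \<tau>_def using cSup_upper[OF A0 bdd] A0 by (auto intro!: cSup_least simp: A_def)
  \<comment> \<open>Rearranged, \<open>le\<close> says that \<open>x u\<close> is at least
    \<open>x' u + (r u - r' u - e)\<close>, and the bracket is positive outside
    \<open>A\<close>.\<close>
  have pos: "0 < x u" if "0 \<le> u" "u \<le> t" "u \<notin> A" for u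
    using that le[of u] x'[of u] by (simp add: A_def)
  have "u \<notin> A" if "\<tau> < u" for u
    using that cSup_upper[OF _ bdd, of u] unfolding \<tau>_def by auto
  then have rt: "r t = r \<tau>"
    using \<tau> by (intro reflection_termD(3)[OF r] pos) auto
  have "\<tau> \<notin> A"
    using not rt reflection_termD(1)[OF r' \<tau>] by (auto simp: A_def)
  then have "\<tau> \<noteq> 0" "0 < x \<tau>" using A0 pos[OF \<tau>] by auto
  \<comment> \<open>Since \<open>x \<tau>\<close> is positive, \<open>r\<close> has no jump at
    \<open>\<tau>\<close>, so it exceeds \<open>r' \<tau> + e\<close> already shortly before
    \<open>\<tau>\<close>. But \<open>\<tau>\<close> is a supremum of \<open>A\<close> outside
    \<open>A\<close>, so points of \<open>A\<close> lie there, and \<open>r'\<close> is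
    monotone.\<close>
  then have "(r \<longlongrightarrow> r \<tau>) (at_left \<tau>)" using reflection_termD(4)[OF r, of \<tau>] \<tau> by simp
  moreover have "r' \<tau> + e < r \<tau>" using not rt reflection_termD(1)[OF r' \<tau>] by simp
  ultimately have "\<forall>\<^sub>F u in at_left \<tau>. r' \<tau> + e < r u" by (rule order_tendstoD)
  then obtain b where b: "b < \<tau>" "\<And>u. b < u \<Longrightarrow> u < \<tau> \<Longrightarrow> r' \<tau> + e < r u"
    unfolding eventually_at_left_field by blast
  obtain u where u: "u \<in> A" "b < u" using less_cSupD[of A b] A0 b(1) unfolding \<tau>_def by auto
  have "u \<le> \<tau>" using cSup_upper[OF u(1) bdd] by (simp add: \<tau>_def)
  then have "u < \<tau>" using u(1) \<open>\<tau> \<notin> A\<close> by (cases "u = \<tau>") auto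
  then have "r' \<tau> + e < r u" using b(2) u(2) by simp
  moreover have "r' u \<le> r' \<tau>" using u(1) \<open>u \<le> \<tau>\<close> by (intro reflection_termD(1)[OF r']) (auto simp: A_def)
  ultimately show False using u(1) by (simp add: A_def)
qed

text \<open>Level \<open>k\<close> is a one-dimensional reflection problem whose input is the free
  part minus the reflection term of level \<open>k - 1\<close>. By comparison in both directions its
  error is at most the error of the previous reflection term plus \<open>\<eta>\<close>, so the
  errors grow linearly in \<open>k\<close>.\<close>

lemma reflection_chain_stability:
  fixes s r s' r' :: "real \<Rightarrow> nat \<Rightarrow> real"
  assumes R: "\<And>k. k \<in> {1..K} \<Longrightarrow> reflection_term (\<lambda>t. s t k) (\<lambda>t. r t k)"
    and R': "\<And>k. k \<in> {1..K} \<Longrightarrow> reflection_term (\<lambda>t. s' t k) (\<lambda>t. r' t k)"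
    and pos: "\<And>k u. k \<in> {1..K} \<Longrightarrow> 0 \<le> u \<Longrightarrow> 0 \<le> s u k"
      "\<And>k u. k \<in> {1..K} \<Longrightarrow> 0 \<le> u \<Longrightarrow> 0 \<le> s' u k"
    and y: "\<And>k u. k \<in> {1..K} \<Longrightarrow> 0 \<le> u \<Longrightarrow> u \<le> t \<Longrightarrow>
      \<bar>(s u k - r u k + (if 2 \<le> k then r u (k - 1) else 0)) -
       (s' u k - r' u k + (if 2 \<le> k then r' u (k - 1) else 0))\<bar> \<le> \<eta>"
    and k: "k \<in> {1..K}" and u: "0 \<le> u" "u \<le> t"
  shows "\<bar>r u k - r' u k\<bar> \<le> real k * \<eta>" "\<bar>s u k - s' u k\<bar> \<le> 2 * real k * \<eta>"
proof -
  have step: "\<bar>r u k - r' u k\<bar> \<le> c + \<eta>"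
    if k: "k \<in> {1..K}" and u: "0 \<le> u" "u \<le> t" and c: "0 \<le> c"
      "\<And>v. 0 \<le> v \<Longrightarrow> v \<le> t \<Longrightarrow> \<bar>(if 2 \<le> k then r v (k - 1) else 0) - (if 2 \<le> k then r' v (k - 1) else 0)\<bar> \<le> c"
    for k u c
  proof -
    have \<eta>: "0 \<le> \<eta>" using y[OF k u] by linarith
    have "r u k \<le> r' u k + (c + \<eta>)"
      using u \<eta> c(1) pos(2)[OF k]
    proof (intro reflection_term_comparison[OF R[OF k] R'[OF k]])
      show "s' v k - r' v k - (c + \<eta>) \<le> s v k - r v k" if v: "0 \<le> v" "v \<le> u" for v
        using y[OF k v(1)] c(2)[of v] v u by linarith
    qed auto
    moreover have "r' u k \<le> r u k + (c + \<eta>)"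
      using u \<eta> c(1) pos(1)[OF k]
    proof (intro reflection_term_comparison[OF R'[OF k] R[OF k]])
      show "s v k - r v k - (c + \<eta>) \<le> s' v k - r' v k" if v: "0 \<le> v" "v \<le> u" for v
        using y[OF k v(1)] c(2)[of v] v u by linarith
    qed auto
    ultimately show ?thesis by linarith
  qed
  have r_diff: "\<bar>r u k - r' u k\<bar> \<le> real k * \<eta>" if "k \<in> {1..K}" "0 \<le> u" "u \<le> t" for k u
    using that
  proof (induction k arbitrary: u)
    case (Suc k)
    have \<eta>: "0 \<le> \<eta>" using y[OF Suc.prems] by linarith
    have "\<bar>r u (Suc k) - r' u (Suc k)\<bar> \<le> real k * \<eta> + \<eta>"
    proof (rule step[OF Suc.prems])
      show "\<bar>(if 2 \<le> Suc k then r v (Suc k - 1) else 0) - (if 2 \<le> Suc k then r' v (Suc k - 1) else 0)\<bar> \<le> real k * \<eta>"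
        if "0 \<le> v" "v \<le> t" for v
        using Suc.IH[of v] Suc.prems that \<eta> by auto
    qed (use \<eta> in simp)
    then show ?case by (simp add: algebra_simps)
  qed simp
  show rk: "\<bar>r u k - r' u k\<bar> \<le> real k * \<eta>" using r_diff[OF k u] .
  have \<eta>: "0 \<le> \<eta>" using y[OF k u] by linarith
  have "\<bar>(if 2 \<le> k then r u (k - 1) else 0) - (if 2 \<le> k then r' u (k - 1) else 0)\<bar> \<le> (real k - 1) * \<eta>"
  proof (cases "2 \<le> k")
    case True
    then have "k - 1 \<in> {1..K}" "real (k - 1) = real k - 1" using k by auto
    then show ?thesis using True r_diff[of "k - 1" u] u by simp
  qed (use k \<eta> in auto)
  \<comment> \<open>The factor \<open>2 * real k\<close> is 1 for the free part,
    \<open>real k\<close> for the reflection term of level \<open>k\<close> and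
    \<open>real k - 1\<close> for that of the level below.\<close>
  then show "\<bar>s u k - s' u k\<bar> \<le> 2 * real k * \<eta>"
    using y[OF k u] rk by (simp add: algebra_simps)
qed

text \<open>In the norm weighted by \<open>exp (- (L * v))\<close> integration gains a factor
  \<open>1 / L\<close>. This gain is the source of the contraction.\<close>

lemma integral_diff_exp_bound:
  fixes f g :: "real \<Rightarrow> real"
  assumes f: "f integrable_on {0..u}" and g: "g integrable_on {0..u}"
    and L: "0 < L" and u: "0 \<le> u" and B: "0 \<le> B"
    and le: "\<And>v. 0 \<le> v \<Longrightarrow> v \<le> u \<Longrightarrow> \<bar>f v - g v\<bar> \<le> B * exp (L * v)"
  shows "\<bar>integral {0..u} f - integral {0..u} g\<bar> \<le> B * exp (L * u) / L"
proof -
  have "((\<lambda>v. B * exp (L * v)) has_integral (B * exp (L * u) / L - B * exp (L * 0) / L)) {0..u}"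
    using u L by (intro fundamental_theorem_of_calculus)
      (auto intro!: derivative_eq_intros simp: has_real_derivative_iff_has_vector_derivative[symmetric])
  note I = this
  have E: "(\<lambda>v. B * exp (L * v)) integrable_on {0..u}"
    "integral {0..u} (\<lambda>v. B * exp (L * v)) \<le> B * exp (L * u) / L"
    using has_integral_integrable[OF I] L B unfolding integral_unique[OF I] by simp_all
  have "norm (integral {0..u} (\<lambda>v. f v - g v)) \<le> integral {0..u} (\<lambda>v. B * exp (L * v))"
    using le by (intro integral_norm_bound_integral integrable_diff f g E(1)) auto
  then show ?thesis using E(2) Henstock_Kurzweil_Integration.integral_diff[OF f g] by simp
qed

lemma integrable_on_integral:
  fixes f :: "real \<Rightarrow> real"
  assumes "\<And>u. f integrable_on {0..u}"
  shows "(\<lambda>u. integral {0..u} f) integrable_on {0..t}"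
  by (intro integrable_continuous_interval indefinite_integral_continuous_1 assms)

text \<open>For \<open>k < d - 1\<close> the three terms of the integrand, with coefficients at most
  \<open>d\<close>, \<open>d\<close> and 1, give \<open>mu * (2 * real d + 1)\<close>. The last
  coordinate gives \<open>real d * mu * (1 + mu) + mu\<close>, where the square of \<open>mu\<close>
  comes from the double integral; the stated constant dominates both.\<close>

lemma G_functional_lipschitz:
  assumes mu: "0 \<le> mu" and d: "2 \<le> d" and k: "k \<in> {1..d - 1}" and u: "0 \<le> u"
    and L: "1 \<le> L" and A: "0 \<le> A"
    and int: "\<And>k t. k \<in> {1..d - 1} \<Longrightarrow> (\<lambda>v. h v k) integrable_on {0..t}"
      "\<And>k t. k \<in> {1..d - 1} \<Longrightarrow> (\<lambda>v. h' v k) integrable_on {0..t}"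
    and le: "\<And>v k. k \<in> {1..d - 1} \<Longrightarrow> 0 \<le> v \<Longrightarrow> v \<le> u \<Longrightarrow> \<bar>h v k - h' v k\<bar> \<le> A * exp (L * v)"
  shows "\<bar>G_functional d mu h \<beta> \<eta> u k - G_functional d mu h' \<beta> \<eta> u k\<bar>
      \<le> (mu * (2 * real d + 1) + real d * mu\<^sup>2) * (A * exp (L * u) / L)"
proof -
  define Q where "Q = A * exp (L * u) / L"
  have Q: "0 \<le> Q" using A L by (simp add: Q_def)
  have one: "1 \<in> {1..d - 1}" using d by auto
  show ?thesis
  proof (cases "k = d - 1")
    case True
    define f where "f h u = \<beta> - h u (d - 1) - mu * integral {0..u} (\<lambda>v. h v 1)" for h :: "real \<Rightarrow> nat \<Rightarrow> real" and u
    have intf: "f h integrable_on {0..u}" "f h' integrable_on {0..u}"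
      unfolding f_def using one d
      by (intro integrable_diff integrable_const_ivl integrable_on_mult_right integrable_on_integral int; simp)+
    have "\<bar>f h v - f h' v\<bar> \<le> ((1 + mu) * A) * exp (L * v)" if v: "0 \<le> v" "v \<le> u" for v
    proof -
      have "\<bar>integral {0..v} (\<lambda>v. h v 1) - integral {0..v} (\<lambda>v. h' v 1)\<bar> \<le> A * exp (L * v) / L"
        using v L A by (intro integral_diff_exp_bound int one le) auto
      \<comment> \<open>The inner integral gains its own factor \<open>1 / L\<close>, which is given
        away here: the outer integration produces the one that is kept.\<close>
      also have "\<dots> \<le> A * exp (L * v)" using L A divide_left_mono[of 1 L "A * exp (L * v)"] by simp
      finally have "mu * \<bar>integral {0..v} (\<lambda>v. h v 1) - integral {0..v} (\<lambda>v. h' v 1)\<bar> \<le> mu * (A * exp (L * v))"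
        using mu by (rule mult_left_mono)
      moreover have "\<bar>h v (d - 1) - h' v (d - 1)\<bar> \<le> A * exp (L * v)" using d v by (intro le) auto
      moreover have "\<bar>f h v - f h' v\<bar> \<le> \<bar>h v (d - 1) - h' v (d - 1)\<bar>
          + \<bar>mu * (integral {0..v} (\<lambda>v. h v 1) - integral {0..v} (\<lambda>v. h' v 1))\<bar>"
        unfolding f_def right_diff_distrib by linarith
      moreover have "\<bar>mu * (integral {0..v} (\<lambda>v. h v 1) - integral {0..v} (\<lambda>v. h' v 1))\<bar>
          = mu * \<bar>integral {0..v} (\<lambda>v. h v 1) - integral {0..v} (\<lambda>v. h' v 1)\<bar>"
        using mu by (simp add: abs_mult)
      moreover have "((1 + mu) * A) * exp (L * v) = A * exp (L * v) + mu * (A * exp (L * v))"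
        by (simp add: algebra_simps)
      ultimately show ?thesis by linarith
    qed
    then have 1: "\<bar>integral {0..u} (f h) - integral {0..u} (f h')\<bar> \<le> (1 + mu) * A * exp (L * u) / L"
      using u L A mu by (intro integral_diff_exp_bound intf) auto
    have 2: "\<bar>integral {0..u} (\<lambda>v. h v 1) - integral {0..u} (\<lambda>v. h' v 1)\<bar> \<le> A * exp (L * u) / L"
      using u L A by (intro integral_diff_exp_bound int one le) auto
    have "\<bar>G_functional d mu h \<beta> \<eta> u k - G_functional d mu h' \<beta> \<eta> u k\<bar>
      = \<bar>real d * mu * (integral {0..u} (f h) - integral {0..u} (f h'))
         - mu * (integral {0..u} (\<lambda>v. h v 1) - integral {0..u} (\<lambda>v. h' v 1))\<bar>"
      using True by (simp add: G_functional_def f_def[abs_def] right_diff_distrib)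
    also have "\<dots> \<le> real d * mu * \<bar>integral {0..u} (f h) - integral {0..u} (f h')\<bar>
         + mu * \<bar>integral {0..u} (\<lambda>v. h v 1) - integral {0..u} (\<lambda>v. h' v 1)\<bar>"
      using mu by (intro order_trans[OF abs_triangle_ineq4]) (simp add: abs_mult)
    also have "\<dots> \<le> real d * mu * ((1 + mu) * Q) + mu * Q"
      using 1 2 mu by (intro add_mono mult_left_mono) (simp_all add: Q_def mult.assoc)
    also have "\<dots> \<le> (mu * (2 * real d + 1) + real d * mu\<^sup>2) * Q"
      using mu Q by (simp add: power2_eq_square algebra_simps)
    finally show ?thesis unfolding Q_def .
  next
    case False
    then have k': "Suc k \<in> {1..d - 1}" "real (Suc k) \<le> real d" using k by auto
    define f where "f h u = real (k + 1) * h u (k + 1) - real (k + 1) * h u k - h u 1"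
      for h :: "real \<Rightarrow> nat \<Rightarrow> real" and u :: real
    have intf: "f h integrable_on {0..u}" "f h' integrable_on {0..u}"
      unfolding f_def using one k' k
      by (intro integrable_diff integrable_on_mult_right int; simp)+
    have "\<bar>f h v - f h' v\<bar> \<le> ((2 * real d + 1) * A) * exp (L * v)" if v: "0 \<le> v" "v \<le> u" for v
    proof -
      have *: "real (k + 1) * \<bar>h v j - h' v j\<bar> \<le> real d * (A * exp (L * v))" if "j \<in> {1..d - 1}" for j
        using le[OF that v] k'(2) A by (intro mult_mono) auto
      have "\<bar>f h v - f h' v\<bar> \<le> \<bar>real (k + 1) * (h v (k + 1) - h' v (k + 1))\<bar>
          + \<bar>real (k + 1) * (h v k - h' v k)\<bar> + \<bar>h v 1 - h' v 1\<bar>"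
        unfolding f_def right_diff_distrib by linarith
      also have "\<dots> \<le> real d * (A * exp (L * v)) + real d * (A * exp (L * v)) + A * exp (L * v)"
        using *[of k] *[of "k + 1"] le[OF one v] k k' unfolding abs_mult abs_of_nat by (intro add_mono) simp_all
      finally show ?thesis by (simp add: algebra_simps)
    qed
    then have 1: "\<bar>integral {0..u} (f h) - integral {0..u} (f h')\<bar> \<le> (2 * real d + 1) * A * exp (L * u) / L"
      using u L A by (intro integral_diff_exp_bound intf) auto
    have "\<bar>G_functional d mu h \<beta> \<eta> u k - G_functional d mu h' \<beta> \<eta> u k\<bar>
       = mu * \<bar>integral {0..u} (f h) - integral {0..u} (f h')\<bar>"
      using False mu by (simp add: G_functional_def f_def[abs_def] right_diff_distrib[symmetric] abs_mult)
    also have "\<dots> \<le> mu * ((2 * real d + 1) * Q)"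
      using 1 mu by (intro mult_left_mono) (simp_all add: Q_def mult.assoc)
    also have "\<dots> \<le> (mu * (2 * real d + 1) + real d * mu\<^sup>2) * Q"
      using mu Q by (simp add: algebra_simps)
    finally show ?thesis unfolding Q_def .
  qed
qed

text \<open>Sign and reflection conditions are exact and hold for all times; the equation has error
  at most \<open>\<epsilon>\<close>, on \<open>{0..T}\<close>. Exact solutions belong to the class
  with \<open>\<epsilon> = 0\<close> and the good paths of the scaled process with a small
  \<open>\<epsilon>\<close>, so one stability estimate covers both.\<close>

definition approx_skorohod_solution ::
    "nat \<Rightarrow> real \<Rightarrow> real \<Rightarrow> real \<Rightarrow> real \<Rightarrow> real \<Rightarrow> (real \<Rightarrow> nat \<Rightarrow> real) \<Rightarrow> (real \<Rightarrow> nat \<Rightarrow> real) \<Rightarrow> bool"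
  where
  "approx_skorohod_solution d mu lam \<beta> T \<epsilon> s r \<longleftrightarrow>
     (\<forall>k\<in>{1..d - 1}. cadlag (\<lambda>t. s t k) \<and> (\<forall>t\<ge>0. 0 \<le> s t k) \<and>
        reflection_term (\<lambda>t. s t k) (\<lambda>t. r t k) \<and>
        (\<forall>t\<in>{0..T}. \<bar>s t k - (G_functional d mu s \<beta> lam t k + r t k
            - (if 2 \<le> k then r t (k - 1) else 0))\<bar> \<le> \<epsilon>))"

lemma approx_skorohod_solutionD:
  assumes "approx_skorohod_solution d mu lam \<beta> T \<epsilon> s r" "k \<in> {1..d - 1}"
  shows "cadlag (\<lambda>t. s t k)" "\<And>t. 0 \<le> t \<Longrightarrow> 0 \<le> s t k"
    "reflection_term (\<lambda>t. s t k) (\<lambda>t. r t k)"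
    "\<And>t. 0 \<le> t \<Longrightarrow> t \<le> T \<Longrightarrow> \<bar>s t k - (G_functional d mu s \<beta> lam t k + r t k
            - (if 2 \<le> k then r t (k - 1) else 0))\<bar> \<le> \<epsilon>"
  using assms unfolding approx_skorohod_solution_def by auto

text \<open>
  The weight \<open>exp (- L t)\<close> turns the Lipschitz bound into a contraction, which replaces Gronwall's
  inequality.
\<close>

lemma approx_skorohod_stability:
  assumes mu: "0 \<le> mu" and d: "2 \<le> d"
  shows "\<exists>C\<ge>0. \<forall>\<epsilon> \<epsilon>' s r s' r'.
    approx_skorohod_solution d mu lam \<beta> T \<epsilon> s r \<longrightarrow> approx_skorohod_solution d mu lam \<beta> T \<epsilon>' s' r' \<longrightarrow>
    (\<forall>t\<in>{0..T}. \<forall>k\<in>{1..d - 1}. \<bar>s t k - s' t k\<bar> \<le> C * (\<epsilon> + \<epsilon>') \<and> \<bar>r t k - r' t k\<bar> \<le> C * (\<epsilon> + \<epsilon>'))"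
proof -
  define c where "c = mu * (2 * real d + 1) + real d * mu\<^sup>2"
  \<comment> \<open>Here \<open>c\<close> is the Lipschitz constant of G and
    \<open>2 * real d\<close> bounds the factor of the reflection chain. The value of
    \<open>L\<close> makes \<open>2 * real d * c / L\<close> at most 1/2, so the weighted supremum
    \<open>A\<close> satisfies
    \<open>A \<le> 2 * real d * (\<epsilon> + \<epsilon>') + A / 2\<close>. In \<open>C\<close> the
    first summand serves \<open>s\<close> and the second one \<open>r\<close>.\<close>
  define L where "L = 1 + 4 * real d * c"
  define C where "C = 4 * real d * exp (L * T) + real d * (1 + 4 * real d * exp (L * T))"
  have c: "0 \<le> c" using mu by (simp add: c_def)
  have L: "1 \<le> L" "2 * real d * c / L \<le> 1 / 2" "c / L \<le> 1"
  proof -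
    show "1 \<le> L" using c by (simp add: L_def)
    then show "2 * real d * c / L \<le> 1 / 2" by (simp add: divide_le_eq) (simp add: L_def)
    have "c \<le> 4 * real d * c" using mult_right_mono[of 1 "4 * real d" c] c d by simp
    then show "c / L \<le> 1" using \<open>1 \<le> L\<close> by (simp add: divide_le_eq) (simp add: L_def)
  qed
  have "\<bar>s t k - s' t k\<bar> \<le> C * (\<epsilon> + \<epsilon>') \<and> \<bar>r t k - r' t k\<bar> \<le> C * (\<epsilon> + \<epsilon>')"
    if S: "approx_skorohod_solution d mu lam \<beta> T \<epsilon> s r"
      and S': "approx_skorohod_solution d mu lam \<beta> T \<epsilon>' s' r'"
      and t: "0 \<le> t" "t \<le> T" and k: "k \<in> {1..d - 1}" for \<epsilon> \<epsilon>' s r s' r' t k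
  proof -
    define w where "w v k = exp (- (L * v)) * \<bar>s v k - s' v k\<bar>" for v k
    define W where "W = (\<lambda>(v, k). w v k) ` ({0..T} \<times> {1..d - 1})"
    define A where "A = Sup W"
    have \<epsilon>: "0 \<le> \<epsilon> + \<epsilon>'"
      using approx_skorohod_solutionD(4)[OF S k t] approx_skorohod_solutionD(4)[OF S' k t] by linarith
    have int: "(\<lambda>v. s v k) integrable_on {0..t}" "(\<lambda>v. s' v k) integrable_on {0..t}" if "k \<in> {1..d - 1}" for k t
      using approx_skorohod_solutionD(1)[OF S that] approx_skorohod_solutionD(1)[OF S' that]
      by (auto intro: integrable_on_cadlag)
    \<comment> \<open>Absorbing \<open>A / 2\<close> into the left side is legitimate because the
      supremum is finite; this is where boundedness of cadlag functions on compact intervals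
      enters.\<close>
    have bdd: "bdd_above W"
    proof -
      have "\<exists>B. \<forall>k\<in>{1..d - 1}. \<forall>v\<in>{0..T}. w v k \<le> B k"
      proof (intro bchoice ballI)
        fix k assume k: "k \<in> {1..d - 1}"
        obtain B B' where B: "\<And>v. v \<in> {0..T} \<Longrightarrow> \<bar>s v k\<bar> \<le> B" "\<And>v. v \<in> {0..T} \<Longrightarrow> \<bar>s' v k\<bar> \<le> B'"
          using cadlag_bounded[OF approx_skorohod_solutionD(1)[OF S k], of T]
            cadlag_bounded[OF approx_skorohod_solutionD(1)[OF S' k], of T] by blast
        have "w v k \<le> B + B'" if v: "v \<in> {0..T}" for v
        proof -
          have "w v k \<le> 1 * \<bar>s v k - s' v k\<bar>"
            unfolding w_def using v L by (intro mult_right_mono) auto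
          also have "\<dots> \<le> \<bar>s v k\<bar> + \<bar>s' v k\<bar>" using abs_triangle_ineq4 by simp
          finally show ?thesis using B(1)[OF v] B(2)[OF v] by linarith
        qed
        then show "\<exists>B. \<forall>v\<in>{0..T}. w v k \<le> B" by blast
      qed
      then obtain B where B: "\<And>k v. k \<in> {1..d - 1} \<Longrightarrow> v \<in> {0..T} \<Longrightarrow> w v k \<le> B k" by blast
      have "w v k \<le> (\<Sum>k\<in>{1..d - 1}. \<bar>B k\<bar>)" if "k \<in> {1..d - 1}" "v \<in> {0..T}" for v k
        using B[OF that] member_le_sum[OF that(1), of "\<lambda>k. \<bar>B k\<bar>"] by simp
      then show ?thesis unfolding W_def by (intro bdd_aboveI[of _ "\<Sum>k\<in>{1..d - 1}. \<bar>B k\<bar>"]) auto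
    qed
    have w_le: "w v k \<le> A" if "0 \<le> v" "v \<le> T" "k \<in> {1..d - 1}" for v k
      unfolding A_def using that by (intro cSup_upper bdd) (auto simp: W_def intro!: image_eqI[of _ _ "(v, k)"])
    have A0: "0 \<le> A" using w_le[OF t k] by (simp add: w_def order_trans[rotated])
    have diff_le: "\<bar>s v k - s' v k\<bar> \<le> A * exp (L * v)" if "0 \<le> v" "v \<le> T" "k \<in> {1..d - 1}" for v k
      using w_le[OF that] by (simp add: w_def exp_minus field_simps)
    define \<eta> where "\<eta> t = (\<epsilon> + \<epsilon>') + c * (A * exp (L * t) / L)" for t
    have y: "\<bar>(s u k - r u k + (if 2 \<le> k then r u (k - 1) else 0)) -
       (s' u k - r' u k + (if 2 \<le> k then r' u (k - 1) else 0))\<bar> \<le> \<eta> t"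
      if "k \<in> {1..d - 1}" "0 \<le> u" "u \<le> t" "t \<le> T" for k u t
    proof -
      have "\<bar>G_functional d mu s \<beta> lam u k - G_functional d mu s' \<beta> lam u k\<bar> \<le> c * (A * exp (L * u) / L)"
        unfolding c_def using that
        by (intro G_functional_lipschitz mu d L A0 int diff_le) auto
      also have "\<dots> \<le> c * (A * exp (L * t) / L)"
        using c A0 L that by (intro mult_left_mono divide_right_mono) auto
      finally show ?thesis
        using approx_skorohod_solutionD(4)[OF S that(1,2)] approx_skorohod_solutionD(4)[OF S' that(1,2)] that
        unfolding \<eta>_def by linarith
    qed
    have chain: "\<bar>r t k - r' t k\<bar> \<le> real d * \<eta> t" "\<bar>s t k - s' t k\<bar> \<le> 2 * real d * \<eta> t"
      if t: "0 \<le> t" "t \<le> T" and k: "k \<in> {1..d - 1}" for t k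
    proof -
      note st = reflection_chain_stability[where K="d - 1" and s=s and r=r and s'=s' and r'=r' and t=t and \<eta>="\<eta> t",
          OF approx_skorohod_solutionD(3)[OF S] approx_skorohod_solutionD(3)[OF S']
            approx_skorohod_solutionD(2)[OF S] approx_skorohod_solutionD(2)[OF S'] y k t(1) order_refl]
      have "0 \<le> \<eta> t" using \<epsilon> c A0 L by (simp add: \<eta>_def)
      then have "real k * \<eta> t \<le> real d * \<eta> t" using k by (intro mult_right_mono) auto
      then show "\<bar>r t k - r' t k\<bar> \<le> real d * \<eta> t" "\<bar>s t k - s' t k\<bar> \<le> 2 * real d * \<eta> t"
        using st t by force+
    qed
    have "w v k \<le> 2 * real d * (\<epsilon> + \<epsilon>') + A / 2" if v: "0 \<le> v" "v \<le> T" and k: "k \<in> {1..d - 1}" for v k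
    proof -
      have "w v k \<le> exp (- (L * v)) * (2 * real d * \<eta> v)"
        unfolding w_def using chain(2)[OF v k] by (intro mult_left_mono) auto
      also have "\<dots> = exp (- (L * v)) * (2 * real d * (\<epsilon> + \<epsilon>')) + 2 * real d * c / L * A"
        by (simp add: \<eta>_def exp_minus field_simps)
      also have "\<dots> \<le> 1 * (2 * real d * (\<epsilon> + \<epsilon>')) + 1 / 2 * A"
        using L v \<epsilon> A0 by (intro add_mono mult_right_mono) auto
      finally show ?thesis by simp
    qed
    then have "A \<le> 2 * real d * (\<epsilon> + \<epsilon>') + A / 2"
      unfolding A_def using t k by (intro cSup_least) (auto simp: W_def)
    then have A: "A \<le> 4 * real d * (\<epsilon> + \<epsilon>')" by simp
    have Ae: "A * exp (L * t) \<le> 4 * real d * exp (L * T) * (\<epsilon> + \<epsilon>')"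
    proof -
      have "exp (L * t) \<le> exp (L * T)" using t L by simp
      then have "A * exp (L * t) \<le> (4 * real d * (\<epsilon> + \<epsilon>')) * exp (L * T)"
        using A A0 by (intro mult_mono) auto
      then show ?thesis by (simp add: algebra_simps)
    qed
    have C_le: "4 * real d * exp (L * T) * (\<epsilon> + \<epsilon>') \<le> C * (\<epsilon> + \<epsilon>')"
        "real d * (1 + 4 * real d * exp (L * T)) * (\<epsilon> + \<epsilon>') \<le> C * (\<epsilon> + \<epsilon>')"
      unfolding C_def using \<epsilon> by (auto intro!: mult_right_mono)
    have "\<bar>s t k - s' t k\<bar> \<le> C * (\<epsilon> + \<epsilon>')" using diff_le[OF t k] Ae C_le by linarith
    moreover have "\<bar>r t k - r' t k\<bar> \<le> C * (\<epsilon> + \<epsilon>')"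
    proof -
      have "c / L * (A * exp (L * t)) \<le> 1 * (A * exp (L * t))" using L A0 by (intro mult_right_mono) auto
      then have "\<eta> t \<le> (1 + 4 * real d * exp (L * T)) * (\<epsilon> + \<epsilon>')"
        using Ae by (simp add: \<eta>_def algebra_simps)
      then have "real d * \<eta> t \<le> real d * (1 + 4 * real d * exp (L * T)) * (\<epsilon> + \<epsilon>')"
        unfolding mult.assoc by (intro mult_left_mono) (simp_all add: mult.assoc)
      then show ?thesis using chain(1)[OF t k] C_le by linarith
    qed
    ultimately show ?thesis by blast
  qed
  moreover have "0 \<le> C" by (simp add: C_def)
  ultimately show ?thesis by (intro exI[of _ C]) (auto simp: Ball_def)
qed

section \<open>Existence and uniqueness for the generalized Skorohod problem\<close>

lemma P_matrix_sum:
  assumes "k \<in> {1..K}"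
  shows "(\<Sum>j\<in>{1..K}. (of_bool (k = j) - P_matrix k j) * R j) = R k - (if 2 \<le> k then R (k - 1) else (0::real))"
proof -
  have "(\<Sum>j\<in>{1..K}. (of_bool (k = j) - P_matrix k j) * R j)
      = (\<Sum>j\<in>{1..K}. (if j = k then R j else 0) - (if j = k - 1 then if 2 \<le> k then R j else 0 else 0))"
    using assms by (intro sum.cong) (auto simp: P_matrix_def)
  also have "\<dots> = R k - (if 2 \<le> k then R (k - 1) else 0)"
    using assms by (auto simp: sum_subtractf)
  finally show ?thesis .
qed

lemma interval_measure_max:
  assumes r: "cadlag r" "mono_on {0..} r"
  shows "a \<le> b \<Longrightarrow> emeasure (interval_measure (\<lambda>t. r (max 0 t))) {a<..b} = r (max 0 b) - r (max 0 a)"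
proof (rule emeasure_interval_measure_Ioc)
  show "r (max 0 x) \<le> r (max 0 y)" if "x \<le> y" for x y
    using that by (intro mono_onD[OF r(2)]) auto
  show "continuous (at_right a) (\<lambda>t. r (max 0 t))" for a
  proof (cases "0 \<le> a")
    case True
    then have "(r \<longlongrightarrow> r a) (at_right a)" using r by (simp add: cadlag_def)
    moreover have "\<forall>\<^sub>F t in at_right a. r t = r (max 0 t)"
      using True unfolding eventually_at_filter by (intro always_eventually) auto
    ultimately have "((\<lambda>t. r (max 0 t)) \<longlongrightarrow> r a) (at_right a)" by (rule Lim_transform_eventually)
    then show ?thesis using True by (simp add: continuous_within)
  next
    case False
    then have "\<forall>\<^sub>F t in at_right a. r (max 0 t) = r 0"
      unfolding eventually_at_right_field by (intro exI[of _ 0]) auto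
    then show ?thesis using False by (simp add: continuous_within tendsto_eventually)
  qed
qed

text \<open>A vanishing integral means that the Stieltjes measure of \<open>r\<close> does not
  charge the set where \<open>x\<close> is positive. Applied to half-open intervals this makes
  \<open>r\<close> constant, and applied to single points it excludes jumps.\<close>

lemma reflection_termI_integral:
  assumes x: "cadlag x" and r: "cadlag r" "mono_on {0..} r" "r 0 = 0"
    and null: "(\<integral>\<^sup>+t\<in>{0..}. ennreal (x t) \<partial>interval_measure (\<lambda>t. r (max 0 t))) = 0"
  shows "reflection_term x r"
proof -
  let ?\<mu> = "interval_measure (\<lambda>t. r (max 0 t))"
  define N where "N = {t. 0 \<le> t \<and> 0 < x (max 0 t)}"
  note Ioc = interval_measure_max[OF r(1,2)]
  have [measurable]: "(\<lambda>t. x (max 0 t)) \<in> borel_measurable borel" by (rule borel_measurable_cadlag[OF x])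
  have N [measurable]: "N \<in> sets borel" unfolding N_def by measurable
  have "(\<integral>\<^sup>+t. ennreal (x (max 0 t)) * indicator {0..} t \<partial>?\<mu>) = (\<integral>\<^sup>+t\<in>{0..}. ennreal (x t) \<partial>?\<mu>)"
    by (intro nn_integral_cong) (auto simp: indicator_def max_def)
  then have "AE t in ?\<mu>. ennreal (x (max 0 t)) * indicator {0..} t = 0"
    unfolding null by (subst (asm) nn_integral_0_iff_AE) auto
  then have "AE t in ?\<mu>. t \<notin> N" by eventually_elim (auto simp: N_def)
  then have \<mu>N: "emeasure ?\<mu> N = 0"
    by (subst (asm) AE_iff_measurable[of N]) auto
  have sub: "emeasure ?\<mu> S = 0" if "S \<subseteq> N" for S
    using emeasure_mono[OF that, of ?\<mu>] N \<mu>N by simp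
  have mono: "r a \<le> r b" if "0 \<le> a" "a \<le> b" for a b using that by (intro mono_onD[OF r(2)]) auto
  have "r b = r a" if "0 \<le> a" "a \<le> b" "\<forall>u\<in>{a<..b}. 0 < x u" for a b
  proof -
    have "ennreal (r b - r a) = 0"
      using Ioc[OF that(2)] sub[of "{a<..b}"] that by (simp add: N_def subset_eq)
    then show ?thesis using mono[OF that(1,2)] by (simp add: ennreal_eq_0_iff)
  qed
  moreover have "(r \<longlongrightarrow> r t) (at_left t)" if t: "0 < t" "0 < x t" for t
  proof -
    obtain l where l: "(r \<longlongrightarrow> l) (at_left t)" using r(1) t(1) unfolding cadlag_def by blast
    \<comment> \<open>The intervals \<open>{u n<..t}\<close> shrink to the point \<open>t\<close>,
      so the jump \<open>r t - l\<close> of \<open>r\<close> at \<open>t\<close> is the mass of that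
      point, which is 0.\<close>
    define u where "u n = t - t * inverse (real (Suc n))" for n
    have u1: "u n < t" "0 \<le> u n" for n
      using t(1) by (auto simp: u_def field_simps)
    have u2: "u \<longlonglongrightarrow> t"
      using tendsto_diff[OF tendsto_const[of t] tendsto_mult[OF tendsto_const[of t] LIMSEQ_inverse_real_of_nat]]
      by (simp add: u_def[abs_def])
    have u3: "decseq (\<lambda>n. {u n<..t})"
    proof (rule decseq_SucI)
      fix n
      have "u n \<le> u (Suc n)" using t(1) by (simp add: u_def le_imp_inverse_le)
      then show "{u (Suc n)<..t} \<subseteq> {u n<..t}" by auto
    qed
    have u4: "(\<Inter>n. {u n<..t}) = {t}"
    proof (intro equalityI subsetI)
      fix v assume v: "v \<in> (\<Inter>n. {u n<..t})"
      then have "t \<le> v" using LIMSEQ_le_const2[OF u2, of v] by (auto intro: less_imp_le)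
      then show "v \<in> {t}" using v by auto
    qed (use u1 in auto)
    have "(\<lambda>n. emeasure ?\<mu> {u n<..t}) \<longlonglongrightarrow> emeasure ?\<mu> {t}"
      unfolding u4[symmetric] using Ioc u1 u3 by (intro Lim_emeasure_decseq) (auto simp: less_imp_le)
    moreover have "emeasure ?\<mu> {t} = 0" using t by (intro sub) (auto simp: N_def)
    moreover have "emeasure ?\<mu> {u n<..t} = ennreal (r t - r (u n))" for n
      using Ioc[of "u n" t] u1[of n] t by simp
    ultimately have "(\<lambda>n. ennreal (r t - r (u n))) \<longlonglongrightarrow> ennreal 0" by simp
    then have 1: "(\<lambda>n. r t - r (u n)) \<longlonglongrightarrow> 0"
      using u1 mono by (subst (asm) tendsto_ennreal_iff) (auto simp: less_imp_le)
    have "filterlim u (at_left t) sequentially"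
      using u1 u2 by (auto simp: filterlim_at less_imp_neq)
    then have "(\<lambda>n. r (u n)) \<longlonglongrightarrow> l" by (rule filterlim_compose[OF l])
    then have "(\<lambda>n. r t - r (u n)) \<longlonglongrightarrow> r t - l" by (intro tendsto_intros)
    then have "r t - l = 0" using 1 by (rule LIMSEQ_unique)
    then show ?thesis using l by simp
  qed
  ultimately show ?thesis using r unfolding reflection_term_def by blast
qed

lemma cadlag_continuous:
  assumes "continuous_on {0..} f"
  shows "cadlag f"
  unfolding cadlag_def
proof (intro conjI allI impI)
  fix t :: real assume t: "0 \<le> t"
  then have "(f \<longlongrightarrow> f t) (at t within {0..})" using assms by (simp add: continuous_on_def)
  then show "(f \<longlongrightarrow> f t) (at_right t)" by (rule tendsto_within_subset) (use t in auto)
next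
  fix t :: real assume t: "0 < t"
  then have "isCont f t" using continuous_on_interior[OF assms, of t] by simp
  then have "(f \<longlongrightarrow> f t) (at_left t)" unfolding isCont_def by (rule tendsto_within_subset) auto
  then show "\<exists>l. (f \<longlongrightarrow> l) (at_left t)" by blast
qed

text \<open>The set where \<open>x\<close> is positive is covered by countably many intervals on which \<open>r\<close> is constant.\<close>

lemma reflection_term_integral:
  assumes x: "continuous_on {0..} x" and r: "cadlag r" and R: "reflection_term x r"
    and pos: "\<And>t. 0 \<le> t \<Longrightarrow> 0 \<le> x t"
  shows "(\<integral>\<^sup>+t\<in>{0..}. ennreal (x t) \<partial>interval_measure (\<lambda>t. r (max 0 t))) = 0"
proof -
  let ?\<mu> = "interval_measure (\<lambda>t. r (max 0 t))"
  have mono: "mono_on {0..} r" using R by (simp add: reflection_term_def)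
  note Ioc = interval_measure_max[OF r mono]
  define I where "I = {(a, b). a \<in> \<rat> \<and> b \<in> \<rat> \<and> 0 \<le> a \<and> a \<le> b \<and> (\<forall>u\<in>{a<..b}. 0 < x u)}"
  \<comment> \<open>No interval \<open>{a<..b}\<close> with \<open>0 \<le> a\<close> contains the
    point 0. It is covered by \<open>{-1<..0}\<close>, which is null because \<open>max 0\<close>
    continues \<open>r\<close> by the constant \<open>r 0\<close>.\<close>
  define N where "N = {-1<..0} \<union> (\<Union>(a, b)\<in>I. {a<..b})"
  have "countable I"
    by (rule countable_subset[of _ "\<rat> \<times> \<rat>"]) (auto simp: I_def countable_rat)
  moreover have "{a<..b} \<in> null_sets ?\<mu>" if "(a, b) \<in> I" for a b
    using that Ioc[of a b] reflection_termD(3)[OF R, of a b] by (auto simp: I_def null_sets_def)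
  moreover have "{-1<..0} \<in> null_sets ?\<mu>" using Ioc[of "-1" 0] by (simp add: null_sets_def)
  ultimately have "N \<in> null_sets ?\<mu>"
    unfolding N_def by (intro null_sets.Un null_sets_UN') auto
  have "t \<in> N" if t: "0 \<le> t" "0 < x t" for t
  proof (cases "t = 0")
    case False
    then have "isCont x t" using continuous_on_interior[OF x, of t] t by simp
    then have "\<forall>\<^sub>F u in at t. 0 < x u" unfolding isCont_def using t(2) by (rule order_tendstoD)
    then obtain e where e: "e > 0" "\<And>u. u \<noteq> t \<Longrightarrow> dist u t < e \<Longrightarrow> 0 < x u"
      unfolding eventually_at by auto
    obtain a where a: "a \<in> \<rat>" "max 0 (t - e) < a" "a < t"
      using Rats_dense_in_real[of "max 0 (t - e)" t] False t e by auto
    obtain b where b: "b \<in> \<rat>" "t < b" "b < t + e"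
      using Rats_dense_in_real[of t "t + e"] e by auto
    have "0 < x u" if "u \<in> {a<..b}" for u
      using e(2)[of u] that a b t(2) by (cases "u = t") (auto simp: dist_real_def)
    then have "(a, b) \<in> I" using a b by (auto simp: I_def)
    then show ?thesis using a b unfolding N_def by (intro UnI2 UN_I[of "(a, b)"]) auto
  qed (simp add: N_def)
  then have "AE t in ?\<mu>. ennreal (x t) * indicator {0..} t = 0"
    by (intro AE_I'[OF \<open>N \<in> null_sets ?\<mu>\<close>] subsetI) (auto simp: indicator_def ennreal_eq_0_iff not_le split: if_splits)
  then have "(\<integral>\<^sup>+t. ennreal (x t) * indicator {0..} t \<partial>?\<mu>) = (\<integral>\<^sup>+t. 0 \<partial>?\<mu>)"
    by (rule nn_integral_cong_AE)
  then show ?thesis by simp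
qed

lemma skorohod_solution_imp_approx:
  assumes "skorohod_solution (d - 1) (\<lambda>h. G_functional d mu h \<beta> lam) P_matrix s r"
  shows "approx_skorohod_solution d mu lam \<beta> T 0 s r"
proof -
  have "reflection_term (\<lambda>t. s t k) (\<lambda>t. r t k)" if "k \<in> {1..d - 1}" for k
    using assms that unfolding skorohod_solution_def by (intro reflection_termI_integral) auto
  moreover have "s t k = G_functional d mu s \<beta> lam t k + (r t k - (if 2 \<le> k then r t (k - 1) else 0))"
    if "k \<in> {1..d - 1}" "0 \<le> t" for k t
    using assms that P_matrix_sum[OF that(1), of "r t"] unfolding skorohod_solution_def by auto
  moreover have "cadlag (\<lambda>t. s t k)" "\<forall>t\<ge>0. 0 \<le> s t k" if "k \<in> {1..d - 1}" for k
    using assms that unfolding skorohod_solution_def by blast+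
  ultimately show ?thesis unfolding approx_skorohod_solution_def by simp
qed

lemma skorohod_solution_unique:
  assumes mu: "0 \<le> mu" and d: "2 \<le> d"
    and S: "skorohod_solution (d - 1) (\<lambda>h. G_functional d mu h \<beta> lam) P_matrix s r"
    and S': "skorohod_solution (d - 1) (\<lambda>h. G_functional d mu h \<beta> lam) P_matrix s' r'"
    and t: "0 \<le> t" and k: "k \<in> {1..d - 1}"
  shows "s' t k = s t k \<and> r' t k = r t k"
proof -
  obtain C where C: "\<And>\<epsilon> \<epsilon>' s r s' r'. approx_skorohod_solution d mu lam \<beta> t \<epsilon> s r \<Longrightarrow>
      approx_skorohod_solution d mu lam \<beta> t \<epsilon>' s' r' \<Longrightarrow>
      \<forall>t\<in>{0..t}. \<forall>k\<in>{1..d - 1}. \<bar>s t k - s' t k\<bar> \<le> C * (\<epsilon> + \<epsilon>') \<and> \<bar>r t k - r' t k\<bar> \<le> C * (\<epsilon> + \<epsilon>')"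
    using approx_skorohod_stability[OF mu d, of lam \<beta> t] by blast
  have "\<bar>s t k - s' t k\<bar> \<le> C * (0 + 0) \<and> \<bar>r t k - r' t k\<bar> \<le> C * (0 + 0)"
    using C[OF skorohod_solution_imp_approx[OF S] skorohod_solution_imp_approx[OF S']] t k by auto
  then show ?thesis by simp
qed

section \<open>Limits of approximate solutions\<close>

lemma null_bound_imp_convergent:
  fixes a :: "nat \<Rightarrow> real"
  assumes le: "\<And>m n. N \<le> m \<Longrightarrow> N \<le> n \<Longrightarrow> \<bar>a m - a n\<bar> \<le> c * (e m + e n)" and e: "e \<longlonglongrightarrow> 0"
  shows "\<exists>l. a \<longlonglongrightarrow> l \<and> (\<forall>n\<ge>N. \<bar>a n - l\<bar> \<le> c * e n)"
proof -
  have "(\<lambda>n. c * e n) \<longlonglongrightarrow> 0" using tendsto_mult[OF tendsto_const[of c] e] by simp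
  have "Cauchy a"
  proof (rule metric_CauchyI)
    fix \<epsilon> :: real assume "0 < \<epsilon>"
    then have "\<forall>\<^sub>F n in sequentially. c * e n < \<epsilon> / 2"
      using order_tendstoD(2)[OF \<open>(\<lambda>n. c * e n) \<longlonglongrightarrow> 0\<close>, of "\<epsilon> / 2"] by simp
    then obtain M where M: "\<And>n. M \<le> n \<Longrightarrow> c * e n < \<epsilon> / 2" unfolding eventually_sequentially by blast
    have "dist (a m) (a n) < \<epsilon>" if "max M N \<le> m" "max M N \<le> n" for m n
      using le[of m n] M[of m] M[of n] that by (simp add: dist_real_def distrib_left)
    then show "\<exists>M. \<forall>m\<ge>M. \<forall>n\<ge>M. dist (a m) (a n) < \<epsilon>" by blast
  qed
  then obtain l where l: "a \<longlonglongrightarrow> l" using real_Cauchy_convergent convergent_def by metis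
  \<comment> \<open>Letting the second index tend to infinity preserves \<open>c\<close> and the
    threshold \<open>N\<close>. Applied at all times of a compact interval with the same constants,
    this gives uniform convergence there.\<close>
  have "\<bar>a n - l\<bar> \<le> c * e n" if n: "N \<le> n" for n
  proof (rule LIMSEQ_le)
    show "(\<lambda>m. \<bar>a n - a m\<bar>) \<longlonglongrightarrow> \<bar>a n - l\<bar>" by (intro tendsto_intros l)
    show "(\<lambda>m. c * (e n + e m)) \<longlonglongrightarrow> c * e n"
      using tendsto_mult[OF tendsto_const[of c] tendsto_add[OF tendsto_const[of "e n"] e]] by simp
    show "\<exists>M. \<forall>m\<ge>M. \<bar>a n - a m\<bar> \<le> c * (e n + e m)" using le n by blast
  qed
  then show ?thesis using l by blast
qed

lemma continuous_on_atLeastI: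
  fixes f :: "real \<Rightarrow> real"
  assumes "\<And>T. continuous_on {a..T} f"
  shows "continuous_on {a..} f"
  unfolding continuous_on_def
proof
  fix t assume "t \<in> {a..}"
  then have "(f \<longlongrightarrow> f t) (at t within {a..t + 1})" using assms[of "t + 1"] by (simp add: continuous_on_def)
  moreover have "at t within {a..} = at t within {a..t + 1}"
    by (rule at_within_nhd[of t "{..<t + 1}"]) auto
  ultimately show "(f \<longlongrightarrow> f t) (at t within {a..})" by simp
qed

lemma continuous_on_integral_atLeast:
  fixes f :: "real \<Rightarrow> real"
  assumes "\<And>t. f integrable_on {0..t}"
  shows "continuous_on {0..} (\<lambda>t. integral {0..t} f)"
  by (intro continuous_on_atLeastI indefinite_integral_continuous_1 assms)

lemma continuous_on_G_functional:
  assumes d: "2 \<le> d" and k: "k \<in> {1..d - 1}"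
    and int: "\<And>k t. k \<in> {1..d - 1} \<Longrightarrow> (\<lambda>v. h v k) integrable_on {0..t}"
  shows "continuous_on {0..} (\<lambda>t. G_functional d mu h \<beta> \<eta> t k)"
proof (cases "k = d - 1")
  case True
  then show ?thesis unfolding G_functional_def using d
    by (auto intro!: continuous_intros continuous_on_integral_atLeast integrable_diff
        integrable_const_ivl integrable_on_mult_right integrable_on_integral int)
next
  case False
  then show ?thesis unfolding G_functional_def using d k
    by (auto intro!: continuous_intros continuous_on_integral_atLeast integrable_diff
        integrable_on_mult_right int simp del: of_nat_Suc)
qed

text \<open>By stability the sequence is Cauchy uniformly on every compact interval, with horizons
  that grow beyond it. The equation passes to the limit by the Lipschitz bound for G. The Lipschitz
  bound on the \<open>r n\<close> makes \<open>R\<close>, and through the equation \<open>S\<close>,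
  continuous; with that the reflection condition passes to the limit.\<close>

lemma skorohod_solution_limit:
  assumes mu: "0 \<le> mu" and d: "2 \<le> d" and lam: "0 \<le> lam"
    and A: "\<And>n. approx_skorohod_solution d mu lam \<beta> (real n) (e n) (s n) (r n)" and e: "e \<longlonglongrightarrow> 0"
    and Lip: "\<And>n k t u. k \<in> {1..d - 1} \<Longrightarrow> 0 \<le> t \<Longrightarrow> t \<le> u \<Longrightarrow> r n u k - r n t k \<le> lam * (u - t)"
  shows "\<exists>S R. skorohod_solution (d - 1) (\<lambda>h. G_functional d mu h \<beta> lam) P_matrix S R \<and>
    (\<forall>k\<in>{1..d - 1}. continuous_on {0..} (\<lambda>t. S t k))"
proof -
  obtain C where C: "\<And>T \<epsilon> \<epsilon>' s r s' r'. approx_skorohod_solution d mu lam \<beta> T \<epsilon> s r \<Longrightarrow>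
      approx_skorohod_solution d mu lam \<beta> T \<epsilon>' s' r' \<Longrightarrow>
      \<forall>t\<in>{0..T}. \<forall>k\<in>{1..d - 1}. \<bar>s t k - s' t k\<bar> \<le> C T * (\<epsilon> + \<epsilon>') \<and> \<bar>r t k - r' t k\<bar> \<le> C T * (\<epsilon> + \<epsilon>')"
    and C0: "\<And>T. 0 \<le> C T"
    using approx_skorohod_stability[OF mu d, of lam \<beta>] by metis
  have one: "1 \<in> {1..d - 1}" using d by auto
  have e0: "0 \<le> e n" for n
    using approx_skorohod_solutionD(4)[OF A one, of 0 n] by simp
  have AT: "approx_skorohod_solution d mu lam \<beta> T (e n) (s n) (r n)" if "T \<le> real n" for T n
    using A[of n] that unfolding approx_skorohod_solution_def by auto
  define S where "S t k = lim (\<lambda>n. s n t k)" for t k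
  define R where "R t k = lim (\<lambda>n. r n t k)" for t k
  have SR: "(\<lambda>n. s n t k) \<longlonglongrightarrow> S t k" "(\<lambda>n. r n t k) \<longlonglongrightarrow> R t k"
      "T \<le> real n \<Longrightarrow> \<bar>s n t k - S t k\<bar> \<le> C T * e n"
    if t: "0 \<le> t" "t \<le> T" and k: "k \<in> {1..d - 1}" for t k T n
  proof -
    have T: "T \<le> real n" if "nat \<lceil>T\<rceil> \<le> n" for n using that by linarith
    have "\<exists>l. (\<lambda>n. s n t k) \<longlonglongrightarrow> l \<and> (\<forall>n\<ge>nat \<lceil>T\<rceil>. \<bar>s n t k - l\<bar> \<le> C T * e n)"
      using C[OF AT[OF T] AT[OF T]] t k by (intro null_bound_imp_convergent e) auto
    then obtain l where l: "(\<lambda>n. s n t k) \<longlonglongrightarrow> l" "\<And>n. nat \<lceil>T\<rceil> \<le> n \<Longrightarrow> \<bar>s n t k - l\<bar> \<le> C T * e n" by blast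
    have "S t k = l" unfolding S_def using l(1) by (rule limI)
    then show "(\<lambda>n. s n t k) \<longlonglongrightarrow> S t k" "T \<le> real n \<Longrightarrow> \<bar>s n t k - S t k\<bar> \<le> C T * e n"
      using l by (auto simp: ceiling_le_iff nat_le_iff)
    have "\<exists>l. (\<lambda>n. r n t k) \<longlonglongrightarrow> l \<and> (\<forall>n\<ge>nat \<lceil>T\<rceil>. \<bar>r n t k - l\<bar> \<le> C T * e n)"
      using C[OF AT[OF T] AT[OF T]] t k by (intro null_bound_imp_convergent e) auto
    then show "(\<lambda>n. r n t k) \<longlonglongrightarrow> R t k" unfolding R_def using limI by blast
  qed
  note S_lim = SR(1)[OF _ order_refl] and R_lim = SR(2)[OF _ order_refl]
  have small: "\<exists>n. T \<le> real n \<and> (\<forall>m\<ge>n. C T * e m < \<delta>)" if "0 < \<delta>" for T \<delta>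
  proof -
    have "(\<lambda>n. C T * e n) \<longlonglongrightarrow> 0" using tendsto_mult[OF tendsto_const[of "C T"] e] by simp
    then have "\<forall>\<^sub>F n in sequentially. C T * e n < \<delta>" using that by (rule order_tendstoD)
    then obtain M where "\<And>n. M \<le> n \<Longrightarrow> C T * e n < \<delta>" unfolding eventually_sequentially by blast
    moreover have "T \<le> real (max M (nat \<lceil>T\<rceil>))" by linarith
    ultimately show ?thesis by (intro exI[of _ "max M (nat \<lceil>T\<rceil>)"]) simp
  qed
  have s_int: "(\<lambda>v. s n v k) integrable_on {0..t}" if "k \<in> {1..d - 1}" for k t n
    by (intro integrable_on_cadlag approx_skorohod_solutionD(1)[OF A that]) simp
  \<comment> \<open>Continuity of \<open>S\<close> will come from the limit equation, which itself
    contains integrals of \<open>S\<close>. To avoid the circle, integrability is taken from uniform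
    convergence.\<close>
  have S_int: "(\<lambda>v. S v k) integrable_on {0..t}" if k: "k \<in> {1..d - 1}" for k t
    unfolding interval_cbox
  proof (rule integrable_uniform_limit)
    fix \<delta> :: real assume "0 < \<delta>"
    then obtain n where n: "t \<le> real n" "C t * e n < \<delta>" using small by blast
    have "norm (S v k - s n v k) \<le> \<delta>" if "v \<in> cbox 0 t" for v
      using SR(3)[of v t k n] k n that by auto
    then show "\<exists>g. (\<forall>v\<in>cbox 0 t. norm (S v k - g v) \<le> \<delta>) \<and> g integrable_on cbox 0 t"
      using s_int[OF k, of n t] unfolding interval_cbox by (intro exI[of _ "\<lambda>v. s n v k"] conjI ballI)
  qed
  have eq: "S t k = G_functional d mu S \<beta> lam t k + R t k - (if 2 \<le> k then R t (k - 1) else 0)"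
    if t: "0 \<le> t" and k: "k \<in> {1..d - 1}" for t k
  proof -
    define c where "c = mu * (2 * real d + 1) + real d * mu\<^sup>2"
    \<comment> \<open>The estimate is reused with \<open>L = 1\<close> and
      \<open>A = C t * e n\<close>: a uniform bound is also a bound by this constant times
      \<open>exp v\<close>.\<close>
    have "\<bar>G_functional d mu (s n) \<beta> lam t k - G_functional d mu S \<beta> lam t k\<bar> \<le> c * (C t * e n * exp (1 * t) / 1)"
      if "t \<le> real n" for n
      unfolding c_def
    proof (intro G_functional_lipschitz mu d k t s_int S_int)
      show "\<bar>s n v k - S v k\<bar> \<le> C t * e n * exp (1 * v)" if "k \<in> {1..d - 1}" "0 \<le> v" "v \<le> t" for v k
      proof -
        have "C t * e n * 1 \<le> C t * e n * exp (1 * v)" using C0 e0 that by (intro mult_left_mono) auto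
        then show ?thesis using SR(3)[OF that(2,3,1) \<open>t \<le> real n\<close>] by linarith
      qed
    qed (use C0 e0 in auto)
    moreover have "(\<lambda>n. c * (C t * e n * exp (1 * t) / 1)) \<longlonglongrightarrow> c * (C t * 0 * exp (1 * t) / 1)"
      by (intro tendsto_intros e) auto
    moreover have "\<forall>\<^sub>F n in sequentially. t \<le> real n"
      by (metis eventually_sequentiallyI nat_ceiling_le_eq)
    ultimately have "(\<lambda>n. G_functional d mu (s n) \<beta> lam t k - G_functional d mu S \<beta> lam t k) \<longlonglongrightarrow> 0"
      by - (rule Lim_null_comparison[where g="\<lambda>n. c * (C t * e n * exp (1 * t) / 1)"], auto elim: eventually_mono)
    then have G: "(\<lambda>n. G_functional d mu (s n) \<beta> lam t k) \<longlonglongrightarrow> G_functional d mu S \<beta> lam t k"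
      by (rule LIM_zero_cancel)
    have R': "(\<lambda>n. if 2 \<le> k then r n t (k - 1) else 0) \<longlonglongrightarrow> (if 2 \<le> k then R t (k - 1) else 0)"
    proof (cases "2 \<le> k")
      case True
      then have "k - 1 \<in> {1..d - 1}" using k by auto
      then show ?thesis using R_lim[OF t] True by simp
    qed simp
    have "(\<lambda>n. \<bar>s n t k - (G_functional d mu (s n) \<beta> lam t k + r n t k - (if 2 \<le> k then r n t (k - 1) else 0))\<bar>)
      \<longlonglongrightarrow> \<bar>S t k - (G_functional d mu S \<beta> lam t k + R t k - (if 2 \<le> k then R t (k - 1) else 0))\<bar>"
      by (intro tendsto_intros S_lim R_lim G R' t k)
    moreover have "\<exists>N. \<forall>n\<ge>N. \<bar>s n t k - (G_functional d mu (s n) \<beta> lam t k + r n t k - (if 2 \<le> k then r n t (k - 1) else 0))\<bar> \<le> e n"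
      using approx_skorohod_solutionD(4)[OF A k t] by (metis nat_ceiling_le_eq)
    ultimately have "\<bar>S t k - (G_functional d mu S \<beta> lam t k + R t k - (if 2 \<le> k then R t (k - 1) else 0))\<bar> \<le> 0"
      using e by (intro LIMSEQ_le)
    then show ?thesis by simp
  qed
  have S0: "0 \<le> S t k" if "0 \<le> t" "k \<in> {1..d - 1}" for t k
    using approx_skorohod_solutionD(2)[OF A that(2,1)] by (intro LIMSEQ_le_const[OF S_lim[OF that]]) auto
  have Rmono: "R t k \<le> R u k" if "0 \<le> t" "t \<le> u" "k \<in> {1..d - 1}" for t u k
    using reflection_termD(1)[OF approx_skorohod_solutionD(3)[OF A that(3)] that(1,2)] that
    by (intro LIMSEQ_le[OF R_lim R_lim]) auto
  have RLip: "R u k - R t k \<le> lam * (u - t)" if "0 \<le> t" "t \<le> u" "k \<in> {1..d - 1}" for t u k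
    using that Lip[OF that(3,1,2)]
    by (intro LIMSEQ_le_const2[OF tendsto_diff[OF R_lim R_lim]]) auto
  have Rcont: "continuous_on {0..} (\<lambda>t. R t k)" if k: "k \<in> {1..d - 1}" for k
  proof -
    have "lam-lipschitz_on {0..} (\<lambda>t. R t k)"
    proof (intro lipschitz_onI lam)
      fix t u :: real assume tu: "t \<in> {0..}" "u \<in> {0..}"
      show "dist (R t k) (R u k) \<le> lam * dist t u"
      proof (cases "t \<le> u")
        case True
        then show ?thesis using Rmono[of t u k] RLip[of t u k] tu k by (simp add: dist_real_def)
      next
        case False
        then show ?thesis using Rmono[of u t k] RLip[of u t k] tu k by (simp add: dist_real_def)
      qed
    qed
    then show ?thesis by (rule lipschitz_on_continuous_on)
  qed
  have Scont: "continuous_on {0..} (\<lambda>t. S t k)" if k: "k \<in> {1..d - 1}" for k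
  proof -
    have "continuous_on {0..} (\<lambda>t. if 2 \<le> k then R t (k - 1) else 0)"
      using k by (cases "2 \<le> k") (auto intro!: Rcont)
    then have "continuous_on {0..} (\<lambda>t. G_functional d mu S \<beta> lam t k + R t k - (if 2 \<le> k then R t (k - 1) else 0))"
      by (intro continuous_intros continuous_on_G_functional d k S_int Rcont)
    then show ?thesis by (rule continuous_on_cong[THEN iffD1, rotated 2]) (use eq k in auto)
  qed
  have refl: "reflection_term (\<lambda>t. S t k) (\<lambda>t. R t k)" if k: "k \<in> {1..d - 1}" for k
    unfolding reflection_term_def
  proof (intro conjI allI impI mono_onI)
    have "r n 0 k = 0" for n using reflection_termD(2)[OF approx_skorohod_solutionD(3)[OF A k]] .
    then show "R 0 k = 0" using R_lim[of 0 k] k LIMSEQ_unique[of "\<lambda>n. 0" "R 0 k" 0] by simp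
    show "((\<lambda>t. R t k) \<longlongrightarrow> R t k) (at_left t)" if "0 < t" for t
    proof -
      have "isCont (\<lambda>t. R t k) t" using continuous_on_interior[OF Rcont[OF k], of t] that by simp
      then show ?thesis unfolding isCont_def by (rule tendsto_within_subset) auto
    qed
    show "R b k = R a k" if ab: "0 \<le> a \<and> a \<le> b \<and> (\<forall>u\<in>{a<..b}. 0 < S u k)" for a b
    proof -
      \<comment> \<open>\<open>S\<close> may vanish at \<open>a\<close>, so it need not be bounded
        away from 0 on \<open>{a<..b}\<close>. On the compact interval \<open>{a'..b}\<close> it is,
        and uniform convergence makes \<open>s m\<close> positive there for large
        \<open>m\<close>.\<close>
      have const: "R b k = R a' k" if a': "a < a'" "a' \<le> b" for a'
      proof -
        have "continuous_on {a'..b} (\<lambda>t. S t k)"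
          by (rule continuous_on_subset[OF Scont[OF k]]) (use ab a' in auto)
        then obtain u where u: "u \<in> {a'..b}" "\<And>v. v \<in> {a'..b} \<Longrightarrow> S u k \<le> S v k"
          using continuous_attains_inf[of "{a'..b}" "\<lambda>t. S t k"] a' by auto
        have "0 < S u k" using u(1) ab a' by auto
        then obtain n where n: "b \<le> real n" "\<And>m. n \<le> m \<Longrightarrow> C b * e m < S u k" using small by blast
        have "r m b k = r m a' k" if "n \<le> m" for m
        proof (rule reflection_termD(3)[OF approx_skorohod_solutionD(3)[OF A k]])
          fix v assume v: "a' < v" "v \<le> b"
          then have "\<bar>s m v k - S v k\<bar> \<le> C b * e m"
            using ab a' n(1) that k by (intro SR(3)) auto
          then show "0 < s m v k" using n(2)[OF that] u(2)[of v] v by auto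
        qed (use ab a' in auto)
        then have "\<forall>\<^sub>F m in sequentially. r m b k = r m a' k" by (rule eventually_sequentiallyI)
        then have "(\<lambda>m. r m a' k) \<longlonglongrightarrow> R b k"
          using ab a' k by (intro Lim_transform_eventually[OF R_lim]) auto
        then show ?thesis using ab a' k by (intro LIMSEQ_unique[OF _ R_lim]) auto
      qed
      have "R b k \<le> R a k"
      proof (cases "a = b")
        case False
        show ?thesis
        proof (rule field_le_epsilon)
          fix \<epsilon> :: real assume \<epsilon>: "0 < \<epsilon>"
          \<comment> \<open>Going back from \<open>a'\<close> to \<open>a\<close> costs at most
            \<open>lam * (a' - a)\<close>, which this choice keeps below \<open>\<epsilon>\<close>;
            \<open>lam + 1\<close> is a positive denominator also for
            \<open>lam = 0\<close>.\<close>
          define a' where "a' = min b (a + \<epsilon> / (lam + 1))"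
          have a': "a < a'" "a' \<le> b" "a' - a \<le> \<epsilon> / (lam + 1)" using False ab \<epsilon> lam by (auto simp: a'_def)
          have "R b k - R a k \<le> lam * (a' - a)" using const[OF a'(1,2)] RLip[of a a' k] ab a' k by auto
          also have "\<dots> \<le> (lam + 1) * (\<epsilon> / (lam + 1))" using a' lam by (intro mult_mono) auto
          also have "\<dots> = \<epsilon>" using lam by simp
          finally show "R b k \<le> R a k + \<epsilon>" by simp
        qed
      qed simp
      then show ?thesis using Rmono[of a b k] ab k by simp
    qed
  qed (use Rmono k in auto)
  have "skorohod_solution (d - 1) (\<lambda>h. G_functional d mu h \<beta> lam) P_matrix S R"
    unfolding skorohod_solution_def
  proof (intro conjI ballI allI impI)
    fix t :: real and k assume t: "0 \<le> t" and k: "k \<in> {1..d - 1}"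
    show "S t k = G_functional d mu S \<beta> lam t k + (\<Sum>j\<in>{1..d - 1}. (of_bool (k = j) - P_matrix k j) * R t j)"
      unfolding P_matrix_sum[OF k, of "R t"] using eq[OF t k] by simp
  next
    fix k assume k: "k \<in> {1..d - 1}"
    show "(\<integral>\<^sup>+t\<in>{0..}. ennreal (S t k) \<partial>interval_measure (\<lambda>t. R (max 0 t) k)) = 0"
      using k by (intro reflection_term_integral Scont cadlag_continuous Rcont refl S0)
  qed (use refl S0 cadlag_continuous Scont Rcont in \<open>auto simp: reflection_term_def\<close>)
  then show ?thesis using Scont by blast
qed

section \<open>The scaled process\<close>

definition partial_sum :: "nat \<Rightarrow> (nat \<Rightarrow> nat) \<Rightarrow> real" where
  "partial_sum k x = (\<Sum>i\<in>{1..k}. real (x i))"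

lemma real_move:
  assumes "0 < x k" "k \<noteq> l"
  shows "real (move k l x i) = real (x i) - of_bool (i = k) + of_bool (i = l)"
  using assms by (auto simp: move_def of_nat_diff)

lemma move_in_states:
  assumes "x \<in> states d F" "0 < x k" "k \<le> d" "l \<le> d" "k \<noteq> l"
  shows "move k l x \<in> states d F"
proof -
  have "real (\<Sum>i\<le>d. move k l x i) = (\<Sum>i\<le>d. real (x i) - of_bool (i = k) + of_bool (i = l))"
    using real_move[of x k l] assms(2,5) by simp
  also have "\<dots> = real (\<Sum>i\<le>d. x i) - (\<Sum>i\<le>d. of_bool (i = k)) + (\<Sum>i\<le>d. of_bool (i = l))"
    by (simp add: sum.distrib sum_subtractf)
  also have "\<dots> = real (\<Sum>i\<le>d. x i)" using assms(3,4) by (simp add: of_bool_def)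
  finally have "(\<Sum>i\<le>d. move k l x i) = (\<Sum>i\<le>d. x i)" by linarith
  then show ?thesis using assms by (auto simp: states_def move_def)
qed

text \<open>Each transition is a point mass at its target. If its rate is nonzero, the target is
  again a state; otherwise both sides vanish, so the truncated subtraction in \<open>move\<close> is
  never visible.\<close>

lemma jump_rate_sum:
  assumes x: "x \<in> states d F" and fin: "finite (states d F)"
  shows "(\<Sum>y\<in>states d F. jump_rate d lam mu N x y * c y) =
    (\<Sum>k\<in>{1..d}. mu * real k * real (x k) * c (move k (k - 1) x)) +
    (\<Sum>k\<in>{1..d - 1}. lam * real N * of_bool (x k > 0 \<and> (\<forall>i\<in>{1..<k}. x i = 0)) * c (move k (k + 1) x))"
proof -
  have single: "(\<Sum>y\<in>states d F. C * of_bool (b \<and> y = m) * c y) = C * of_bool b * c m"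
    if "C \<noteq> 0 \<Longrightarrow> b \<Longrightarrow> m \<in> states d F" for C b m
  proof (cases "C \<noteq> 0 \<and> b")
    case True
    have "(\<Sum>y\<in>states d F. C * of_bool (b \<and> y = m) * c y) = (\<Sum>y\<in>states d F. if y = m then C * c y else 0)"
      using True by (intro sum.cong) auto
    then show ?thesis using fin that True by simp
  qed auto
  have 1: "(\<Sum>y\<in>states d F. mu * real k * real (x k) * of_bool (y = move k (k - 1) x) * c y)
      = mu * real k * real (x k) * c (move k (k - 1) x)" if k: "k \<in> {1..d}" for k
    using single[of "mu * real k * real (x k)" True "move k (k - 1) x"] k
      move_in_states[OF x, of k "k - 1"] by auto
  have 2: "(\<Sum>y\<in>states d F. lam * real N *
        of_bool (x k > 0 \<and> (\<forall>i\<in>{1..<k}. x i = 0) \<and> y = move k (k + 1) x) * c y)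
      = lam * real N * of_bool (x k > 0 \<and> (\<forall>i\<in>{1..<k}. x i = 0)) * c (move k (k + 1) x)"
    if k: "k \<in> {1..d - 1}" for k
    unfolding conj_assoc[symmetric]
    by (rule single) (use k move_in_states[OF x, of k "k + 1"] in auto)
  have "(\<Sum>y\<in>states d F. jump_rate d lam mu N x y * c y) =
    (\<Sum>y\<in>states d F. \<Sum>k\<in>{1..d}. mu * real k * real (x k) * of_bool (y = move k (k - 1) x) * c y) +
    (\<Sum>y\<in>states d F. \<Sum>k\<in>{1..d - 1}. lam * real N *
        of_bool (x k > 0 \<and> (\<forall>i\<in>{1..<k}. x i = 0) \<and> y = move k (k + 1) x) * c y)"
    by (simp only: jump_rate_def distrib_right sum_distrib_right sum.distrib)
  also have "\<dots> = (\<Sum>k\<in>{1..d}. \<Sum>y\<in>states d F. mu * real k * real (x k) * of_bool (y = move k (k - 1) x) * c y) +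
    (\<Sum>k\<in>{1..d - 1}. \<Sum>y\<in>states d F. lam * real N *
        of_bool (x k > 0 \<and> (\<forall>i\<in>{1..<k}. x i = 0) \<and> y = move k (k + 1) x) * c y)"
    by (intro arg_cong2[where f="(+)"] sum.swap)
  also have "\<dots> = (\<Sum>k\<in>{1..d}. mu * real k * real (x k) * c (move k (k - 1) x)) +
    (\<Sum>k\<in>{1..d - 1}. lam * real N * of_bool (x k > 0 \<and> (\<forall>i\<in>{1..<k}. x i = 0)) * c (move k (k + 1) x))"
    by (intro arg_cong2[where f="(+)"] sum.cong refl 1 2)
  finally show ?thesis .
qed

text \<open>Index \<open>0\<close> stands for the coordinate \<open>x 0\<close>, index \<open>j \<ge> 1\<close> for the partial sum up to \<open>j\<close>.\<close>

definition scaled :: "nat \<Rightarrow> nat \<Rightarrow> (nat \<Rightarrow> nat) \<Rightarrow> real" where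
  "scaled N j x = (if j = 0 then real (x 0) else partial_sum j x) / real N"

text \<open>A partial sum over \<open>{1..j}\<close> sees a loss when a unit crosses a border of
  that range: from \<open>j + 1\<close> down to \<open>j\<close> it gains one, from 1 down to 0 it
  loses one. Moves inside the range cancel.\<close>

lemma scaled_loss:
  assumes "0 < x k" "1 \<le> k"
  shows "scaled N j (move k (k - 1) x) - scaled N j x =
     (if j = 0 then of_bool (k = 1) else of_bool (k = j + 1) - of_bool (k = 1)) / real N"
proof -
  have "partial_sum j (move k (k - 1) x) = (\<Sum>i\<in>{1..j}. real (x i) - of_bool (i = k) + of_bool (i = k - 1))"
    unfolding partial_sum_def using assms by (intro sum.cong real_move) auto
  also have "\<dots> = partial_sum j x - of_bool (k \<in> {1..j}) + of_bool (k - 1 \<in> {1..j})"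
    by (simp add: sum.distrib sum_subtractf partial_sum_def of_bool_def)
  finally have p: "partial_sum j (move k (k - 1) x) - partial_sum j x
      = of_bool (k - 1 \<in> {1..j}) - of_bool (k \<in> {1..j})" by simp
  show ?thesis
  proof (cases "j = 0")
    case True
    then show ?thesis
      using real_move[of x k "k - 1" 0] assms by (auto simp: scaled_def diff_divide_distrib[symmetric])
  next
    case False
    have "of_bool (k - 1 \<in> {1..j}) - of_bool (k \<in> {1..j}) = (of_bool (k = j + 1) - of_bool (k = 1) :: real)"
      using assms False by (auto simp: of_bool_def)
    then show ?thesis using False p by (simp add: scaled_def diff_divide_distrib[symmetric])
  qed
qed

lemma scaled_duplication:
  assumes "0 < x k" "1 \<le> k"
  shows "scaled N j (move k (k + 1) x) - scaled N j x = (if j = 0 then 0 else - of_bool (k = j)) / real N"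
proof -
  have "partial_sum j (move k (k + 1) x) = (\<Sum>i\<in>{1..j}. real (x i) - of_bool (i = k) + of_bool (i = k + 1))"
    unfolding partial_sum_def using assms by (intro sum.cong real_move) auto
  also have "\<dots> = partial_sum j x - of_bool (k \<in> {1..j}) + of_bool (k + 1 \<in> {1..j})"
    by (simp add: sum.distrib sum_subtractf partial_sum_def of_bool_def)
  finally have p: "partial_sum j (move k (k + 1) x) - partial_sum j x
      = of_bool (k + 1 \<in> {1..j}) - of_bool (k \<in> {1..j})" by simp
  show ?thesis
  proof (cases "j = 0")
    case True
    then show ?thesis
      using real_move[of x k "k + 1" 0] assms by (auto simp: scaled_def)
  next
    case False
    have "of_bool (k + 1 \<in> {1..j}) - of_bool (k \<in> {1..j}) = (- of_bool (k = j) :: real)"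
      using assms False by (auto simp: of_bool_def)
    then show ?thesis using False p by (simp add: scaled_def diff_divide_distrib[symmetric])
  qed
qed

lemma partial_sum_eq_0_iff: "partial_sum k x = 0 \<longleftrightarrow> (\<forall>i\<in>{1..k}. x i = 0)"
  unfolding partial_sum_def by (subst sum_nonneg_eq_0_iff) auto

text \<open>Of the losses the border crossings at \<open>j + 1\<close> and 1 survive, of the
  duplications the one at level \<open>j\<close>. For the latter the jump size \<open>1 / N\<close>
  cancels the factor \<open>N\<close> of the rate, so both parts of the drift are of order
  one.\<close>

lemma generator_scaled:
  assumes x: "x \<in> states d F" and fin: "finite (states d F)" and N: "1 \<le> N" and j: "j < d"
  shows "(\<Sum>y\<in>states d F. jump_rate d lam mu N x y * (scaled N j y - scaled N j x)) =
    (if j = 0 then mu * real (x 1) / real N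
     else (mu * real (j + 1) * real (x (j + 1)) - mu * real (x 1)) / real N
       - lam * (of_bool (partial_sum (j - 1) x = 0) - of_bool (partial_sum j x = 0)))"
proof -
  let ?a = "\<lambda>k. if j = 0 then of_bool (k = 1) else of_bool (k = j + 1) - of_bool (k = 1) :: real"
  have 1: "mu * real k * real (x k) * (scaled N j (move k (k - 1) x) - scaled N j x)
      = (mu * real k * real (x k) * ?a k) / real N" if "k \<in> {1..d}" for k
    using scaled_loss[of x k N j] that by (cases "x k = 0") auto
  have 2: "lam * real N * of_bool (x k > 0 \<and> (\<forall>i\<in>{1..<k}. x i = 0)) * (scaled N j (move k (k + 1) x) - scaled N j x)
      = - lam * of_bool (x k > 0 \<and> (\<forall>i\<in>{1..<k}. x i = 0)) * of_bool (k = j)" if "k \<in> {1..d - 1}" for k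
    using scaled_duplication[of x k N j] that N by (cases "x k = 0") auto
  have L: "(\<Sum>k\<in>{1..d}. mu * real k * real (x k) * ?a k)
      = (if j = 0 then mu * real (x 1) else mu * real (j + 1) * real (x (j + 1)) - mu * real (x 1))"
  proof (cases "j = 0")
    case True
    then have "(\<Sum>k\<in>{1..d}. mu * real k * real (x k) * ?a k) = (\<Sum>k\<in>{1..d}. if k = 1 then mu * real k * real (x k) else 0)"
      by (intro sum.cong) auto
    then show ?thesis using True j by simp
  next
    case False
    then have "(\<Sum>k\<in>{1..d}. mu * real k * real (x k) * ?a k)
       = (\<Sum>k\<in>{1..d}. (if k = j + 1 then mu * real k * real (x k) else 0) - (if k = 1 then mu * real k * real (x k) else 0))"
      by (intro sum.cong) auto
    then show ?thesis using False j by (simp add: sum_subtractf)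
  qed
  have D: "(\<Sum>k\<in>{1..d - 1}. - lam * of_bool (x k > 0 \<and> (\<forall>i\<in>{1..<k}. x i = 0)) * of_bool (k = j))
      = (if j = 0 then 0 else - lam * of_bool (x j > 0 \<and> (\<forall>i\<in>{1..<j}. x i = 0)))"
  proof -
    have "(\<Sum>k\<in>{1..d - 1}. - lam * of_bool (x k > 0 \<and> (\<forall>i\<in>{1..<k}. x i = 0)) * of_bool (k = j))
      = (\<Sum>k\<in>{1..d - 1}. if k = j then - lam * of_bool (x k > 0 \<and> (\<forall>i\<in>{1..<k}. x i = 0)) else 0)"
      by (intro sum.cong) auto
    then show ?thesis using j by auto
  qed
  \<comment> \<open>The identity includes \<open>j = 1\<close>: \<open>partial_sum 0 x\<close> is an
    empty sum, its indicator is constantly 1.\<close>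
  have I: "of_bool (x j > 0 \<and> (\<forall>i\<in>{1..<j}. x i = 0)) = (of_bool (partial_sum (j - 1) x = 0) - of_bool (partial_sum j x = 0) :: real)"
    if "j \<noteq> 0"
  proof -
    have "{1..j} = insert j {1..j - 1}" "{1..<j} = {1..j - 1}" using that by auto
    then show ?thesis by (auto simp: partial_sum_eq_0_iff)
  qed
  have "(\<Sum>y\<in>states d F. jump_rate d lam mu N x y * (scaled N j y - scaled N j x))
      = (\<Sum>k\<in>{1..d}. (mu * real k * real (x k) * ?a k) / real N)
      + (\<Sum>k\<in>{1..d - 1}. - lam * of_bool (x k > 0 \<and> (\<forall>i\<in>{1..<k}. x i = 0)) * of_bool (k = j))"
    unfolding jump_rate_sum[OF x fin] by (intro arg_cong2[where f="(+)"] sum.cong refl 1 2)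
  also have "\<dots> = (if j = 0 then mu * real (x 1) else mu * real (j + 1) * real (x (j + 1)) - mu * real (x 1)) / real N
      + (if j = 0 then 0 else - lam * of_bool (x j > 0 \<and> (\<forall>i\<in>{1..<j}. x i = 0)))"
    unfolding L[symmetric] D[symmetric] by (simp only: sum_divide_distrib)
  finally show ?thesis using I by (cases "j = 0") (simp_all only: if_True if_False, simp_all)
qed

text \<open>A jump changes \<open>scaled N j\<close> by at most \<open>1 / N\<close>. The total loss
  rate is at most \<open>mu * real d * real F\<close>, and each level contributes a duplication rate
  of at most \<open>lam * real N\<close>. With \<open>F\<close> of order \<open>N\<close> the bound
  is of order \<open>1 / N\<close>.\<close>

lemma carre_du_champ_scaled:
  assumes x: "x \<in> states d F" and fin: "finite (states d F)" and N: "1 \<le> N"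
    and lam: "0 \<le> lam" and mu: "0 \<le> mu"
  shows "(\<Sum>y\<in>states d F. jump_rate d lam mu N x y * (scaled N j y - scaled N j x)\<^sup>2)
    \<le> (mu * real d * real F + lam * real N * real d) / (real N)\<^sup>2"
proof -
  have sq: "(scaled N j (move k (k - 1) x) - scaled N j x)\<^sup>2 \<le> 1 / (real N)\<^sup>2" if "0 < x k" "1 \<le> k" for k
    unfolding scaled_loss[of x, OF that] power_divide
    by (intro divide_right_mono) (auto simp: of_bool_def)
  have sq': "(scaled N j (move k (k + 1) x) - scaled N j x)\<^sup>2 \<le> 1 / (real N)\<^sup>2" if "0 < x k" "1 \<le> k" for k
    unfolding scaled_duplication[of x, OF that] power_divide
    by (intro divide_right_mono) (auto simp: of_bool_def)
  have 1: "mu * real k * real (x k) * (scaled N j (move k (k - 1) x) - scaled N j x)\<^sup>2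
      \<le> mu * real d * real (x k) * (1 / (real N)\<^sup>2)" if "k \<in> {1..d}" for k
  proof (cases "x k = 0")
    case False
    have "mu * real k * real (x k) \<le> mu * real d * real (x k)"
      using that mu by (intro mult_right_mono mult_left_mono) auto
    then show ?thesis using sq[of k] that mu False by (intro mult_mono) auto
  qed simp
  have 2: "lam * real N * of_bool (x k > 0 \<and> (\<forall>i\<in>{1..<k}. x i = 0)) * (scaled N j (move k (k + 1) x) - scaled N j x)\<^sup>2
      \<le> lam * real N * (1 / (real N)\<^sup>2)" if "k \<in> {1..d - 1}" for k
    using mult_left_mono[OF sq'[of k], of "lam * real N"] that lam
    by (cases "x k > 0 \<and> (\<forall>i\<in>{1..<k}. x i = 0)") auto
  have "(\<Sum>k\<in>{1..d}. mu * real d * real (x k) * (1 / (real N)\<^sup>2))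
      = mu * real d * (\<Sum>k\<in>{1..d}. real (x k)) / (real N)\<^sup>2"
    by (simp add: sum_distrib_left sum_divide_distrib)
  also have "\<dots> \<le> mu * real d * real F / (real N)\<^sup>2"
  proof -
    have "(\<Sum>k\<in>{1..d}. x k) \<le> (\<Sum>k\<le>d. x k)" by (intro sum_mono2) auto
    then have "(\<Sum>k\<in>{1..d}. real (x k)) \<le> real F" using x by (simp add: states_def flip: of_nat_sum)
    then show ?thesis using mu by (intro divide_right_mono mult_left_mono) auto
  qed
  finally have "(\<Sum>k\<in>{1..d}. mu * real d * real (x k) * (1 / (real N)\<^sup>2)) \<le> mu * real d * real F / (real N)\<^sup>2" .
  moreover have "(\<Sum>k\<in>{1..d - 1}. lam * real N * (1 / (real N)\<^sup>2)) \<le> lam * real N * real d / (real N)\<^sup>2"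
  proof -
    have "lam * real N * real (d - 1) \<le> lam * real N * real d" using lam by (intro mult_left_mono) auto
    then show ?thesis by (simp add: divide_right_mono mult.commute)
  qed
  ultimately show ?thesis
    unfolding jump_rate_sum[OF x fin] add_divide_distrib
    by (intro add_mono) (rule order_trans[OF sum_mono], rule 1 2, assumption, assumption)+
qed

text \<open>\<open>scaled_path\<close> and \<open>scaled_reflection\<close> are the pre-limit versions of \<open>S\<close> and \<open>R\<close>.\<close>

definition scaled_path :: "nat \<Rightarrow> (real \<Rightarrow> nat \<Rightarrow> nat) \<Rightarrow> real \<Rightarrow> nat \<Rightarrow> real" where
  "scaled_path N Y t k = scaled N k (Y t)"

definition scaled_reflection :: "real \<Rightarrow> (real \<Rightarrow> nat \<Rightarrow> nat) \<Rightarrow> real \<Rightarrow> nat \<Rightarrow> real" where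
  "scaled_reflection lam Y t k = lam * integral {0..t} (\<lambda>u. of_bool (partial_sum k (Y u) = 0))"

section \<open>Deterministic analysis of a single path\<close>

locale path_in_states =
  fixes d F :: nat and Y :: "real \<Rightarrow> nat \<Rightarrow> nat" and lam :: real
  assumes Y: "0 \<le> t \<Longrightarrow> Y t \<in> states d F"
    and cadlag_Y: "cadlag (\<lambda>t. \<phi> (Y t))"
    and lam: "0 \<le> lam"
begin

lemma path_integrable: "(\<lambda>t. \<phi> (Y t)) integrable_on {0..t}" for \<phi> :: "(nat \<Rightarrow> nat) \<Rightarrow> real"
  by (intro integrable_on_cadlag cadlag_Y) simp

lemma scaled_reflection_diff:
  assumes "0 \<le> a" "a \<le> b"
  shows "scaled_reflection lam Y b k - scaled_reflection lam Y a k
    = lam * integral {a..b} (\<lambda>u. of_bool (partial_sum k (Y u) = 0))"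
  using Henstock_Kurzweil_Integration.integral_combine[OF assms path_integrable, of "\<lambda>x. of_bool (partial_sum k x = 0)"]
  by (simp add: scaled_reflection_def flip: right_diff_distrib)

lemma path_integrable_from: "0 \<le> a \<Longrightarrow> (\<lambda>t. \<phi> (Y t)) integrable_on {a..b}" for \<phi> :: "(nat \<Rightarrow> nat) \<Rightarrow> real"
  by (intro integrable_on_cadlag cadlag_Y)

lemma scaled_reflection_bounds:
  assumes "0 \<le> a" "a \<le> b"
  shows "0 \<le> scaled_reflection lam Y b k - scaled_reflection lam Y a k"
    "scaled_reflection lam Y b k - scaled_reflection lam Y a k \<le> lam * (b - a)"
proof -
  have "0 \<le> integral {a..b} (\<lambda>u. of_bool (partial_sum k (Y u) = 0) :: real)"
    by (intro integral_nonneg path_integrable_from[of a "\<lambda>x. of_bool (partial_sum k x = 0)"] assms) auto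
  moreover have "integral {a..b} (\<lambda>u. of_bool (partial_sum k (Y u) = 0)) \<le> integral {a..b} (\<lambda>u. 1::real)"
    by (intro integral_le path_integrable_from[of a "\<lambda>x. of_bool (partial_sum k x = 0)"] assms integrable_const_ivl) auto
  ultimately show "0 \<le> scaled_reflection lam Y b k - scaled_reflection lam Y a k"
    "scaled_reflection lam Y b k - scaled_reflection lam Y a k \<le> lam * (b - a)"
    unfolding scaled_reflection_diff[OF assms] using lam assms(2) by (auto intro!: mult_nonneg_nonneg mult_left_mono)
qed

lemma reflection_term_scaled:
  assumes N: "1 \<le> N" and k: "1 \<le> k"
  shows "reflection_term (\<lambda>t. scaled_path N Y t k) (\<lambda>t. scaled_reflection lam Y t k)"
  unfolding reflection_term_def
proof (intro conjI allI impI mono_onI)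
  show "scaled_reflection lam Y a k \<le> scaled_reflection lam Y b k" if "a \<in> {0..}" "a \<le> b" for a b
    using scaled_reflection_bounds(1)[of a b k] that by simp
  show "scaled_reflection lam Y 0 k = 0" by (simp add: scaled_reflection_def)
  show "scaled_reflection lam Y b k = scaled_reflection lam Y a k"
    if ab: "0 \<le> a \<and> a \<le> b \<and> (\<forall>u\<in>{a<..b}. 0 < scaled_path N Y u k)" for a b
  proof -
    \<comment> \<open>Positivity is known on the half-open interval; the left end point is a null
      set for the time integral.\<close>
    have "integral {a..b} (\<lambda>u. of_bool (partial_sum k (Y u) = 0) :: real) = integral {a..b} (\<lambda>u. 0)"
    proof (rule integral_spike[of "{a}"])
      show "0 = (of_bool (partial_sum k (Y u) = 0) :: real)" if "u \<in> {a..b} - {a}" for u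
        using ab that k by (force simp: scaled_path_def scaled_def)
    qed simp
    then show ?thesis using scaled_reflection_diff[of a b k] ab by simp
  qed
  show "((\<lambda>t. scaled_reflection lam Y t k) \<longlongrightarrow> scaled_reflection lam Y t k) (at_left t)" if "0 < t" for t
  proof -
    have "continuous_on {0..} (\<lambda>t. scaled_reflection lam Y t k)"
      unfolding scaled_reflection_def
      by (intro continuous_intros continuous_on_integral_atLeast path_integrable[of "\<lambda>x. of_bool (partial_sum k x = 0)"])
    then have "isCont (\<lambda>t. scaled_reflection lam Y t k) t"
      using continuous_on_interior[of "{0..}" "\<lambda>t. scaled_reflection lam Y t k" t] that by simp
    then show ?thesis unfolding isCont_def by (rule tendsto_within_subset) auto
  qed
qed

text \<open>For \<open>k < d - 1\<close> the occupation of level \<open>k + 1\<close> is a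
  difference of consecutive partial sums, and \<open>dynkin\<close> is the Skorohod equation with
  error \<open>\<epsilon>\<close>. For \<open>k = d - 1\<close> the occupation of level
  \<open>d\<close> is rewritten by conservation of mass, with error \<open>\<epsilon>\<close> for
  \<open>real F / real N\<close> and another \<open>\<epsilon>\<close> for the occupation of level
  0, which \<open>dynkin\<close> with \<open>j = 0\<close> replaces by an integral. Integrated up to
  \<open>T\<close> with the coefficient \<open>real d * mu\<close> this gives the second summand of
  the error.\<close>

lemma approx_skorohod_scaled:
  assumes d: "2 \<le> d" and N: "1 \<le> N" and mu: "0 \<le> mu" and T: "0 \<le> T"
    and Y0: "Y 0 = (\<lambda>i. if i = d then F else 0)"
    and dynkin: "\<And>j t. j < d \<Longrightarrow> 0 \<le> t \<Longrightarrow> t \<le> T \<Longrightarrow>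
      \<bar>scaled N j (Y t) - scaled N j (Y 0)
        - integral {0..t} (\<lambda>u. if j = 0 then mu * real (Y u 1) / real N
            else (mu * real (j + 1) * real (Y u (j + 1)) - mu * real (Y u 1)) / real N
              - lam * (of_bool (partial_sum (j - 1) (Y u) = 0) - of_bool (partial_sum j (Y u) = 0)))\<bar> \<le> \<epsilon>"
    and F: "\<bar>real F / real N - \<beta>\<bar> \<le> \<epsilon>"
  shows "approx_skorohod_solution d mu lam \<beta> T (\<epsilon> + real d * mu * T * (2 * \<epsilon>)) (scaled_path N Y) (scaled_reflection lam Y)"
    and "\<And>t. 0 \<le> t \<Longrightarrow> t \<le> T \<Longrightarrow> \<bar>real (Y t 0) / real N - mu * integral {0..t} (\<lambda>u. scaled_path N Y u 1)\<bar> \<le> \<epsilon>"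
proof -
  define s where "s = scaled_path N Y"
  define r where "r = scaled_reflection lam Y"
  have \<epsilon>: "0 \<le> \<epsilon>" using F by linarith
  have s_int: "(\<lambda>u. s u k) integrable_on {0..t}" for k t
    unfolding s_def scaled_path_def by (rule path_integrable)
  have s1: "s u 1 = real (Y u 1) / real N" for u
    by (simp add: s_def scaled_path_def scaled_def partial_sum_def)
  have init: "scaled N j (Y 0) = 0" if "j < d" for j
    using that d by (auto simp: scaled_def partial_sum_def Y0)
  have s_diff: "real (Y u (j + 1)) / real N = s u (j + 1) - s u j" if "1 \<le> j" for u j
  proof -
    have "partial_sum (j + 1) (Y u) = partial_sum j (Y u) + real (Y u (j + 1))"
      by (simp add: partial_sum_def)
    then show ?thesis using that by (simp add: s_def scaled_path_def scaled_def add_divide_distrib)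
  qed
  have zero: "\<bar>real (Y t 0) / real N - mu * integral {0..t} (\<lambda>u. s u 1)\<bar> \<le> \<epsilon>" if "0 \<le> t" "t \<le> T" for t
  proof -
    have "integral {0..t} (\<lambda>u. mu * real (Y u 1) / real N) = mu * integral {0..t} (\<lambda>u. s u 1)"
      by (simp only: s1 times_divide_eq_right[symmetric] integral_mult_right)
    then show ?thesis using dynkin[OF _ that, of 0] d init[of 0] by (simp add: scaled_def[of N 0 "Y t"])
  qed
  then show "\<And>t. 0 \<le> t \<Longrightarrow> t \<le> T \<Longrightarrow> \<bar>real (Y t 0) / real N - mu * integral {0..t} (\<lambda>u. scaled_path N Y u 1)\<bar> \<le> \<epsilon>"
    by (simp add: s_def)
  have last: "real (Y u d) / real N = real F / real N - s u (d - 1) - real (Y u 0) / real N" if "0 \<le> u" for u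
  proof -
    have "{..d} = insert 0 {1..d}" by auto
    then have "(\<Sum>i\<le>d. Y u i) = Y u 0 + (\<Sum>i\<in>{1..d}. Y u i)" by simp
    moreover have "(\<Sum>i\<le>d. Y u i) = F" using Y[OF that] by (simp add: states_def)
    ultimately have "real F = real (Y u 0) + partial_sum d (Y u)"
      by (simp add: partial_sum_def flip: of_nat_sum)
    moreover have "partial_sum d (Y u) = partial_sum (d - 1) (Y u) + real (Y u d)"
      using d by (cases d) (simp_all add: partial_sum_def)
    ultimately show ?thesis
      using d by (simp add: s_def scaled_path_def scaled_def add_divide_distrib)
  qed
  have main: "\<bar>s t k - (G_functional d mu s \<beta> lam t k + r t k - (if 2 \<le> k then r t (k - 1) else 0))\<bar>
      \<le> \<epsilon> + real d * mu * T * (2 * \<epsilon>)"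
    if k: "k \<in> {1..d - 1}" and t: "0 \<le> t" "t \<le> T" for k t
  proof -
    define g where "g u = real (k + 1) * (real (Y u (k + 1)) / real N) - s u 1" for u
    have kd: "k < d" "k \<noteq> 0" using k by auto
    have g_int: "g integrable_on {0..t}"
      unfolding g_def s_def scaled_path_def
      by (intro path_integrable[of "\<lambda>x. real (k + 1) * (real (x (k + 1)) / real N) - scaled N 1 x"])
    have b_int: "(\<lambda>u. of_bool (partial_sum j (Y u) = 0) :: real) integrable_on {0..t}" for j
      by (rule path_integrable)
    have "integral {0..t} (\<lambda>u. (mu * real (k + 1) * real (Y u (k + 1)) - mu * real (Y u 1)) / real N
              - lam * (of_bool (partial_sum (k - 1) (Y u) = 0) - of_bool (partial_sum k (Y u) = 0)))
        = integral {0..t} (\<lambda>u. mu * g u - lam * (of_bool (partial_sum (k - 1) (Y u) = 0) - of_bool (partial_sum k (Y u) = 0)))"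
      by (intro integral_cong) (simp add: g_def s1[unfolded One_nat_def] diff_divide_distrib right_diff_distrib mult.assoc)
    also have "\<dots> = mu * integral {0..t} g - (r t (k - 1) - r t k)"
      unfolding r_def scaled_reflection_def right_diff_distrib[symmetric]
      by (intro integral_unique has_integral_diff has_integral_mult_right integrable_integral g_int b_int)
    finally have 1: "\<bar>s t k - (mu * integral {0..t} g - (r t (k - 1) - r t k))\<bar> \<le> \<epsilon>"
      using dynkin[OF kd(1) t] init[OF kd(1)] kd(2) by (simp add: s_def scaled_path_def)
    \<comment> \<open>For \<open>k = 1\<close> the term \<open>r t 0\<close> is
      \<open>lam * t\<close>, since the empty partial sum always vanishes. In the Skorohod problem
      this is part of G and not of the reflection.\<close>
    have r0: "r t (k - 1) = (if 2 \<le> k then r t (k - 1) else 0) + lam * t * of_bool (k = 1)"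
      using k t by (cases "k = 1") (auto simp: r_def scaled_reflection_def partial_sum_def)
    have 2: "\<bar>mu * integral {0..t} g - lam * t * of_bool (k = 1) - G_functional d mu s \<beta> lam t k\<bar> \<le> real d * mu * T * (2 * \<epsilon>)"
    proof (cases "k = d - 1")
      case False
      have "g = (\<lambda>u. real (k + 1) * s u (k + 1) - real (k + 1) * s u k - s u 1)"
        unfolding g_def[abs_def] using k by (subst s_diff) (auto simp: right_diff_distrib simp del: of_nat_add)
      then have "G_functional d mu s \<beta> lam t k = mu * integral {0..t} g - lam * t * of_bool (k = 1)"
        using False by (simp add: G_functional_def)
      then show ?thesis using mu T \<epsilon> by simp
    next
      case True
      define f where "f u = \<beta> - s u (d - 1) - mu * integral {0..u} (\<lambda>v. s v 1)" for u
      define y where "y u = real (Y u d) / real N" for u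
      have kd: "k + 1 = d" using True d by simp
      have f_int: "f integrable_on {0..t}"
        unfolding f_def by (intro integrable_diff integrable_const_ivl integrable_on_mult_right integrable_on_integral s_int)
      have y_int: "y integrable_on {0..t}"
        unfolding y_def by (intro path_integrable[of "\<lambda>x. real (x d) / real N"])
      have "\<bar>y u - f u\<bar> \<le> 2 * \<epsilon>" if u: "u \<in> {0..t}" for u
        using last[of u] zero[of u] F u t unfolding y_def f_def by auto
      then have "norm (integral {0..t} (\<lambda>u. y u - f u)) \<le> integral {0..t} (\<lambda>u. 2 * \<epsilon>)"
        by (intro integral_norm_bound_integral integrable_diff f_int y_int) auto
      then have "\<bar>integral {0..t} y - integral {0..t} f\<bar> \<le> t * (2 * \<epsilon>)"
        using t by (simp add: Henstock_Kurzweil_Integration.integral_diff f_int y_int)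
      also have "\<dots> \<le> T * (2 * \<epsilon>)" using t \<epsilon> by (intro mult_right_mono) auto
      finally have "real d * mu * \<bar>integral {0..t} y - integral {0..t} f\<bar> \<le> real d * mu * (T * (2 * \<epsilon>))"
        using mu by (intro mult_left_mono) auto
      moreover have g: "integral {0..t} g = real d * integral {0..t} y - integral {0..t} (\<lambda>u. s u 1)"
        unfolding g_def kd y_def[symmetric]
        by (intro integral_unique has_integral_diff has_integral_mult_right integrable_integral y_int s_int)
      moreover have G: "G_functional d mu s \<beta> lam t k = real d * mu * integral {0..t} f
          - mu * integral {0..t} (\<lambda>u. s u 1) - lam * t * of_bool (k = 1)"
        using True d by (auto simp: G_functional_def f_def[abs_def])
      moreover have "mu * integral {0..t} g - lam * t * of_bool (k = 1) - G_functional d mu s \<beta> lam t k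
          = real d * mu * (integral {0..t} y - integral {0..t} f)"
        unfolding g G by (simp add: right_diff_distrib)
      ultimately show ?thesis using mu by (simp add: abs_mult)
    qed
    show ?thesis using 1 2 r0 by linarith
  qed
  have "cadlag (\<lambda>t. s t k)" for k unfolding s_def scaled_path_def by (rule cadlag_Y)
  moreover have "0 \<le> s t k" for t k
    by (simp add: s_def scaled_path_def scaled_def partial_sum_def sum_nonneg)
  ultimately show "approx_skorohod_solution d mu lam \<beta> T (\<epsilon> + real d * mu * T * (2 * \<epsilon>)) (scaled_path N Y) (scaled_reflection lam Y)"
    unfolding approx_skorohod_solution_def s_def[symmetric] r_def[symmetric]
    using main reflection_term_scaled[OF N] by (auto simp: s_def r_def)
qed

end

section \<open>Convergence to the fluid limit\<close>

text \<open>What a good path must satisfy for all \<open>d + 1\<close> coordinates to be recovered: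
  the partial sums give the levels 1 to \<open>d - 1\<close>, the bound on level 0 gives the
  coordinate 0, and the bound on the total mass then gives level \<open>d\<close>.\<close>

definition near_fluid_path ::
    "nat \<Rightarrow> real \<Rightarrow> real \<Rightarrow> real \<Rightarrow> real \<Rightarrow> real \<Rightarrow> nat \<Rightarrow> nat \<Rightarrow> (real \<Rightarrow> nat \<Rightarrow> nat) \<Rightarrow> bool" where
  "near_fluid_path d mu lam \<beta> T \<epsilon> N F Y \<longleftrightarrow> path_in_states d F Y lam \<and>
     approx_skorohod_solution d mu lam \<beta> T \<epsilon> (scaled_path N Y) (scaled_reflection lam Y) \<and>
     (\<forall>t\<in>{0..T}. \<bar>real (Y t 0) / real N - mu * integral {0..t} (\<lambda>u. scaled_path N Y u 1)\<bar> \<le> \<epsilon>) \<and>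
     \<bar>real F / real N - \<beta>\<bar> \<le> \<epsilon>"

lemma scaled_process_approx:
  fixes M :: "nat \<Rightarrow> 'w measure" and X :: "nat \<Rightarrow> real \<Rightarrow> 'w \<Rightarrow> nat \<Rightarrow> nat" and F :: "nat \<Rightarrow> nat"
  assumes lam: "0 < lam" and mu: "0 < mu" and d: "2 \<le> d"
    and F: "(\<lambda>N. real (F N) / real N) \<longlonglongrightarrow> \<beta>"
    and mjp: "\<And>N. N \<ge> 1 \<Longrightarrow> markov_jump_process (M N) (states d (F N)) (jump_rate d lam mu N) (X N)"
    and init: "\<And>N. N \<ge> 1 \<Longrightarrow> AE \<omega> in M N. X N 0 \<omega> = (\<lambda>i. if i = d then F N else 0)"
    and T: "0 < T" and \<epsilon>: "0 < \<epsilon>" and \<delta>: "0 < \<delta>"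
  shows "\<forall>\<^sub>F N in sequentially. \<exists>A\<in>sets (M N). measure (M N) A \<le> \<delta> \<and>
     (\<forall>\<omega>\<in>space (M N) - A. near_fluid_path d mu lam \<beta> T \<epsilon> N (F N) (\<lambda>t. X N t \<omega>))"
proof -
  \<comment> \<open>Chosen so that the error
    \<open>\<epsilon>0 + real d * mu * T * (2 * \<epsilon>0)\<close> of
    \<open>approx_skorohod_scaled\<close> is exactly \<open>\<epsilon>\<close>.\<close>
  define c where "c = 1 + 2 * (real d * mu * T)"
  define \<epsilon>0 where "\<epsilon>0 = \<epsilon> / c"
  have c: "1 \<le> c" using mu T by (simp add: c_def)
  have \<epsilon>0: "0 < \<epsilon>0" "\<epsilon>0 \<le> \<epsilon>" "\<epsilon>0 + real d * mu * T * (2 * \<epsilon>0) = \<epsilon>"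
  proof -
    show "0 < \<epsilon>0" using c \<epsilon> by (simp add: \<epsilon>0_def)
    show "\<epsilon>0 \<le> \<epsilon>" using c \<epsilon> divide_left_mono[of 1 c \<epsilon>] by (simp add: \<epsilon>0_def)
    have "\<epsilon>0 + real d * mu * T * (2 * \<epsilon>0) = c * \<epsilon>0" by (simp add: c_def algebra_simps)
    also have "\<dots> = \<epsilon>" using c by (simp add: \<epsilon>0_def)
    finally show "\<epsilon>0 + real d * mu * T * (2 * \<epsilon>0) = \<epsilon>" .
  qed
  \<comment> \<open>The summand 1 turns the carre du champ bound into the strict inequality that
    \<open>dynkin_maximal_inequality\<close> asks for; \<open>V N\<close> still tends to 0.\<close>
  define V where "V N = (mu * real d * real (F N) + lam * real N * real d + 1) / (real N)\<^sup>2" for N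
  have "(\<lambda>N. (mu * real d * (real (F N) / real N) + lam * real d + 1 / real N) * (1 / real N)) \<longlonglongrightarrow>
      (mu * real d * \<beta> + lam * real d + 0) * 0"
    by (intro tendsto_intros F lim_1_over_n)
  moreover have "\<forall>\<^sub>F N in sequentially.
      (mu * real d * (real (F N) / real N) + lam * real d + 1 / real N) * (1 / real N) = V N"
    using eventually_ge_at_top[of 1]
    by eventually_elim (simp add: V_def power2_eq_square field_simps)
  ultimately have "V \<longlonglongrightarrow> 0" by (auto intro: Lim_transform_eventually)
  then have "(\<lambda>N. real d * (T * V N / \<epsilon>0\<^sup>2)) \<longlonglongrightarrow> real d * (T * 0 / \<epsilon>0\<^sup>2)"
    using \<epsilon>0(1) by (intro tendsto_intros) auto
  then have "\<forall>\<^sub>F N in sequentially. real d * (T * V N / \<epsilon>0\<^sup>2) < \<delta>"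
    using \<delta> by (intro order_tendstoD(2)) auto
  moreover have "\<forall>\<^sub>F N in sequentially. dist (real (F N) / real N) \<beta> < \<epsilon>0" using F \<epsilon>0(1) by (rule tendstoD)
  moreover have "\<forall>\<^sub>F N in sequentially. 1 \<le> N" by (rule eventually_ge_at_top)
  ultimately show ?thesis
  proof eventually_elim
    case (elim N)
    obtain p where "finite_markov_process (M N) (states d (F N)) (jump_rate d lam mu N) (X N) p"
      using markov_jump_processE[OF mjp[OF elim(3)]] by blast
    then interpret finite_markov_process "M N" "states d (F N)" "jump_rate d lam mu N" "X N" p .
    have "\<exists>A. \<forall>j. A j \<in> sets (M N) \<and> prob (A j) \<le> T * V N / \<epsilon>0\<^sup>2 \<and> (\<forall>\<omega>\<in>space (M N) - A j. \<forall>t\<in>{0..T}.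
       \<bar>scaled N j (X N t \<omega>) - scaled N j (X N 0 \<omega>) - integral {0..t} (\<lambda>u. \<Sum>y\<in>states d (F N).
          jump_rate d lam mu N (X N u \<omega>) y * (scaled N j y - scaled N j (X N u \<omega>)))\<bar> \<le> \<epsilon>0)"
    proof (intro choice allI)
      fix j
      have "(\<Sum>y\<in>states d (F N). jump_rate d lam mu N x y * (scaled N j y - scaled N j x)\<^sup>2) < V N"
        if "x \<in> states d (F N)" for x
      proof -
        have "(mu * real d * real (F N) + lam * real N * real d) / (real N)\<^sup>2 < V N"
          unfolding V_def using elim(3) by (intro divide_strict_right_mono) auto
        then show ?thesis
          using carre_du_champ_scaled[OF that finite_E elim(3) less_imp_le[OF lam] less_imp_le[OF mu], of j] by linarith
      qed
      from dynkin_maximal_inequality[OF T \<epsilon>0(1) this]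
      show "\<exists>A. A \<in> sets (M N) \<and> prob A \<le> T * V N / \<epsilon>0\<^sup>2 \<and> (\<forall>\<omega>\<in>space (M N) - A. \<forall>t\<in>{0..T}.
         \<bar>scaled N j (X N t \<omega>) - scaled N j (X N 0 \<omega>) - integral {0..t} (\<lambda>u. \<Sum>y\<in>states d (F N).
            jump_rate d lam mu N (X N u \<omega>) y * (scaled N j y - scaled N j (X N u \<omega>)))\<bar> \<le> \<epsilon>0)"
        by blast
    qed
    then obtain A where A: "\<And>j. A j \<in> sets (M N)" "\<And>j. prob (A j) \<le> T * V N / \<epsilon>0\<^sup>2"
      "\<And>j \<omega> t. \<omega> \<in> space (M N) - A j \<Longrightarrow> t \<in> {0..T} \<Longrightarrow>
       \<bar>scaled N j (X N t \<omega>) - scaled N j (X N 0 \<omega>) - integral {0..t} (\<lambda>u. \<Sum>y\<in>states d (F N).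
          jump_rate d lam mu N (X N u \<omega>) y * (scaled N j y - scaled N j (X N u \<omega>)))\<bar> \<le> \<epsilon>0"
      by blast
    obtain Z where Z: "{\<omega> \<in> space (M N). X N 0 \<omega> \<noteq> (\<lambda>i. if i = d then F N else 0)} \<subseteq> Z"
      "emeasure (M N) Z = 0" "Z \<in> sets (M N)"
      using AE_E[OF init[OF elim(3)]] by blast
    \<comment> \<open>The null set \<open>Z\<close> is added because the initial state is prescribed
      almost surely, while the argument on good paths needs it exactly.\<close>
    define B where "B = Z \<union> (\<Union>j<d. A j)"
    have B: "B \<in> sets (M N)" unfolding B_def using A(1) Z(3) by auto
    have "prob B \<le> prob Z + prob (\<Union>j<d. A j)"
      unfolding B_def using A(1) Z(3) by (intro measure_Un_le) auto
    also have "prob (\<Union>j<d. A j) \<le> (\<Sum>j<d. prob (A j))"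
      using A(1) by (intro measure_UNION_le) auto
    also have "\<dots> \<le> (\<Sum>j<d. T * V N / \<epsilon>0\<^sup>2)" by (intro sum_mono A(2))
    finally have "prob B \<le> \<delta>" using elim(1) Z(2) by (simp add: measure_def)
    moreover have "near_fluid_path d mu lam \<beta> T \<epsilon> N (F N) (\<lambda>t. X N t \<omega>)"
      if \<omega>: "\<omega> \<in> space (M N) - B" for \<omega>
    proof -
      interpret path_in_states d "F N" "\<lambda>t. X N t \<omega>" lam
        using \<omega> lam by unfold_locales (auto intro: X_in_E cadlag_path)
      have *: "\<bar>scaled N j (X N t \<omega>) - scaled N j (X N 0 \<omega>)
        - integral {0..t} (\<lambda>u. if j = 0 then mu * real (X N u \<omega> 1) / real N
            else (mu * real (j + 1) * real (X N u \<omega> (j + 1)) - mu * real (X N u \<omega> 1)) / real N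
              - lam * (of_bool (partial_sum (j - 1) (X N u \<omega>) = 0) - of_bool (partial_sum j (X N u \<omega>) = 0)))\<bar> \<le> \<epsilon>0"
        if "j < d" "0 \<le> t" "t \<le> T" for j t
      proof -
        have "integral {0..t} (\<lambda>u. \<Sum>y\<in>states d (F N).
          jump_rate d lam mu N (X N u \<omega>) y * (scaled N j y - scaled N j (X N u \<omega>)))
          = integral {0..t} (\<lambda>u. if j = 0 then mu * real (X N u \<omega> 1) / real N
            else (mu * real (j + 1) * real (X N u \<omega> (j + 1)) - mu * real (X N u \<omega> 1)) / real N
              - lam * (of_bool (partial_sum (j - 1) (X N u \<omega>) = 0) - of_bool (partial_sum j (X N u \<omega>) = 0)))"
          using \<omega> by (intro integral_cong generator_scaled X_in_E finite_E elim(3) that(1)) auto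
        then show ?thesis using A(3)[of \<omega> j t] \<omega> that by (auto simp: B_def)
      qed
      have F': "\<bar>real (F N) / real N - \<beta>\<bar> \<le> \<epsilon>0" using elim(2) by (simp add: dist_real_def)
      have Y0: "X N 0 \<omega> = (\<lambda>i. if i = d then F N else 0)" using \<omega> Z(1) by (auto simp: B_def)
      note res = approx_skorohod_scaled[OF d elim(3) less_imp_le[OF mu] less_imp_le[OF T] Y0 * F']
      show ?thesis
        unfolding near_fluid_path_def
      proof (intro conjI ballI)
        show "path_in_states d (F N) (\<lambda>t. X N t \<omega>) lam" by unfold_locales
        show "approx_skorohod_solution d mu lam \<beta> T \<epsilon> (scaled_path N (\<lambda>t. X N t \<omega>)) (scaled_reflection lam (\<lambda>t. X N t \<omega>))"
          using res(1) unfolding \<epsilon>0(3) .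
        show "\<bar>real (X N t \<omega> 0) / real N - mu * integral {0..t} (\<lambda>u. scaled_path N (\<lambda>t. X N t \<omega>) u 1)\<bar> \<le> \<epsilon>"
          if "t \<in> {0..T}" for t using res(2)[of t] that \<epsilon>0(2) by simp
        show "\<bar>real (F N) / real N - \<beta>\<bar> \<le> \<epsilon>" using F' \<epsilon>0(2) by simp
      qed
    qed
    ultimately show ?case using B by blast
  qed
qed

text \<open>For every \<open>n\<close> one path of one process is picked outside an exceptional set.
  The picked paths may live on unrelated probability spaces; they are compared by the deterministic
  stability estimate alone.\<close>

lemma skorohod_solution_exists:
  fixes M :: "nat \<Rightarrow> 'w measure" and X :: "nat \<Rightarrow> real \<Rightarrow> 'w \<Rightarrow> nat \<Rightarrow> nat" and F :: "nat \<Rightarrow> nat"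
  assumes lam: "0 < lam" and mu: "0 < mu" and d: "2 \<le> d"
    and F: "(\<lambda>N. real (F N) / real N) \<longlonglongrightarrow> \<beta>"
    and mjp: "\<And>N. N \<ge> 1 \<Longrightarrow> markov_jump_process (M N) (states d (F N)) (jump_rate d lam mu N) (X N)"
    and init: "\<And>N. N \<ge> 1 \<Longrightarrow> AE \<omega> in M N. X N 0 \<omega> = (\<lambda>i. if i = d then F N else 0)"
  shows "\<exists>S R. skorohod_solution (d - 1) (\<lambda>h. G_functional d mu h \<beta> lam) P_matrix S R \<and>
    (\<forall>k\<in>{1..d - 1}. continuous_on {0..} (\<lambda>t. S t k))"
proof -
  have "\<exists>sr. approx_skorohod_solution d mu lam \<beta> (real n) (inverse (real (Suc n))) (fst sr) (snd sr) \<and>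
     (\<forall>k t u. 0 \<le> t \<longrightarrow> t \<le> u \<longrightarrow> snd sr u k - snd sr t k \<le> lam * (u - t))" for n
  proof -
    \<comment> \<open>Any bound below 1 leaves a point outside \<open>A\<close>. The horizon is
      \<open>Suc n\<close>, as a positive one is required and \<open>n\<close> may be 0.\<close>
    have "\<forall>\<^sub>F N in sequentially. \<exists>A\<in>sets (M N). measure (M N) A \<le> 1 / 2 \<and> (\<forall>\<omega>\<in>space (M N) - A.
        near_fluid_path d mu lam \<beta> (real (Suc n)) (inverse (real (Suc n))) N (F N) (\<lambda>t. X N t \<omega>))"
      by (rule scaled_process_approx[OF lam mu d F mjp init]) auto
    then have "\<forall>\<^sub>F N in sequentially. 1 \<le> N \<and> (\<exists>A\<in>sets (M N). measure (M N) A \<le> 1 / 2 \<and> (\<forall>\<omega>\<in>space (M N) - A.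
        near_fluid_path d mu lam \<beta> (real (Suc n)) (inverse (real (Suc n))) N (F N) (\<lambda>t. X N t \<omega>)))"
      using eventually_ge_at_top[of "1::nat"] by eventually_elim blast
    then obtain N A where N: "1 \<le> N" and A: "A \<in> sets (M N)" "measure (M N) A \<le> 1 / 2"
      "\<And>\<omega>. \<omega> \<in> space (M N) - A \<Longrightarrow>
        near_fluid_path d mu lam \<beta> (real (Suc n)) (inverse (real (Suc n))) N (F N) (\<lambda>t. X N t \<omega>)"
      unfolding eventually_sequentially by blast
    interpret prob_space "M N" using mjp[OF N] by (simp add: markov_jump_process_def)
    have "\<not> space (M N) \<subseteq> A"
    proof
      assume "space (M N) \<subseteq> A"
      then have "A = space (M N)" using sets.sets_into_space[OF A(1)] by blast
      then show False using A(2) prob_space by simp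
    qed
    then obtain \<omega> where \<omega>: "\<omega> \<in> space (M N) - A" by blast
    have "approx_skorohod_solution d mu lam \<beta> (real n) (inverse (real (Suc n)))
       (scaled_path N (\<lambda>t. X N t \<omega>)) (scaled_reflection lam (\<lambda>t. X N t \<omega>))"
      using A(3)[OF \<omega>] unfolding near_fluid_path_def approx_skorohod_solution_def by auto
    moreover have "scaled_reflection lam (\<lambda>t. X N t \<omega>) u k - scaled_reflection lam (\<lambda>t. X N t \<omega>) t k \<le> lam * (u - t)"
      if "0 \<le> t" "t \<le> u" for k t u
      using A(3)[OF \<omega>] that path_in_states.scaled_reflection_bounds(2) unfolding near_fluid_path_def by blast
    ultimately show ?thesis
      by (intro exI[of _ "(scaled_path N (\<lambda>t. X N t \<omega>), scaled_reflection lam (\<lambda>t. X N t \<omega>))"]) auto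
  qed
  then obtain sr where sr: "\<And>n. approx_skorohod_solution d mu lam \<beta> (real n) (inverse (real (Suc n))) (fst (sr n)) (snd (sr n))"
     "\<And>n k t u. 0 \<le> t \<Longrightarrow> t \<le> u \<Longrightarrow> snd (sr n) u k - snd (sr n) t k \<le> lam * (u - t)"
    by metis
  show ?thesis
    by (rule skorohod_solution_limit[OF less_imp_le[OF mu] d less_imp_le[OF lam] sr(1) LIMSEQ_inverse_real_of_nat sr(2)])
qed

text \<open>The bound is common to all coordinates. An intermediate level is a difference of two
  partial sums and costs \<open>2 * \<eta>\<close>. Level 0 costs
  \<open>\<epsilon> + mu * T * \<eta>\<close> after replacing the integrand. Level \<open>d\<close>
  adds to that an \<open>\<epsilon>\<close> for the mass and an \<open>\<eta>\<close> for the last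
  partial sum.\<close>

lemma scaled_path_coordinates_close:
  assumes d: "2 \<le> d" and N: "1 \<le> N" and mu: "0 < mu" and Y: "path_in_states d F Y lam"
    and S: "\<And>k. k \<in> {1..d - 1} \<Longrightarrow> continuous_on {0..} (\<lambda>t. S t k)"
    and close: "\<And>t k. k \<in> {1..d - 1} \<Longrightarrow> 0 \<le> t \<Longrightarrow> t \<le> T \<Longrightarrow> \<bar>scaled_path N Y t k - S t k\<bar> \<le> \<eta>"
    and zero: "\<And>t. 0 \<le> t \<Longrightarrow> t \<le> T \<Longrightarrow> \<bar>real (Y t 0) / real N - mu * integral {0..t} (\<lambda>u. scaled_path N Y u 1)\<bar> \<le> \<epsilon>"
    and F: "\<bar>real F / real N - \<beta>\<bar> \<le> \<epsilon>" and k: "k \<le> d" and t: "0 \<le> t" "t \<le> T"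
  shows "\<bar>real (Y t k) / real N - fluid_limit d mu \<beta> S t k\<bar> \<le> 2 * \<epsilon> + (2 + mu * T) * \<eta>"
proof -
  interpret path_in_states d F Y lam by (rule Y)
  have one: "1 \<in> {1..d - 1}" using d by auto
  have \<eta>: "0 \<le> \<eta>" using close[OF one t] by linarith
  have \<epsilon>: "0 \<le> \<epsilon>" using F by linarith
  have S_int: "(\<lambda>u. S u 1) integrable_on {0..t}"
    by (intro integrable_continuous_interval continuous_on_subset[OF S[OF one]]) auto
  have s_int: "(\<lambda>u. scaled_path N Y u 1) integrable_on {0..t}"
    unfolding scaled_path_def by (rule path_integrable)
  have "norm (integral {0..t} (\<lambda>u. scaled_path N Y u 1 - S u 1)) \<le> integral {0..t} (\<lambda>u. \<eta>)"
    using close[OF one] t by (intro integral_norm_bound_integral integrable_diff S_int s_int) auto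
  then have "\<bar>integral {0..t} (\<lambda>u. scaled_path N Y u 1) - integral {0..t} (\<lambda>u. S u 1)\<bar> \<le> t * \<eta>"
    unfolding Henstock_Kurzweil_Integration.integral_diff[OF s_int S_int] using t by simp
  also have "\<dots> \<le> T * \<eta>" using t \<eta> by (intro mult_right_mono) auto
  finally have "mu * \<bar>integral {0..t} (\<lambda>u. scaled_path N Y u 1) - integral {0..t} (\<lambda>u. S u 1)\<bar> \<le> mu * (T * \<eta>)"
    using mu by (intro mult_left_mono) auto
  then have "\<bar>mu * integral {0..t} (\<lambda>u. scaled_path N Y u 1) - mu * integral {0..t} (\<lambda>u. S u 1)\<bar> \<le> mu * T * \<eta>"
    using mu by (simp add: abs_mult flip: right_diff_distrib)
  then have y0: "\<bar>real (Y t 0) / real N - mu * integral {0..t} (\<lambda>u. S u 1)\<bar> \<le> \<epsilon> + mu * T * \<eta>"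
    using zero[OF t] by linarith
  have muT: "0 \<le> mu * T * \<eta>" using mu t \<eta> by simp
  have succ: "partial_sum j (Y t) = partial_sum (j - 1) (Y t) + real (Y t j)" if "1 \<le> j" for j
    using that by (cases j) (simp_all add: partial_sum_def)
  have sp: "scaled_path N Y t j = partial_sum j (Y t) / real N" if "1 \<le> j" for j
    using that by (simp add: scaled_path_def scaled_def)
  consider "k = 0" | "k = 1" | "2 \<le> k" "k < d" | "k = d" using k by linarith
  then have "\<bar>real (Y t k) / real N - fluid_limit d mu \<beta> S t k\<bar> \<le> 2 * \<epsilon> + 2 * \<eta> + mu * T * \<eta>"
  proof cases
    case 1
    then show ?thesis using y0 \<epsilon> \<eta> by (simp add: fluid_limit_def)
  next
    case 2
    have "scaled_path N Y t 1 = real (Y t 1) / real N" by (simp add: sp partial_sum_def)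
    then show ?thesis using 2 close[OF one t] \<epsilon> \<eta> muT by (simp add: fluid_limit_def)
  next
    case 3
    then have "k \<in> {1..d - 1}" "k - 1 \<in> {1..d - 1}" by auto
    moreover have "real (Y t k) / real N = scaled_path N Y t k - scaled_path N Y t (k - 1)"
      using 3 succ[of k] by (simp add: sp add_divide_distrib)
    moreover have "fluid_limit d mu \<beta> S t k = S t k - S t (k - 1)" using 3 by (simp add: fluid_limit_def)
    ultimately show ?thesis using close[of k t] close[of "k - 1" t] t \<epsilon> \<eta> muT by linarith
  next
    case 4
    have "{..d} = insert 0 {1..d}" by auto
    then have "(\<Sum>i\<le>d. Y t i) = Y t 0 + (\<Sum>i\<in>{1..d}. Y t i)" by simp
    moreover have "(\<Sum>i\<le>d. Y t i) = F" using Y[OF t(1)] by (simp add: states_def)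
    ultimately have "real F = real (Y t 0) + partial_sum d (Y t)"
      by (simp add: partial_sum_def flip: of_nat_sum)
    then have "real (Y t d) / real N = real F / real N - scaled_path N Y t (d - 1) - real (Y t 0) / real N"
      using succ[of d] d by (simp add: sp add_divide_distrib)
    moreover have "fluid_limit d mu \<beta> S t k = \<beta> - S t (d - 1) - mu * integral {0..t} (\<lambda>u. S u 1)"
      using 4 d by (simp add: fluid_limit_def)
    moreover have "\<bar>scaled_path N Y t (d - 1) - S t (d - 1)\<bar> \<le> \<eta>" using d t by (intro close) auto
    ultimately show ?thesis using y0 F \<eta> unfolding \<open>k = d\<close> by linarith
  qed
  then show ?thesis by (simp add: algebra_simps)
qed

lemma fluid_limit_in_cadlag_paths:
  assumes d: "2 \<le> d" and S: "\<And>k. k \<in> {1..d - 1} \<Longrightarrow> continuous_on {0..} (\<lambda>t. S t k)"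
  shows "(\<lambda>t\<in>{0..}. \<lambda>k\<in>{0..d}. fluid_limit d mu \<beta> S t k) \<in> cadlag_paths {0..d}"
proof -
  have one: "1 \<in> {1..d - 1}" using d by auto
  have I: "continuous_on {0..} (\<lambda>t. integral {0..t} (\<lambda>u. S u 1))"
    by (intro continuous_on_integral_atLeast integrable_continuous_interval continuous_on_subset[OF S[OF one]]) auto
  have "continuous_on {0..} (\<lambda>t. fluid_limit d mu \<beta> S t k)" if "k \<le> d" for k
  proof -
    consider "k = 0" | "k = 1" | "2 \<le> k" "k < d" | "k = d" "2 \<le> k" using \<open>k \<le> d\<close> d by linarith
    then show ?thesis
    proof cases
      case 1
      then show ?thesis by (simp add: fluid_limit_def) (intro continuous_intros I[simplified])
    next
      case 2
      then show ?thesis using S[OF one] by (simp add: fluid_limit_def)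
    next
      case 3
      then have "k \<in> {1..d - 1}" "k - 1 \<in> {1..d - 1}" by auto
      then have "continuous_on {0..} (\<lambda>t. S t k - S t (k - 1))" by (intro continuous_intros S)
      then show ?thesis using 3 by (simp add: fluid_limit_def)
    next
      case 4
      have "d - 1 \<in> {1..d - 1}" using d by auto
      then have "continuous_on {0..} (\<lambda>t. \<beta> - S t (d - 1) - mu * integral {0..t} (\<lambda>u. S u 1))"
        by (intro continuous_intros S I)
      then show ?thesis using 4 by (simp add: fluid_limit_def)
    qed
  qed
  then have "continuous_on {0..} (\<lambda>t. (\<lambda>t\<in>{0..}. \<lambda>k\<in>{0..d}. fluid_limit d mu \<beta> S t k) t k)" if "k \<le> d" for k
    using that by (subst continuous_on_cong[OF refl, of _ _ "\<lambda>t. fluid_limit d mu \<beta> S t k"]) auto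
  then show ?thesis unfolding cadlag_paths_def by (auto intro: cadlag_continuous)
qed

section \<open>The law of the scaled process on path space, and its limit\<close>

context finite_markov_process
begin

text \<open>The \<sigma>-algebra is generated by the evaluations, so measurability reduces to single
  times and coordinates; what remains is that every path is cadlag.\<close>

lemma scaled_path_measurable:
  fixes \<phi> :: "'s \<Rightarrow> nat \<Rightarrow> real"
  shows "(\<lambda>\<omega>. \<lambda>t\<in>{0..}. \<lambda>k\<in>I. \<phi> (X t \<omega>) k) \<in> measurable M (cadlag_space I)"
  unfolding cadlag_space_def
proof (rule measurable_restrict_space2)
  show "(\<lambda>\<omega>. \<lambda>t\<in>{0..}. \<lambda>k\<in>I. \<phi> (X t \<omega>) k) \<in> space M \<rightarrow> cadlag_paths I"
  proof
    fix \<omega> assume \<omega>: "\<omega> \<in> space M"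
    have "cadlag (\<lambda>t. (\<lambda>t\<in>{0..}. \<lambda>k\<in>I. \<phi> (X t \<omega>) k) t k)" if "k \<in> I" for k
    proof -
      have c: "cadlag (\<lambda>t. \<phi> (X t \<omega>) k)" by (rule cadlag_path[OF \<omega>])
      have eq: "(\<lambda>t\<in>{0..}. \<lambda>k\<in>I. \<phi> (X t \<omega>) k) t k = \<phi> (X t \<omega>) k" if "0 \<le> t" for t
        using that \<open>k \<in> I\<close> by simp
      show ?thesis unfolding cadlag_def
      proof (intro conjI allI impI)
        fix t :: real assume t: "0 \<le> t"
        have "((\<lambda>t. \<phi> (X t \<omega>) k) \<longlongrightarrow> \<phi> (X t \<omega>) k) (at_right t)" using c t by (simp add: cadlag_def)
        \<comment> \<open>One-sided neighbourhoods of the relevant times can be taken in the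
          nonnegative half-line, so the default value of the restricted path at negative times does
          not enter.\<close>
        moreover have "\<forall>\<^sub>F u in at_right t. \<phi> (X u \<omega>) k = (\<lambda>t\<in>{0..}. \<lambda>k\<in>I. \<phi> (X t \<omega>) k) u k"
          using eq t unfolding eventually_at_filter by (intro always_eventually) auto
        ultimately show "((\<lambda>t. (\<lambda>t\<in>{0..}. \<lambda>k\<in>I. \<phi> (X t \<omega>) k) t k) \<longlongrightarrow> (\<lambda>t\<in>{0..}. \<lambda>k\<in>I. \<phi> (X t \<omega>) k) t k) (at_right t)"
          unfolding eq[OF t] by (rule Lim_transform_eventually)
      next
        fix t :: real assume t: "0 < t"
        then obtain l where "((\<lambda>t. \<phi> (X t \<omega>) k) \<longlongrightarrow> l) (at_left t)" using c unfolding cadlag_def by blast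
        moreover have "\<forall>\<^sub>F u in at_left t. \<phi> (X u \<omega>) k = (\<lambda>t\<in>{0..}. \<lambda>k\<in>I. \<phi> (X t \<omega>) k) u k"
          unfolding eventually_at_left_field using eq t by (intro exI[of _ 0]) auto
        ultimately show "\<exists>l. ((\<lambda>t. (\<lambda>t\<in>{0..}. \<lambda>k\<in>I. \<phi> (X t \<omega>) k) t k) \<longlongrightarrow> l) (at_left t)"
          by (blast intro: Lim_transform_eventually)
      qed
    qed
    then show "(\<lambda>t\<in>{0..}. \<lambda>k\<in>I. \<phi> (X t \<omega>) k) \<in> cadlag_paths I"
      unfolding cadlag_paths_def by auto
  qed
  show "(\<lambda>\<omega>. \<lambda>t\<in>{0..}. \<lambda>k\<in>I. \<phi> (X t \<omega>) k) \<in> measurable M (\<Pi>\<^sub>M t\<in>{0..}. \<Pi>\<^sub>M k\<in>I. borel)"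
    by (intro measurable_restrict measurable_function_X) auto
qed

end

lemma space_cadlag_space: "space (cadlag_space I) = cadlag_paths I"
  unfolding cadlag_space_def by (auto simp: space_restrict_space space_PiM cadlag_paths_def)

theorem theorem1:
  fixes lam mu \<beta> \<gamma> :: real and d :: nat and F :: "nat \<Rightarrow> nat"
    and M :: "nat \<Rightarrow> 'w measure" and X :: "nat \<Rightarrow> real \<Rightarrow> 'w \<Rightarrow> nat \<Rightarrow> nat"
  assumes "lam > 0" and "mu > 0" and "d \<ge> 2" and "\<beta> > 0" and "\<gamma> \<ge> 0"
    and "(\<lambda>N. (real (F N) - real N * \<beta>) / sqrt (real N)) \<longlonglongrightarrow> \<gamma>"
    and "\<And>N. N \<ge> 1 \<Longrightarrow>
           markov_jump_process (M N) (states d (F N)) (jump_rate d lam mu N) (X N)"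
    and "\<And>N. N \<ge> 1 \<Longrightarrow> AE \<omega> in M N. X N 0 \<omega> = (\<lambda>i. if i = d then F N else 0)"
  shows "\<exists>S R.
    skorohod_solution (d - 1) (\<lambda>h. G_functional d mu h \<beta> lam) P_matrix S R \<and>
    (\<forall>S' R'. skorohod_solution (d - 1) (\<lambda>h. G_functional d mu h \<beta> lam) P_matrix S' R' \<longrightarrow>
       (\<forall>t\<ge>0. \<forall>k\<in>{1..d - 1}. S' t k = S t k \<and> R' t k = R t k)) \<and>
    converge_in_law {0..d}
      (\<lambda>N. distr (M N) (cadlag_space {0..d})
         (\<lambda>\<omega>. \<lambda>t\<in>{0..}. \<lambda>k\<in>{0..d}. real (X N t \<omega> k) / real N))
      (return (cadlag_space {0..d}) (\<lambda>t\<in>{0..}. \<lambda>k\<in>{0..d}. fluid_limit d mu \<beta> S t k))"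
proof -
  note lam = assms(1) and mu = assms(2) and d = assms(3) and mjp = assms(7) and init = assms(8)
  \<comment> \<open>One more division by the square root of \<open>N\<close> turns the bound on
    fluctuations into convergence of the mass per unit \<open>N\<close>.\<close>
  have F: "(\<lambda>N. real (F N) / real N) \<longlonglongrightarrow> \<beta>"
  proof -
    have "(\<lambda>N. 1 / sqrt (real N)) \<longlonglongrightarrow> 0"
      by (rule tendsto_divide_0[OF tendsto_const filterlim_at_top_imp_at_infinity])
        (rule filterlim_compose[OF sqrt_at_top filterlim_real_sequentially])
    then have "(\<lambda>N. (real (F N) - real N * \<beta>) / sqrt (real N) * (1 / sqrt (real N)) + \<beta>) \<longlonglongrightarrow> \<gamma> * 0 + \<beta>"
      by (intro tendsto_intros assms(6))
    moreover have "\<forall>\<^sub>F N in sequentially.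
        (real (F N) - real N * \<beta>) / sqrt (real N) * (1 / sqrt (real N)) + \<beta> = real (F N) / real N"
      using eventually_ge_at_top[of 1] by eventually_elim (simp add: diff_divide_distrib)
    ultimately show ?thesis by (auto intro: Lim_transform_eventually)
  qed
  obtain S R where SR: "skorohod_solution (d - 1) (\<lambda>h. G_functional d mu h \<beta> lam) P_matrix S R"
    and S: "\<And>k. k \<in> {1..d - 1} \<Longrightarrow> continuous_on {0..} (\<lambda>t. S t k)"
    using skorohod_solution_exists[OF lam mu d F mjp init] by blast
  define x where "x = (\<lambda>t\<in>{0..}. \<lambda>k\<in>{0..d}. fluid_limit d mu \<beta> S t k)"
  define y where "y N \<omega> = (\<lambda>t\<in>{0..}. \<lambda>k\<in>{0..d}. real (X N t \<omega> k) / real N)" for N \<omega>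
  have x: "x \<in> cadlag_paths {0..d}" unfolding x_def by (rule fluid_limit_in_cadlag_paths[OF d S])
  have y: "y N \<in> measurable (M N) (cadlag_space {0..d})" if "1 \<le> N" for N
  proof -
    obtain p where "finite_markov_process (M N) (states d (F N)) (jump_rate d lam mu N) (X N) p"
      using markov_jump_processE[OF mjp[OF \<open>1 \<le> N\<close>]] by blast
    then show ?thesis
      unfolding y_def using finite_markov_process.scaled_path_measurable[of _ _ _ _ _ "\<lambda>x k. real (x k) / real N"] by blast
  qed
  \<comment> \<open>The limit is deterministic, so it suffices that \<open>y N\<close> lies, outside
    an event of small probability, in the neighbourhood \<open>U\<close> of \<open>x\<close> on
    which the test function is close to \<open>f x\<close>.\<close>
  have "converge_in_law {0..d} (\<lambda>N. distr (M N) (cadlag_space {0..d}) (y N)) (return (cadlag_space {0..d}) x)"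
    unfolding converge_in_law_def
  proof (intro allI impI, elim conjE)
    fix f :: "(real \<Rightarrow> nat \<Rightarrow> real) \<Rightarrow> real"
    assume f: "f \<in> borel_measurable (cadlag_space {0..d})"
      "continuous_map (ucc_topology {0..d}) euclidean f" "bounded (f ` cadlag_paths {0..d})"
    obtain B where B: "\<And>z. z \<in> cadlag_paths {0..d} \<Longrightarrow> \<bar>f z\<bar> \<le> B"
      using f(3) unfolding bounded_iff by auto
    have B0: "0 \<le> B" using B[OF x] by linarith
    have "\<forall>\<^sub>F N in sequentially. dist (\<integral>\<omega>. f (y N \<omega>) \<partial>M N) (f x) < \<eta>" if \<eta>: "0 < \<eta>" for \<eta>
    proof -
      define U where "U = {z \<in> topspace (ucc_topology {0..d}). f z \<in> ball (f x) (\<eta> / 2)}"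
      have "ucc_open {0..d} U"
        unfolding openin_ucc_topology[symmetric] U_def
        by (rule openin_continuous_map_preimage[OF f(2)]) simp
      moreover have "x \<in> U" using x \<eta> by (simp add: U_def topspace_ucc_topology)
      ultimately obtain T \<epsilon> where \<epsilon>: "0 < \<epsilon>" "\<And>z. z \<in> cadlag_paths {0..d} \<Longrightarrow>
          (\<forall>t\<in>{0..T}. \<forall>k\<in>{0..d}. \<bar>z t k - x t k\<bar> < \<epsilon>) \<Longrightarrow> z \<in> U"
        unfolding ucc_open_def by metis
      \<comment> \<open>The horizon of a basic neighbourhood may be negative, while
        \<open>scaled_process_approx\<close> needs a positive one.\<close>
      define T' where "T' = max T 1"
      have T': "0 < T'" "T \<le> T'" by (simp_all add: T'_def)
      obtain C where C: "0 \<le> C" "\<And>\<epsilon> \<epsilon>' s r s' r'. approx_skorohod_solution d mu lam \<beta> T' \<epsilon> s r \<Longrightarrow>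
          approx_skorohod_solution d mu lam \<beta> T' \<epsilon>' s' r' \<Longrightarrow>
          \<forall>t\<in>{0..T'}. \<forall>k\<in>{1..d - 1}. \<bar>s t k - s' t k\<bar> \<le> C * (\<epsilon> + \<epsilon>') \<and> \<bar>r t k - r' t k\<bar> \<le> C * (\<epsilon> + \<epsilon>')"
        using approx_skorohod_stability[OF less_imp_le[OF mu] d, of lam \<beta> T'] by blast
      \<comment> \<open>Inserting \<open>\<eta> = C * \<epsilon>1\<close> into
        \<open>scaled_path_coordinates_close\<close> gives the error \<open>c * \<epsilon>1\<close>;
        the 2 in the denominator of \<open>\<epsilon>1\<close> makes it strictly smaller than
        \<open>\<epsilon>\<close>.\<close>
      define c where "c = 2 + (2 + mu * T') * C"
      have c: "2 \<le> c" using mu T' C(1) by (simp add: c_def)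
      define \<epsilon>1 where "\<epsilon>1 = \<epsilon> / (2 * c)"
      have \<epsilon>1: "0 < \<epsilon>1" "c * \<epsilon>1 < \<epsilon>" using c \<epsilon>(1) by (simp_all add: \<epsilon>1_def)
      \<comment> \<open>On the exceptional set the test function differs from \<open>f x\<close> by
        at most \<open>2 * B\<close>, so that set contributes at most
        \<open>2 * B * \<delta>\<close>. The denominator \<open>2 * B + 1\<close> stays positive
        when \<open>B = 0\<close>.\<close>
      define \<delta> where "\<delta> = \<eta> / 4 / (2 * B + 1)"
      have \<delta>: "0 < \<delta>" "2 * B * \<delta> < \<eta> / 2"
      proof -
        show "0 < \<delta>" using \<eta> B0 by (simp add: \<delta>_def)
        have "2 * B * \<delta> \<le> (2 * B + 1) * \<delta>" using \<open>0 < \<delta>\<close> by (simp add: algebra_simps)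
        also have "\<dots> = \<eta> / 4"
        proof -
          have "2 * B + 1 \<noteq> 0" using B0 by linarith
          moreover have "a * (\<eta> / 4 / a) = \<eta> / 4" if "a \<noteq> 0" for a :: real using that by simp
          ultimately show ?thesis unfolding \<delta>_def by blast
        qed
        finally show "2 * B * \<delta> < \<eta> / 2" using \<eta> by linarith
      qed
      have "\<forall>\<^sub>F N in sequentially. 1 \<le> N" by (rule eventually_ge_at_top)
      moreover have "\<forall>\<^sub>F N in sequentially. \<exists>A\<in>sets (M N). measure (M N) A \<le> \<delta> \<and>
          (\<forall>\<omega>\<in>space (M N) - A. near_fluid_path d mu lam \<beta> T' \<epsilon>1 N (F N) (\<lambda>t. X N t \<omega>))"
        by (rule scaled_process_approx[OF lam mu d F mjp init T'(1) \<epsilon>1(1) \<delta>(1)])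
      ultimately show ?thesis
      proof eventually_elim
        case (elim N)
        interpret prob_space "M N" using mjp[OF elim(1)] by (simp add: markov_jump_process_def)
        obtain A where A: "A \<in> sets (M N)" "prob A \<le> \<delta>" and good: "\<And>\<omega>. \<omega> \<in> space (M N) - A \<Longrightarrow>
            near_fluid_path d mu lam \<beta> T' \<epsilon>1 N (F N) (\<lambda>t. X N t \<omega>)"
          using elim(2) by blast
        have yp: "y N \<omega> \<in> cadlag_paths {0..d}" if "\<omega> \<in> space (M N)" for \<omega>
          using measurable_space[OF y[OF elim(1)] that] by (simp add: space_cadlag_space)
        have fy [measurable]: "(\<lambda>\<omega>. f (y N \<omega>)) \<in> borel_measurable (M N)"
          using measurable_compose[OF y[OF elim(1)] f(1)] .
        have int: "integrable (M N) (\<lambda>\<omega>. f (y N \<omega>))"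
          using B yp by (intro integrable_bounded[where B=B]) auto
        have intA: "integrable (M N) (indicator A :: 'w \<Rightarrow> real)"
          using A(1) by (intro integrable_bounded[where B=1]) (auto simp: indicator_def)
        have "\<bar>f (y N \<omega>) - f x\<bar> \<le> \<eta> / 2 + 2 * B * indicator A \<omega>" if \<omega>: "\<omega> \<in> space (M N)" for \<omega>
        proof (cases "\<omega> \<in> A")
          case True
          then show ?thesis using B[OF yp[OF \<omega>]] B[OF x] \<eta> by simp
        next
          case False
          then have g: "path_in_states d (F N) (\<lambda>t. X N t \<omega>) lam"
            "approx_skorohod_solution d mu lam \<beta> T' \<epsilon>1 (scaled_path N (\<lambda>t. X N t \<omega>)) (scaled_reflection lam (\<lambda>t. X N t \<omega>))"
            "\<And>t. 0 \<le> t \<Longrightarrow> t \<le> T' \<Longrightarrow> \<bar>real (X N t \<omega> 0) / real N - mu * integral {0..t} (\<lambda>u. scaled_path N (\<lambda>t. X N t \<omega>) u 1)\<bar> \<le> \<epsilon>1"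
            "\<bar>real (F N) / real N - \<beta>\<bar> \<le> \<epsilon>1"
            using good[of \<omega>] \<omega> unfolding near_fluid_path_def by auto
          \<comment> \<open>The exact solution is an approximate one with error 0, so the stability
            constant multiplies \<open>\<epsilon>1\<close> alone.\<close>
          have "\<bar>scaled_path N (\<lambda>t. X N t \<omega>) t k - S t k\<bar> \<le> C * \<epsilon>1"
            if "k \<in> {1..d - 1}" "0 \<le> t" "t \<le> T'" for t k
            using C(2)[OF g(2) skorohod_solution_imp_approx[OF SR]] that by auto
          note close = scaled_path_coordinates_close[OF d elim(1) mu g(1) S this g(3,4)]
          have "\<bar>y N \<omega> t k - x t k\<bar> < \<epsilon>" if "t \<in> {0..T}" "k \<in> {0..d}" for t k
          proof -
            have "\<bar>y N \<omega> t k - x t k\<bar> \<le> 2 * \<epsilon>1 + (2 + mu * T') * (C * \<epsilon>1)"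
              using close[where k=k and t=t] that T'(2) by (simp add: y_def x_def)
            also have "\<dots> = c * \<epsilon>1" by (simp add: c_def algebra_simps)
            finally show ?thesis using \<epsilon>1(2) by linarith
          qed
          then have "y N \<omega> \<in> U" by (intro \<epsilon>(2) yp \<omega>) auto
          then have "\<bar>f (y N \<omega>) - f x\<bar> < \<eta> / 2" by (simp add: U_def dist_real_def abs_minus_commute)
          then show ?thesis using False by simp
        qed
        then have "(\<integral>\<omega>. \<bar>f (y N \<omega>) - f x\<bar> \<partial>M N) \<le> (\<integral>\<omega>. \<eta> / 2 + 2 * B * indicator A \<omega> \<partial>M N)"
          using int intA by (intro integral_mono) auto
        also have "\<dots> = \<eta> / 2 + 2 * B * prob A"
          using A(1) intA by (simp add: prob_space)
        also have "\<dots> \<le> \<eta> / 2 + 2 * B * \<delta>" using A(2) B0 by (intro add_mono mult_left_mono) auto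
        finally have "(\<integral>\<omega>. \<bar>f (y N \<omega>) - f x\<bar> \<partial>M N) < \<eta>" using \<delta>(2) by linarith
        moreover have "(\<integral>\<omega>. f (y N \<omega>) \<partial>M N) - f x = (\<integral>\<omega>. f (y N \<omega>) - f x \<partial>M N)"
          using int by (simp add: prob_space)
        moreover have "\<bar>\<integral>\<omega>. f (y N \<omega>) - f x \<partial>M N\<bar> \<le> (\<integral>\<omega>. \<bar>f (y N \<omega>) - f x\<bar> \<partial>M N)"
          by (rule integral_abs_bound)
        ultimately show "dist (\<integral>\<omega>. f (y N \<omega>) \<partial>M N) (f x) < \<eta>" unfolding dist_real_def by linarith
      qed
    qed
    then have "(\<lambda>N. \<integral>\<omega>. f (y N \<omega>) \<partial>M N) \<longlonglongrightarrow> f x" by (rule tendstoI)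
    \<comment> \<open>The processes are given for \<open>N \<ge> 1\<close>, so the change of
      variables to the law of \<open>y N\<close> is made eventually in \<open>N\<close>.\<close>
    moreover have "\<forall>\<^sub>F N in sequentially. (\<integral>\<omega>. f (y N \<omega>) \<partial>M N) = (\<integral>z. f z \<partial>distr (M N) (cadlag_space {0..d}) (y N))"
      using eventually_ge_at_top[of 1] by eventually_elim (rule integral_distr[symmetric, OF y f(1)])
    ultimately have "(\<lambda>N. \<integral>z. f z \<partial>distr (M N) (cadlag_space {0..d}) (y N)) \<longlonglongrightarrow> f x"
      by (rule Lim_transform_eventually)
    then show "(\<lambda>N. \<integral>z. f z \<partial>distr (M N) (cadlag_space {0..d}) (y N))
        \<longlonglongrightarrow> (\<integral>z. f z \<partial>return (cadlag_space {0..d}) x)"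
      using x f(1) by (subst integral_return) (auto simp: space_cadlag_space)
  qed
  then show ?thesis
    using SR skorohod_solution_unique[OF less_imp_le[OF mu] d SR]
    by (intro exI[of _ S] exI[of _ R]) (auto simp: y_def[abs_def] x_def)
qed

end
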